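(* For every fixed integer $k$, the problem Colored Gourd Placement restricted to instances using at most $k$ distinct colors can be solved in randomized polynomial time.
   Context: A board is a finite, connected set of cells of the regular hexagonal tiling of the plane. Two cells are adjacent if they share a side. A gourd is a piece covering two adjacent cells; each of its two ends carries a color. An instance of Colored Gourd Placement consists of: - a board with $2n+1$ cells, each cell carrying a color; - a multiset of $n$ gourds, each given by the pair of colors of its two ends. The question is whether all gourds can be placed on pairwise disjoint pairs of adjacent cells (leaving one cell empty) so that every gourd end lies on a cell of its own color. *)

theory Defs
  imports
    "HOL-Library.Multiset"
    "HOL-Computational_Algebra.Polynomial"
    "HOL-Probability.Probability"
begin

section \<open>Randomized polynomial time\<close>

text \<open>
  Probabilistic multitape Turing machines. States and tape symbols are initial segments of the
  naturals. Symbol 0 is the blank; symbols 1 and 2 are the input letters. The last argument of the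
  transition function is a fair coin that is tossed afresh in every step, so
  \<open>\<lambda>q ss. delta M q ss False\<close> and \<open>\<lambda>q ss. delta M q ss True\<close> are the usual two transition functions
  of a probabilistic machine.
\<close>

datatype move = Move_Left | Stay | Move_Right

record ptm =
  num_tapes :: nat
  num_symbols :: nat
  num_states :: nat
  start_state :: nat
  accept_state :: nat
  reject_state :: nat
  delta :: "nat \<Rightarrow> nat list \<Rightarrow> bool \<Rightarrow> nat \<times> (nat \<times> move) list"

text \<open>
  On a machine satisfying the following predicate, only the values of \<open>delta\<close> on a finite domain
  ever matter, so its transition function is a finite table.
\<close>

definition ptm_wf :: "ptm \<Rightarrow> bool" where
  "ptm_wf M \<longleftrightarrow>
     num_tapes M \<ge> 1 \<and> num_symbols M \<ge> 3 \<and>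
     start_state M < num_states M \<and> accept_state M < num_states M \<and>
     reject_state M < num_states M \<and> accept_state M \<noteq> reject_state M \<and>
     (\<forall>q ss b. q < num_states M \<and> length ss = num_tapes M \<and> (\<forall>s\<in>set ss. s < num_symbols M) \<longrightarrow>
        (case delta M q ss b of (q', as) \<Rightarrow>
           q' < num_states M \<and> length as = num_tapes M \<and>
           (\<forall>(s, d)\<in>set as. s < num_symbols M)))"

text \<open>A tape is a two-way infinite sequence of symbols together with the head position.\<close>

type_synonym tape = "(int \<Rightarrow> nat) \<times> int"

type_synonym config = "nat \<times> tape list"

definition read_tape :: "tape \<Rightarrow> nat" where
  "read_tape t = fst t (snd t)"

fun head_shift :: "move \<Rightarrow> int" where
  "head_shift Move_Left = - 1"
| "head_shift Stay = 0"
| "head_shift Move_Right = 1"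

fun act_tape :: "nat \<times> move \<Rightarrow> tape \<Rightarrow> tape" where
  "act_tape (s, d) (f, h) = (f(h := s), h + head_shift d)"

definition halted :: "ptm \<Rightarrow> config \<Rightarrow> bool" where
  "halted M c \<longleftrightarrow> fst c = accept_state M \<or> fst c = reject_state M"

definition ptm_step :: "ptm \<Rightarrow> bool \<Rightarrow> config \<Rightarrow> config" where
  "ptm_step M b c =
     (if halted M c then c
      else case delta M (fst c) (map read_tape (snd c)) b of
             (q', as) \<Rightarrow> (q', map2 act_tape as (snd c)))"

definition input_tape :: "bool list \<Rightarrow> tape" where
  "input_tape x =
     (\<lambda>i. if 0 \<le> i \<and> i < int (length x) then (if x ! nat i then 2 else 1) else 0, 0)"

definition initial_config :: "ptm \<Rightarrow> bool list \<Rightarrow> config" where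
  "initial_config M x =
     (start_state M, input_tape x # replicate (num_tapes M - 1) (\<lambda>_. 0, 0))"

definition ptm_run :: "ptm \<Rightarrow> bool list \<Rightarrow> bool list \<Rightarrow> config" where
  "ptm_run M x r = fold (ptm_step M) r (initial_config M x)"

definition accept_prob :: "ptm \<Rightarrow> bool list \<Rightarrow> nat \<Rightarrow> real" where
  "accept_prob M x T =
     measure_pmf.prob (pmf_of_set {r. length r = T}) {r. fst (ptm_run M x r) = accept_state M}"

text \<open>
  A decision problem is given by a set of instances, a predicate singling out the yes-instances, and
  an encoding of instances as bit strings. The machine halts in polynomial time on every bit string
  and for every outcome of its coin tosses; on instances it errs on one side only.
\<close>

definition solvable_in_randomized_poly_time ::
    "('i \<Rightarrow> bool list) \<Rightarrow> 'i set \<Rightarrow> ('i \<Rightarrow> bool) \<Rightarrow> bool" where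
  "solvable_in_randomized_poly_time enc insts yes \<longleftrightarrow>
     (\<exists>(M :: ptm) (p :: nat poly).
        ptm_wf M \<and>
        (\<forall>x r. length r = poly p (length x) \<longrightarrow> halted M (ptm_run M x r)) \<and>
        (\<forall>I\<in>insts.
           (yes I \<longrightarrow> accept_prob M (enc I) (poly p (length (enc I))) \<ge> 1 / 2) \<and>
           (\<not> yes I \<longrightarrow> accept_prob M (enc I) (poly p (length (enc I))) = 0)))"


section \<open>Colored gourd placement\<close>

text \<open>
  Cells of the hexagonal tiling in axial coordinates: with side length \<open>1 / sqrt 3\<close>, the cell
  \<open>(x, y)\<close> is centred at \<open>(x + y / 2, y * sqrt 3 / 2)\<close>, and two cells share a side iff their centres
  are at distance 1.
\<close>

type_synonym cell = "int \<times> int"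

type_synonym color = nat

definition adjacent :: "cell \<Rightarrow> cell \<Rightarrow> bool" where
  "adjacent u v \<longleftrightarrow>
     (fst v - fst u, snd v - snd u) \<in> {(1, 0), (0, 1), (-1, 1), (-1, 0), (0, -1), (1, -1)}"

definition connected_cells :: "cell set \<Rightarrow> bool" where
  "connected_cells B \<longleftrightarrow>
     (\<forall>u\<in>B. \<forall>v\<in>B. (u, v) \<in> {(a, b). a \<in> B \<and> b \<in> B \<and> adjacent a b}\<^sup>*)"

definition is_board :: "cell set \<Rightarrow> bool" where
  "is_board B \<longleftrightarrow> finite B \<and> B \<noteq> {} \<and> connected_cells B"

text \<open>
  The gourd with ends colored \<open>a\<close> and \<open>b\<close> is written \<open>(a, b)\<close> or \<open>(b, a)\<close>; the order is immaterial
  because a gourd \<open>(a, b)\<close> may be placed on a pair \<open>(u, v)\<close> of adjacent cells in either direction.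
  Below, \<open>(u, v) \<in> P\<close> means that the first end of a gourd lies on \<open>u\<close> and the second one on \<open>v\<close>.
\<close>

type_synonym gourd = "color \<times> color"

definition placeable :: "cell set \<Rightarrow> (cell \<Rightarrow> color) \<Rightarrow> gourd multiset \<Rightarrow> bool" where
  "placeable B col G \<longleftrightarrow>
     (\<exists>P :: (cell \<times> cell) set.
        P \<subseteq> B \<times> B \<and>
        (\<forall>(u, v)\<in>P. adjacent u v) \<and>
        (\<forall>(u, v)\<in>P. \<forall>(u', v')\<in>P. (u, v) \<noteq> (u', v') \<longrightarrow> {u, v} \<inter> {u', v'} = {}) \<and>
        image_mset (\<lambda>(u, v). (col u, col v)) (mset_set P) = G)"

text \<open>
  As problem input, a colored board is a list of its cells with their colors and the multiset of
  gourds is a list, both in arbitrary order.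
\<close>

record cgp =
  colored_cells :: "(cell \<times> color) list"
  gourd_list :: "gourd list"

definition cgp_board :: "cgp \<Rightarrow> cell set" where
  "cgp_board I = fst ` set (colored_cells I)"

definition cgp_color :: "cgp \<Rightarrow> cell \<Rightarrow> color" where
  "cgp_color I u = the (map_of (colored_cells I) u)"

definition cgp_gourds :: "cgp \<Rightarrow> gourd multiset" where
  "cgp_gourds I = mset (gourd_list I)"

definition cgp_instance :: "cgp \<Rightarrow> bool" where
  "cgp_instance I \<longleftrightarrow>
     distinct (map fst (colored_cells I)) \<and>
     is_board (cgp_board I) \<and>
     card (cgp_board I) = 2 * size (cgp_gourds I) + 1"

definition cgp_yes :: "cgp \<Rightarrow> bool" where
  "cgp_yes I \<longleftrightarrow> placeable (cgp_board I) (cgp_color I) (cgp_gourds I)"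

definition cgp_colors :: "cgp \<Rightarrow> color set" where
  "cgp_colors I =
     cgp_color I ` cgp_board I \<union> (\<Union>(a, b)\<in>set_mset (cgp_gourds I). {a, b})"


section \<open>Encoding of instances\<close>

text \<open>
  All numbers are written in binary, least significant bit first. The encodings are prefix-free:
  \<open>True\<close> announces a further bit of a number or a further element of a list, \<open>False\<close> ends it.
\<close>

fun enc_nat :: "nat \<Rightarrow> bool list" where
  "enc_nat n = (if n = 0 then [False] else True # odd n # enc_nat (n div 2))"

declare enc_nat.simps [simp del]

lemma enc_nat_0: "enc_nat 0 = [False]"
  by (subst enc_nat.simps) simp

lemma enc_nat_pos: "n \<noteq> 0 \<Longrightarrow> enc_nat n = True # odd n # enc_nat (n div 2)"
  by (subst enc_nat.simps) simp

definition enc_int :: "int \<Rightarrow> bool list" where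
  "enc_int i = (i < 0) # enc_nat (nat \<bar>i\<bar>)"

definition enc_pair :: "('a \<Rightarrow> bool list) \<Rightarrow> ('b \<Rightarrow> bool list) \<Rightarrow> 'a \<times> 'b \<Rightarrow> bool list" where
  "enc_pair f g z = f (fst z) @ g (snd z)"

fun enc_list :: "('a \<Rightarrow> bool list) \<Rightarrow> 'a list \<Rightarrow> bool list" where
  "enc_list f [] = [False]"
| "enc_list f (x # xs) = True # f x @ enc_list f xs"

definition enc_cgp :: "cgp \<Rightarrow> bool list" where
  "enc_cgp I =
     enc_list (enc_pair (enc_pair enc_int enc_int) enc_nat) (colored_cells I) @
     enc_list (enc_pair enc_nat enc_nat) (gourd_list I)"

definition prefix_free :: "('a \<Rightarrow> bool list) \<Rightarrow> bool" where
  "prefix_free f \<longleftrightarrow> (\<forall>x y r s. f x @ r = f y @ s \<longrightarrow> x = y \<and> r = s)"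

lemma prefix_free_enc_nat: "prefix_free enc_nat"
proof -
  have "m = n \<and> r = s" if "enc_nat m @ r = enc_nat n @ s" for m n r s
    using that
  proof (induction m arbitrary: n rule: less_induct)
    case (less m)
    show ?case
    proof (cases "m = 0 \<or> n = 0")
      case True
      then show ?thesis
        using less.prems by (cases "m = 0"; cases "n = 0") (simp_all add: enc_nat_0 enc_nat_pos)
    next
      case False
      then have odd: "odd m = odd n"
        and rest: "enc_nat (m div 2) @ r = enc_nat (n div 2) @ s"
        using less.prems by (simp_all add: enc_nat_pos)
      have "m div 2 = n div 2 \<and> r = s"
        using False by (intro less.IH rest) simp
      moreover have "m = n" if "m div 2 = n div 2"
        using odd that by presburger
      ultimately show ?thesis by blast
    qed
  qed
  then show ?thesis
    unfolding prefix_free_def by blast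
qed

lemma prefix_free_enc_int: "prefix_free enc_int"
  unfolding prefix_free_def enc_int_def
proof (intro allI impI)
  fix i j :: int and r s
  assume "((i < 0) # enc_nat (nat \<bar>i\<bar>)) @ r = ((j < 0) # enc_nat (nat \<bar>j\<bar>)) @ s"
  then have sign: "(i < 0) = (j < 0)"
    and rest: "enc_nat (nat \<bar>i\<bar>) @ r = enc_nat (nat \<bar>j\<bar>) @ s"
    by simp_all
  from rest prefix_free_enc_nat have eq: "nat \<bar>i\<bar> = nat \<bar>j\<bar>" "r = s"
    unfolding prefix_free_def by blast+
  from eq(1) have "\<bar>i\<bar> = \<bar>j\<bar>"
    by (simp add: nat_eq_iff)
  with sign have "i = j"
    by (cases "i < 0") simp_all
  with eq(2) show "i = j \<and> r = s" by simp
qed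

lemma prefix_free_enc_pair:
  assumes "prefix_free f" "prefix_free g"
  shows "prefix_free (enc_pair f g)"
  unfolding prefix_free_def enc_pair_def
proof (intro allI impI)
  fix x y :: "'a \<times> 'b" and r s
  assume "(f (fst x) @ g (snd x)) @ r = (f (fst y) @ g (snd y)) @ s"
  then have eq: "f (fst x) @ (g (snd x) @ r) = f (fst y) @ (g (snd y) @ s)"
    by simp
  from assms(1) eq have "fst x = fst y" "g (snd x) @ r = g (snd y) @ s"
    unfolding prefix_free_def by blast+
  moreover from assms(2) this(2) have "snd x = snd y" "r = s"
    unfolding prefix_free_def by blast+
  ultimately show "x = y \<and> r = s"
    by (simp add: prod_eq_iff)
qed

lemma prefix_free_enc_list:
  assumes "prefix_free f"
  shows "prefix_free (enc_list f)"
proof -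
  have "xs = ys \<and> r = s" if "enc_list f xs @ r = enc_list f ys @ s" for xs ys r s
    using that
  proof (induction xs arbitrary: ys)
    case Nil
    then show ?case by (cases ys) auto
  next
    case (Cons x xs)
    then obtain y ys' where ys: "ys = y # ys'" by (cases ys) auto
    with Cons.prems have "f x @ enc_list f xs @ r = f y @ enc_list f ys' @ s" by simp
    with assms have "x = y" "enc_list f xs @ r = enc_list f ys' @ s"
      unfolding prefix_free_def by blast+
    with Cons.IH ys show ?case by blast
  qed
  then show ?thesis
    unfolding prefix_free_def by blast
qed

lemma inj_enc_cgp: "inj enc_cgp"
proof (rule injI)
  fix I J :: cgp
  assume eq: "enc_cgp I = enc_cgp J"
  let ?f = "enc_list (enc_pair (enc_pair enc_int enc_int) enc_nat)"
  let ?g = "enc_list (enc_pair enc_nat enc_nat)"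
  have pf: "prefix_free (enc_pair ?f ?g)"
    by (intro prefix_free_enc_pair prefix_free_enc_list prefix_free_enc_nat prefix_free_enc_int)
  have "enc_pair ?f ?g (colored_cells I, gourd_list I) @ [] =
        enc_pair ?f ?g (colored_cells J, gourd_list J) @ []"
    using eq by (simp add: enc_cgp_def enc_pair_def)
  with pf have "(colored_cells I, gourd_list I) = (colored_cells J, gourd_list J)"
    unfolding prefix_free_def by blast
  then show "I = J" by simp
qed

end

theory Submission
  imports Defs "HOL-Computational_Algebra.Formal_Power_Series" "HOL-Library.Poly_Mapping" "HOL-Library.Z2"
begin

text \<open>
  With at most \<open>k\<close> colors there are at most \<open>k\<^sup>2\<close> types of gourds, and the instance is solvable iff the
  cell graph, with each edge typed by the colors of its ends, has a matching with a prescribed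
  number of edges of each type. Give every edge a random polynomial over the field with two elements
  and mark its type by an indeterminate. Squaring is injective in characteristic two, so by the
  argument of Schwartz and Zippel the sum of the squared weights of the wanted matchings vanishes
  with probability at most 1/2 if there are any, and always if there are none. In characteristic two
  this sum is a sum over clow sequences in the sense of Mahajan and Vinay, because a closed walk and
  its reversal cancel. Its coefficients are therefore parities of numbers of walks in a graph of
  polynomial size, whose vertices record the position in the clow sequence, the exponent, and the
  numbers of edges of each type.

  Polynomial time is established by a small logic: relations between positions of the padded input
  are closed under Boolean connectives, quantifiers and walk parities, and each of them is evaluated
  by a structured program on a multitape machine. Reachability along deterministic steps is a walk
  parity, which suffices to parse the encoding.
\<close>

section \<open>Structured programs and their compilation\<close>

text \<open>The logic can count only through parities of walk numbers, and this dictates the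
  algebra. Arithmetic in a large field of characteristic two would have to be programmed;
  polynomials over F_2 serve instead, because they form an integral domain and each of their
  coefficients is one bit, hence a parity. An edge gets \<open>L\<close> random coefficients,
  \<open>L\<close> being the input length, so that a block of bits takes a given value with
  probability \<open>1 / 2 ^ L\<close>, while a wanted matching has at most \<open>L / 3\<close>
  edges. Padding to more than \<open>L * L\<close> positions turns the exponents of all squared
  weights into positions. The number \<open>k\<close> of colors enters through tuple lengths such as
  \<open>3 + k * k\<close>, which keeps the walk tables polynomial for fixed \<open>k\<close>. A
  walk may meet the bits of an edge repeatedly and in both directions, so all coins are tossed
  beforehand and kept on a tape. Errors are one-sided because every nonzero coefficient stems from
  an actual matching; the representatives of the types, the exponent and the length can therefore be
  searched for existentially.\<close>

type_synonym state = "nat \<Rightarrow> tape"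

text \<open>Guards and written symbols may depend on all scanned symbols at once, and a written
  symbol also on the coin: this is what one entry of a multitape transition table can
  express.\<close>

datatype com =
    Write nat "(nat \<Rightarrow> nat) \<Rightarrow> bool \<Rightarrow> nat"
  | Move nat move
  | Seq com com
  | Cond "(nat \<Rightarrow> nat) \<Rightarrow> bool" com com
  | While "(nat \<Rightarrow> nat) \<Rightarrow> bool" com

abbreviation reads :: "state \<Rightarrow> nat \<Rightarrow> nat" where
  "reads s \<equiv> \<lambda>i. read_tape (s i)"

text \<open>Control is a stack of pending commands. Every unfolding, even of \<open>Seq\<close> or
  of a guard, costs one step and one coin, so that a stack can become a machine state and step
  counts are exact.\<close>

fun next_com :: "com list \<Rightarrow> (nat \<Rightarrow> nat) \<Rightarrow> bool \<Rightarrow> com list" where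
  "next_com [] rd b = []"
| "next_com (Write i f # k) rd b = k"
| "next_com (Move i d # k) rd b = k"
| "next_com (Seq c1 c2 # k) rd b = c1 # c2 # k"
| "next_com (Cond g c1 c2 # k) rd b = (if g rd then c1 else c2) # k"
| "next_com (While g c # k) rd b = (if g rd then c # While g c # k else k)"

text \<open>A machine acts on all tapes in every step; a tape that is not addressed rewrites the
  symbol just read and stays.\<close>

fun action :: "com list \<Rightarrow> (nat \<Rightarrow> nat) \<Rightarrow> bool \<Rightarrow> nat \<Rightarrow> nat \<times> move" where
  "action (Write i f # k) rd b j = (if j = i then f rd b else rd j, Stay)"
| "action (Move i d # k) rd b j = (rd j, if j = i then d else Stay)"
| "action k rd b j = (rd j, Stay)"

definition com_step :: "bool \<Rightarrow> com list \<times> state \<Rightarrow> com list \<times> state" where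
  "com_step b = (\<lambda>(k, s). (next_com k (reads s) b, \<lambda>j. act_tape (action k (reads s) b j) (s j)))"

text \<open>The coins \<open>r\<close> are exactly those consumed by \<open>c\<close>. Quantifying
  over the stack \<open>k\<close> underneath makes executions compose.\<close>

definition exec :: "com \<Rightarrow> state \<Rightarrow> bool list \<Rightarrow> state \<Rightarrow> bool" where
  "exec c s r s' \<longleftrightarrow> (\<forall>k. fold com_step r (c # k, s) = (k, s'))"

lemma act_tape_read [simp]: "act_tape (read_tape t, d) t = (fst t, snd t + head_shift d)"
  by (cases t) (simp add: read_tape_def)

lemma exec_Write:
  "exec (Write i f) s [b] (s(i := ((fst (s i))(snd (s i) := f (reads s) b), snd (s i))))"
  unfolding exec_def by (auto simp: com_step_def fun_eq_iff prod_eq_iff) (cases "s i"; simp)+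

lemma exec_Move:
  "exec (Move i d) s [b] (s(i := (fst (s i), snd (s i) + head_shift d)))"
  unfolding exec_def by (auto simp: com_step_def fun_eq_iff)

lemma exec_Seq:
  assumes "exec c1 s r1 s1" "exec c2 s1 r2 s2"
  shows "exec (Seq c1 c2) s (b # r1 @ r2) s2"
  using assms unfolding exec_def by (simp add: com_step_def)

lemma exec_Cond:
  assumes "exec (if g (reads s) then c1 else c2) s r s'"
  shows "exec (Cond g c1 c2) s (b # r) s'"
  using assms unfolding exec_def by (simp add: com_step_def)

lemma exec_While_False:
  assumes "\<not> g (reads s)"
  shows "exec (While g c) s [b] s"
  using assms unfolding exec_def by (simp add: com_step_def)

lemma exec_While_True:
  assumes "g (reads s)" "exec c s r1 s1" "exec (While g c) s1 r2 s2"
  shows "exec (While g c) s (b # r1 @ r2) s2"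
  using assms unfolding exec_def by (simp add: com_step_def)

text \<open>The machine alphabet has six symbols; the programs below write only the blank 0, the
  bits 1 and 2, the padding 3, and copies of scanned symbols.\<close>

fun wf_com :: "com \<Rightarrow> bool" where
  "wf_com (Write i f) \<longleftrightarrow> (\<forall>rd b. (\<forall>j. rd j < 6) \<longrightarrow> f rd b < 6)"
| "wf_com (Move i d) \<longleftrightarrow> True"
| "wf_com (Seq c1 c2) \<longleftrightarrow> wf_com c1 \<and> wf_com c2"
| "wf_com (Cond g c1 c2) \<longleftrightarrow> wf_com c1 \<and> wf_com c2"
| "wf_com (While g c) \<longleftrightarrow> wf_com c"

fun tape_bound :: "com \<Rightarrow> nat" where
  "tape_bound (Write i f) = Suc i"
| "tape_bound (Move i d) = Suc i"
| "tape_bound (Seq c1 c2) = max (tape_bound c1) (tape_bound c2)"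
| "tape_bound (Cond g c1 c2) = max (tape_bound c1) (tape_bound c2)"
| "tape_bound (While g c) = tape_bound c"

text \<open>The stacks that arise while \<open>c\<close> runs on top of \<open>k\<close>. A loop
  body runs on top of its own loop, so no stack grows with the number of iterations and the set is
  finite.\<close>

fun conts :: "com \<Rightarrow> com list \<Rightarrow> com list set" where
  "conts (Write i f) k = {Write i f # k}"
| "conts (Move i d) k = {Move i d # k}"
| "conts (Seq c1 c2) k = {Seq c1 c2 # k} \<union> conts c1 (c2 # k) \<union> conts c2 k"
| "conts (Cond g c1 c2) k = {Cond g c1 c2 # k} \<union> conts c1 k \<union> conts c2 k"
| "conts (While g c) k = {While g c # k} \<union> conts c (While g c # k)"

lemma finite_conts: "finite (conts c k)"
  by (induction c arbitrary: k) auto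

lemma self_in_conts: "c # k \<in> conts c k"
  by (cases c) auto

lemma conts_step: "l \<in> conts c k \<Longrightarrow> next_com l rd b \<in> insert k (conts c k)"
proof (induction c arbitrary: k)
  case (Seq c1 c2)
  consider "l = Seq c1 c2 # k" | "l \<in> conts c1 (c2 # k)" | "l \<in> conts c2 k"
    using Seq.prems by auto
  then show ?case
  proof cases
    case 2
    from Seq.IH(1)[OF this] show ?thesis using self_in_conts[of c2 k] by auto
  next
    case 3
    from Seq.IH(2)[OF this] show ?thesis by auto
  qed (use self_in_conts[of c1 "c2 # k"] in auto)
next
  case (Cond g c1 c2)
  consider "l = Cond g c1 c2 # k" | "l \<in> conts c1 k" | "l \<in> conts c2 k"
    using Cond.prems by auto
  then show ?case
  proof cases
    case 2
    from Cond.IH(1)[OF this] show ?thesis by auto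
  next
    case 3
    from Cond.IH(2)[OF this] show ?thesis by auto
  qed (use self_in_conts[of c1 k] self_in_conts[of c2 k] in auto)
next
  case (While g c)
  consider "l = While g c # k" | "l \<in> conts c (While g c # k)"
    using While.prems by auto
  then show ?case
  proof cases
    case 2
    from While.IH[OF this] show ?thesis by auto
  qed (use self_in_conts[of c "While g c # k"] in auto)
qed auto

lemma conts_action:
  assumes "l \<in> conts c k" "wf_com c" "\<And>j. rd j < 6"
  shows "fst (action l rd b j) < 6"
  using assms by (induction c arbitrary: k) auto

lemma conts_frame:
  assumes "l \<in> conts c k" "j \<ge> tape_bound c"
  shows "action l rd b j = (rd j, Stay)"
  using assms by (induction c arbitrary: k) auto

definition list_reads :: "nat list \<Rightarrow> nat \<Rightarrow> nat" where
  "list_reads ss j = (if j < length ss then ss ! j else 0)"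

text \<open>
  States \<open>0\<close> and \<open>1\<close> halt, and state \<open>q + 2\<close> stands for the continuation \<open>de q\<close>.
\<close>

definition compile :: "com \<Rightarrow> nat \<Rightarrow> (com list \<Rightarrow> nat) \<Rightarrow> (nat \<Rightarrow> com list) \<Rightarrow> nat \<Rightarrow> ptm" where
  "compile c M en de n = \<lparr>num_tapes = M, num_symbols = 6, num_states = n + 2,
     start_state = en [c] + 2, accept_state = 0, reject_state = 1,
     delta = (\<lambda>q ss b.
       if q < 2 then (q, map (\<lambda>s. (s, Stay)) ss)
       else (case de (q - 2) of
           [] \<Rightarrow> (if list_reads ss 2 = 2 then 0 else 1, map (\<lambda>s. (s, Stay)) ss)
         | l \<Rightarrow> (en (next_com l (list_reads ss) b) + 2,
                 map (action l (list_reads ss) b) [0..<M])))\<rparr>"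

definition input_state :: "bool list \<Rightarrow> state" where
  "input_state x = (\<lambda>_. (\<lambda>_. 0, 0))(0 := input_tape x)"

text \<open>The stacks in \<open>conts\<close> are the states, and a \<open>com_step\<close> is a
  machine step. The additional coin \<open>b\<close> drives the last step, in which the empty stack
  inspects tape 2 and enters a halting state.\<close>

theorem compile_correct:
  assumes wf: "wf_com c"
  obtains M where "ptm_wf M" "accept_state M = 0"
    "\<And>x r b s'. fold com_step r ([c], input_state x) = ([], s') \<Longrightarrow>
       halted M (ptm_run M x (r @ [b])) \<and>
       (fst (ptm_run M x (r @ [b])) = 0 \<longleftrightarrow> read_tape (s' 2) = 2)"
proof -
  define K where "K = insert [] (conts c [])"
  define n where "n = card K"
  \<comment> \<open>At least three tapes, because the result is read from tape 2.\<close>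
  define T where "T = max 3 (tape_bound c)"
  have "finite K" by (simp add: K_def finite_conts)
  then obtain en where en: "bij_betw en K {0..<n}"
    using ex_bij_betw_finite_nat n_def by blast
  define de where "de = inv_into K en"
  have de: "de (en l) = l" if "l \<in> K" for l
    using en that by (simp add: de_def bij_betw_inv_into_left)
  have en_less: "en l < n" if "l \<in> K" for l
    using en that by (auto simp: bij_betw_def)
  have de_in: "de q \<in> K" if "q < n" for q
    using en that unfolding de_def by (metis atLeastLessThan_iff bij_betw_def inv_into_into le0)
  have step_in: "next_com l rd b \<in> K" if "l \<in> K" for l rd b
    using that conts_step[of l c "[]"] by (auto simp: K_def)
  have c_in: "[c] \<in> K" using self_in_conts[of c "[]"] by (simp add: K_def)
  define M where "M = compile c T en de n"
  have wfM: "ptm_wf M"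
    unfolding ptm_wf_def
  proof (intro conjI allI impI)
    show "start_state M < num_states M" using en_less[OF c_in] by (simp add: M_def compile_def)
  next
    fix q ss b
    assume A: "q < num_states M \<and> length ss = num_tapes M \<and> (\<forall>s\<in>set ss. s < num_symbols M)"
    then have len: "length ss = T" and ss: "\<forall>s\<in>set ss. s < 6" and q: "q < n + 2"
      by (auto simp: M_def compile_def)
    have rd: "list_reads ss j < 6" for j using ss by (auto simp: list_reads_def)
    show "case delta M q ss b of (q', as) \<Rightarrow>
           q' < num_states M \<and> length as = num_tapes M \<and> (\<forall>(s, d)\<in>set as. s < num_symbols M)"
    proof (cases "q < 2 \<or> de (q - 2) = []")
      case True
      then show ?thesis using len ss q by (auto simp: M_def compile_def)
    next
      case False
      then obtain a l where al: "de (q - 2) = a # l" by (cases "de (q - 2)") auto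
      have K: "a # l \<in> K" using de_in[of "q - 2"] al False q by simp
      then have "a # l \<in> conts c []" by (simp add: K_def)
      from conts_action[OF this wf rd]
      have "fst (action (a # l) (list_reads ss) b j) < 6" for j .
      then show ?thesis using False al en_less[OF step_in[OF K]]
        by (auto simp: M_def compile_def split: prod.splits) (metis fst_conv)
    qed
  qed (auto simp: M_def compile_def T_def)
  define cfg where "cfg = (\<lambda>(l, s :: state). (en l + 2, map s [0..<T]))"
  define inv where "inv = (\<lambda>(l, s :: state). l \<in> K \<and> (\<forall>j\<ge>T. s j = (\<lambda>_. 0, 0)))"
  have step: "ptm_step M b (cfg (l, s)) = cfg (com_step b (l, s)) \<and> inv (com_step b (l, s))"
    if "inv (l, s)" and ne: "l \<noteq> []" for l s b
  proof -
    obtain a l' where l: "l = a # l'" using ne by (cases l) auto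
    have K: "l \<in> K" and blank: "\<And>j. j \<ge> T \<Longrightarrow> s j = (\<lambda>_. 0, 0)"
      using that(1) by (auto simp: inv_def)
    \<comment> \<open>Tapes from \<open>T\<close> on are never touched and stay blank, so the value
      0 that \<open>list_reads\<close> returns there agrees with an actual reading.\<close>
    have rd: "list_reads (map read_tape (map s [0..<T])) = reads s"
      using blank by (auto simp: list_reads_def fun_eq_iff read_tape_def)
    have C: "l \<in> conts c []" using K that(2) by (simp add: K_def)
    have "delta M (en l + 2) (map read_tape (map s [0..<T])) b =
        (en (next_com l (reads s) b) + 2, map (action l (reads s) b) [0..<T])"
      unfolding M_def compile_def using de[OF K] l by (simp add: rd del: map_map)
    then have "ptm_step M b (cfg (l, s)) = cfg (com_step b (l, s))"
      by (auto simp: ptm_step_def cfg_def halted_def com_step_def M_def compile_def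
          simp del: map_map intro!: nth_equalityI)
    moreover have "inv (com_step b (l, s))"
      using step_in[OF K] conts_frame[OF C] blank
      by (auto simp: inv_def com_step_def T_def read_tape_def)
    ultimately show ?thesis ..
  qed
  have nil: "com_step b ([], s) = ([], s)" for b s
    by (simp add: com_step_def)
  have nil_fold: "fold com_step r ([], s) = ([], s)" for r s
    by (induction r) (simp_all add: nil)
  have nil_step: "ptm_step M b (cfg ([], s)) = (if read_tape (s 2) = 2 then 0 else 1, map s [0..<T])" for s b
    using de[of "[]"]
    by (auto simp: ptm_step_def cfg_def halted_def M_def compile_def K_def T_def list_reads_def
        numeral_2_eq_2 intro!: nth_equalityI)
  have halted: "ptm_step M b (q, ts) = (q, ts)" if "q < 2" for q ts b
    using that by (auto simp: ptm_step_def halted_def M_def compile_def)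
  have halted_fold: "fold (ptm_step M) r (q, ts) = (q, ts)" if "q < 2" for q ts r
    by (induction r) (simp_all add: halted that)
  have run: "fold (ptm_step M) (r @ [b]) (cfg (l, s)) = (if read_tape (s' 2) = 2 then 0 else 1, map s' [0..<T])"
    if "inv (l, s)" "fold com_step r (l, s) = ([], s')" for r l s s' b
    using that
  proof (induction r arbitrary: l s)
    case Nil
    then show ?case by (simp add: nil_step)
  next
    case (Cons c r)
    show ?case
    proof (cases "l = []")
      case True
      then have "s = s'" using Cons.prems(2) by (simp add: nil nil_fold)
      then show ?thesis using True by (simp add: nil_step halted_fold del: fold_append)
    next
      case False
      obtain l' s1 where eq: "com_step c (l, s) = (l', s1)" by force
      show ?thesis using step[OF Cons.prems(1) False, of c] Cons.IH[of l' s1] Cons.prems(2) eq by simp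
    qed
  qed
  have init: "initial_config M x = cfg ([c], input_state x)" for x
    by (auto simp: initial_config_def cfg_def M_def compile_def input_state_def T_def
        nth_Cons intro!: nth_equalityI split: nat.splits)
  have inv0: "inv ([c], input_state x)" for x
    using c_in by (auto simp: inv_def input_state_def T_def)
  show ?thesis
  proof
    show "ptm_wf M" by (fact wfM)
    show "accept_state M = 0" by (simp add: M_def compile_def)
    fix x r b s' assume "fold com_step r ([c], input_state x) = ([], s')"
    from run[OF inv0 this, of b] init
    have "ptm_run M x (r @ [b]) = (if read_tape (s' 2) = 2 then 0 else 1, map s' [0..<T])"
      by (simp add: ptm_run_def)
    then show "halted M (ptm_run M x (r @ [b])) \<and>
       (fst (ptm_run M x (r @ [b])) = 0 \<longleftrightarrow> read_tape (s' 2) = 2)"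
      by (auto simp: halted_def M_def compile_def)
  qed
qed

section \<open>Coin-free execution\<close>

text \<open>The number \<open>t\<close> is only a bound, but the exact duration \<open>n\<close> is
  the same for all outcomes of the coins. Whatever follows a coin-free program therefore starts at a
  known index of the coin string.\<close>

definition runs :: "com \<Rightarrow> state \<Rightarrow> state \<Rightarrow> nat \<Rightarrow> bool" where
  "runs c s s' t \<longleftrightarrow> (\<exists>n\<le>t. \<forall>r. length r = n \<longrightarrow> exec c s r s')"

lemma runs_cong:
  assumes "runs c s s' t" "s' = s''" "t \<le> t'"
  shows "runs c s s'' t'"
  using assms unfolding runs_def by (meson le_trans)

lemma runs_Write:
  assumes "f (reads s) False = v" "f (reads s) True = v"
  shows "runs (Write i f) s (s(i := ((fst (s i))(snd (s i) := v), snd (s i)))) 1"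
  unfolding runs_def
proof (intro exI[of _ 1] conjI allI impI)
  fix r :: "bool list" assume "length r = 1"
  then obtain b where "r = [b]" by (auto simp: length_Suc_conv)
  moreover have "f (reads s) b = v" using assms by (cases b) auto
  ultimately show "exec (Write i f) s r (s(i := ((fst (s i))(snd (s i) := v), snd (s i))))"
    using exec_Write[of i f s b] by simp
qed simp

lemma runs_Move: "runs (Move i d) s (s(i := (fst (s i), snd (s i) + head_shift d))) 1"
  unfolding runs_def
proof (intro exI[of _ 1] conjI allI impI)
  fix r :: "bool list" assume "length r = 1"
  then obtain b where "r = [b]" by (auto simp: length_Suc_conv)
  then show "exec (Move i d) s r (s(i := (fst (s i), snd (s i) + head_shift d)))"
    using exec_Move by simp
qed simp

lemma runs_Seq:
  assumes "runs c1 s s1 t1" "runs c2 s1 s2 t2"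
  shows "runs (Seq c1 c2) s s2 (t1 + t2 + 1)"
proof -
  obtain n1 where n1: "n1 \<le> t1" "\<And>r. length r = n1 \<Longrightarrow> exec c1 s r s1"
    using assms(1) unfolding runs_def by auto
  obtain n2 where n2: "n2 \<le> t2" "\<And>r. length r = n2 \<Longrightarrow> exec c2 s1 r s2"
    using assms(2) unfolding runs_def by auto
  show ?thesis unfolding runs_def
  proof (intro exI[of _ "Suc (n1 + n2)"] conjI allI impI)
    fix r :: "bool list" assume "length r = Suc (n1 + n2)"
    then obtain b r' where r: "r = b # r'" "length r' = n1 + n2" by (auto simp: length_Suc_conv)
    have "exec (Seq c1 c2) s (b # take n1 r' @ drop n1 r') s2"
      using n1(2)[of "take n1 r'"] n2(2)[of "drop n1 r'"] r(2) by (intro exec_Seq[of c1 s _ s1]) auto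
    then show "exec (Seq c1 c2) s r s2" using r(1) by simp
  qed (use n1(1) n2(1) in simp)
qed

lemma runs_Cond:
  assumes "runs (if g (reads s) then c1 else c2) s s' t"
  shows "runs (Cond g c1 c2) s s' (t + 1)"
proof -
  obtain n where n: "n \<le> t" "\<And>r. length r = n \<Longrightarrow> exec (if g (reads s) then c1 else c2) s r s'"
    using assms unfolding runs_def by auto
  show ?thesis unfolding runs_def
  proof (intro exI[of _ "Suc n"] conjI allI impI)
    fix r :: "bool list" assume "length r = Suc n"
    then obtain b r' where "r = b # r'" "length r' = n" by (auto simp: length_Suc_conv)
    then show "exec (Cond g c1 c2) s r s'" using exec_Cond n(2) by simp
  qed (use n(1) in simp)
qed

lemma runs_While_False: "\<not> g (reads s) \<Longrightarrow> runs (While g c) s s 1"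
  unfolding runs_def
proof (intro exI[of _ 1] conjI allI impI)
  fix r :: "bool list" assume "\<not> g (reads s)" "length r = 1"
  then show "exec (While g c) s r s" using exec_While_False[of g s c] by (auto simp: length_Suc_conv)
qed simp

lemma runs_While_True:
  assumes "g (reads s)" "runs c s s1 t1" "runs (While g c) s1 s2 t2"
  shows "runs (While g c) s s2 (t1 + t2 + 1)"
proof -
  obtain n1 where n1: "n1 \<le> t1" "\<And>r. length r = n1 \<Longrightarrow> exec c s r s1"
    using assms(2) unfolding runs_def by auto
  obtain n2 where n2: "n2 \<le> t2" "\<And>r. length r = n2 \<Longrightarrow> exec (While g c) s1 r s2"
    using assms(3) unfolding runs_def by auto
  show ?thesis unfolding runs_def
  proof (intro exI[of _ "Suc (n1 + n2)"] conjI allI impI)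
    fix r :: "bool list" assume "length r = Suc (n1 + n2)"
    then obtain b r' where r: "r = b # r'" "length r' = n1 + n2" by (auto simp: length_Suc_conv)
    have "exec (While g c) s (b # take n1 r' @ drop n1 r') s2"
      using n1(2)[of "take n1 r'"] n2(2)[of "drop n1 r'"] r(2) assms(1)
      by (intro exec_While_True[of g s c _ s1]) auto
    then show "exec (While g c) s r s2" using r(1) by simp
  qed (use n1(1) n2(1) in simp)
qed

lemma runs_While:
  assumes "\<And>k. k < n \<Longrightarrow> g (reads (st k))" "\<not> g (reads (st n))"
    and "\<And>k. k < n \<Longrightarrow> runs c (st k) (st (Suc k)) t"
  shows "runs (While g c) (st 0) (st n) (n * (t + 1) + 1)"
  using assms
proof (induction n arbitrary: st)
  case 0
  then show ?case using runs_While_False by simp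
next
  case (Suc n)
  have "runs (While g c) (st (Suc 0)) (st (Suc n)) (n * (t + 1) + 1)"
    using Suc.prems by (intro Suc.IH[of "\<lambda>k. st (Suc k)"]) auto
  from runs_While_True[OF Suc.prems(1)[of 0] Suc.prems(3)[of 0] this] show ?case
    by (simp add: algebra_simps)
qed

section \<open>Tapes holding lists\<close>

text \<open>The lists that are scanned contain no 0, so that the blank marks both of their ends. A
  one-element list at position 0 serves as a register.\<close>

definition list_tape :: "nat list \<Rightarrow> int \<Rightarrow> tape" where
  "list_tape xs p = (\<lambda>i. if 0 \<le> i \<and> i < int (length xs) then xs ! nat i else 0, p)"

abbreviation blank :: tape where "blank \<equiv> list_tape [] 0"

lemma snd_list_tape [simp]: "snd (list_tape xs p) = p" by (simp add: list_tape_def)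

lemma move_list_tape: "(fst (list_tape xs p), q) = list_tape xs q" by (simp add: list_tape_def)

lemma read_list_tape: "read_tape (list_tape xs p) = (if 0 \<le> p \<and> p < int (length xs) then xs ! nat p else 0)"
  by (simp add: read_tape_def list_tape_def)

lemma read_list_tape_nonzero:
  assumes "0 \<notin> set xs"
  shows "0 < read_tape (list_tape xs p) \<longleftrightarrow> 0 \<le> p \<and> p < int (length xs)"
  using assms by (auto simp: read_list_tape) (metis gr0I nat_less_iff nth_mem)

lemma write_list_tape_append:
  "((fst (list_tape xs (int (length xs))))(int (length xs) := v), q) = list_tape (xs @ [v]) q"
  by (auto simp: list_tape_def fun_eq_iff nth_append)

lemma write_list_tape_erase:
  "((fst (list_tape (xs @ [v]) p))(int (length xs) := 0), q) = list_tape xs q"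
  by (auto simp: list_tape_def fun_eq_iff nth_append)

lemma write_list_tape_reg: "((fst (list_tape [a] 0))(0 := v), 0) = list_tape [v] 0"
  by (auto simp: list_tape_def fun_eq_iff)

lemma write_blank_reg: "((fst blank)(0 := v), 0) = list_tape [v] 0"
  by (auto simp: list_tape_def fun_eq_iff)

lemma write_reg_blank: "((fst (list_tape [a] 0))(0 := 0), 0) = blank"
  by (auto simp: list_tape_def fun_eq_iff)

lemmas runs_Write' = runs_Write[THEN runs_cong]
lemmas runs_Move' = runs_Move[THEN runs_cong]

text \<open>The initial step to the left makes the loop work also when the head stands on the blank
  behind the last entry.\<close>

definition rewind :: "nat \<Rightarrow> com" where
  "rewind i = Seq (Move i Move_Left) (Seq (While (\<lambda>rd. rd i \<noteq> 0) (Move i Move_Left)) (Move i Move_Right))"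

lemma wf_rewind [simp]: "wf_com (rewind i)" by (simp add: rewind_def)

lemma runs_rewind:
  assumes "s i = list_tape xs p" "0 \<notin> set xs" "0 \<le> p" "p \<le> int (length xs)"
  shows "runs (rewind i) s (s(i := list_tape xs 0)) (2 * length xs + 5)"
proof -
  define st where "st = (\<lambda>k. s(i := list_tape xs (p - 1 - int k)))"
  have 1: "runs (Move i Move_Left) s (st 0) 1"
    by (rule runs_Move') (use assms in \<open>auto simp: st_def move_list_tape\<close>)
  have 2: "runs (While (\<lambda>rd. rd i \<noteq> 0) (Move i Move_Left)) (st 0) (st (nat p)) (nat p * (1 + 1) + 1)"
    by (rule runs_While) (use assms in \<open>auto simp: st_def read_list_tape_nonzero move_list_tape algebra_simps
       intro!: runs_Move'\<close>)
  have 3: "runs (Move i Move_Right) (st (nat p)) (s(i := list_tape xs 0)) 1"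
    by (rule runs_Move') (use assms in \<open>auto simp: st_def move_list_tape\<close>)
  show ?thesis unfolding rewind_def
    by (rule runs_cong[OF runs_Seq[OF 1 runs_Seq[OF 2 3]]]) (use assms in auto)
qed

definition copy :: "nat \<Rightarrow> nat \<Rightarrow> com" where
  "copy a b = Seq (While (\<lambda>rd. rd a \<noteq> 0)
      (Seq (Write b (\<lambda>rd _. rd a)) (Seq (Move b Move_Right) (Move a Move_Right))))
      (Seq (rewind a) (rewind b))"

lemma wf_copy [simp]: "wf_com (copy a b)" by (simp add: copy_def)

lemma runs_copy:
  assumes "s a = list_tape xs 0" "s b = blank" "a \<noteq> b" "0 \<notin> set xs"
  shows "runs (copy a b) s (s(b := list_tape xs 0)) (10 * length xs + 13)"
proof -
  let ?L = "length xs"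
  define st where "st = (\<lambda>k. s(a := list_tape xs (int k), b := list_tape (take k xs) (int k)))"
  have "runs (While (\<lambda>rd. rd a \<noteq> 0)
      (Seq (Write b (\<lambda>rd _. rd a)) (Seq (Move b Move_Right) (Move a Move_Right)))) (st 0) (st ?L)
      (?L * (5 + 1) + 1)"
  proof (rule runs_While)
    fix k assume k: "k < ?L"
    then show "reads (st k) a \<noteq> 0" using assms by (simp add: st_def read_list_tape_nonzero)
    have a: "runs (Write b (\<lambda>rd _. rd a)) (st k) ((st k)(b := list_tape (take (Suc k) xs) (int k))) 1"
      by (rule runs_Write'[where v = "xs ! k"])
         (use assms k write_list_tape_append[of "take k xs" "xs ! k" "int k"] in
           \<open>auto simp: st_def read_list_tape take_Suc_conv_app_nth fun_eq_iff\<close>)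
    have b: "runs (Move b Move_Right) ((st k)(b := list_tape (take (Suc k) xs) (int k)))
       ((st k)(b := list_tape (take (Suc k) xs) (int (Suc k)))) 1"
      by (rule runs_Move') (auto simp: move_list_tape algebra_simps)
    have c: "runs (Move a Move_Right) ((st k)(b := list_tape (take (Suc k) xs) (int (Suc k)))) (st (Suc k)) 1"
      by (rule runs_Move') (use assms in \<open>auto simp: move_list_tape st_def fun_eq_iff algebra_simps\<close>)
    show "runs (Seq (Write b (\<lambda>rd _. rd a)) (Seq (Move b Move_Right) (Move a Move_Right))) (st k) (st (Suc k)) 5"
      by (rule runs_cong[OF runs_Seq[OF a runs_Seq[OF b c]]]) auto
  qed (use assms in \<open>simp add: st_def read_list_tape\<close>)
  moreover have "st 0 = s" using assms by (auto simp: st_def)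
  ultimately have 1: "runs (While (\<lambda>rd. rd a \<noteq> 0)
      (Seq (Write b (\<lambda>rd _. rd a)) (Seq (Move b Move_Right) (Move a Move_Right)))) s (st ?L) (?L * 6 + 1)"
    by simp
  have 2: "runs (rewind a) (st ?L) ((st ?L)(a := list_tape xs 0)) (2 * ?L + 5)"
    by (rule runs_rewind[where p = "int ?L"]) (use assms in \<open>auto simp: st_def\<close>)
  have 3: "runs (rewind b) ((st ?L)(a := list_tape xs 0)) (((st ?L)(a := list_tape xs 0))(b := list_tape xs 0)) (2 * ?L + 5)"
    by (rule runs_rewind[where p = "int ?L"]) (use assms in \<open>auto simp: st_def\<close>)
  show ?thesis unfolding copy_def
    by (rule runs_cong[OF runs_Seq[OF 1 runs_Seq[OF 2 3]]]) (use assms in \<open>auto simp: st_def\<close>)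
qed

definition goto_end :: "nat \<Rightarrow> com" where
  "goto_end i = While (\<lambda>rd. rd i \<noteq> 0) (Move i Move_Right)"

lemma wf_goto_end [simp]: "wf_com (goto_end i)" by (simp add: goto_end_def)

lemma runs_goto_end:
  assumes "s i = list_tape xs p" "0 \<notin> set xs" "0 \<le> p" "p \<le> int (length xs)"
  shows "runs (goto_end i) s (s(i := list_tape xs (int (length xs)))) (2 * length xs + 1)"
proof -
  define st where "st = (\<lambda>k. s(i := list_tape xs (p + int k)))"
  define n where "n = nat (int (length xs) - p)"
  have "runs (While (\<lambda>rd. rd i \<noteq> 0) (Move i Move_Right)) (st 0) (st n) (n * (1 + 1) + 1)"
    by (rule runs_While) (use assms in \<open>auto simp: st_def read_list_tape_nonzero move_list_tape algebra_simps n_def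
       intro!: runs_Move'\<close>)
  from runs_cong[OF this] have "runs (While (\<lambda>rd. rd i \<noteq> 0) (Move i Move_Right)) (st 0)
      (s(i := list_tape xs (int (length xs)))) (2 * length xs + 1)"
    using assms by (auto simp: st_def n_def)
  moreover have "st 0 = s" using assms by (auto simp: st_def)
  ultimately show ?thesis unfolding goto_end_def by simp
qed

definition erase :: "nat \<Rightarrow> com" where
  "erase i = Seq (goto_end i) (Seq (Move i Move_Left)
     (Seq (While (\<lambda>rd. rd i \<noteq> 0) (Seq (Write i (\<lambda>_ _. 0)) (Move i Move_Left))) (Move i Move_Right)))"

lemma wf_erase [simp]: "wf_com (erase i)" by (simp add: erase_def)

lemma runs_erase:
  assumes "s i = list_tape xs p" "0 \<notin> set xs" "0 \<le> p" "p \<le> int (length xs)"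
  shows "runs (erase i) s (s(i := blank)) (6 * length xs + 7)"
proof -
  let ?L = "length xs"
  define st where "st = (\<lambda>k. s(i := list_tape (take (?L - k) xs) (int ?L - 1 - int k)))"
  have 1: "runs (goto_end i) s (s(i := list_tape xs (int ?L))) (2 * ?L + 1)"
    using runs_goto_end[of s i xs p] assms by simp
  have 2: "runs (Move i Move_Left) (s(i := list_tape xs (int ?L))) (st 0) 1"
    by (rule runs_Move') (auto simp: st_def move_list_tape)
  have 3: "runs (While (\<lambda>rd. rd i \<noteq> 0) (Seq (Write i (\<lambda>_ _. 0)) (Move i Move_Left))) (st 0) (st ?L)
     (?L * (3 + 1) + 1)"
  proof (rule runs_While)
    fix k assume k: "k < ?L"
    have nz: "0 \<notin> set (take m xs)" for m using assms(2) by (meson in_set_takeD)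
    show "reads (st k) i \<noteq> 0" using k by (simp add: st_def read_list_tape_nonzero[OF nz])
    have tk: "take (?L - k) xs = take (?L - Suc k) xs @ [xs ! (?L - Suc k)]"
      using k by (metis Suc_diff_Suc diff_less_Suc take_Suc_conv_app_nth diff_Suc_less length_pos_if_in_set
         gr_implies_not0 zero_less_diff less_imp_diff_less not_less_eq nat_neq_iff)
    have a: "runs (Write i (\<lambda>_ _. 0)) (st k) (s(i := list_tape (take (?L - Suc k) xs) (int ?L - 1 - int k))) 1"
      by (rule runs_Write'[where v = 0])
         (use k write_list_tape_erase[of "take (?L - Suc k) xs" "xs ! (?L - Suc k)" "int ?L - 1 - int k" "int ?L - 1 - int k"]
          in \<open>auto simp: st_def tk of_nat_diff algebra_simps\<close>)
    have b: "runs (Move i Move_Left) (s(i := list_tape (take (?L - Suc k) xs) (int ?L - 1 - int k))) (st (Suc k)) 1"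
      by (rule runs_Move') (auto simp: st_def move_list_tape algebra_simps)
    show "runs (Seq (Write i (\<lambda>_ _. 0)) (Move i Move_Left)) (st k) (st (Suc k)) 3"
      by (rule runs_cong[OF runs_Seq[OF a b]]) auto
  qed (use assms in \<open>simp add: st_def read_list_tape\<close>)
  have 4: "runs (Move i Move_Right) (st ?L) (s(i := blank)) 1"
    by (rule runs_Move') (auto simp: st_def move_list_tape)
  show ?thesis unfolding erase_def
    by (rule runs_cong[OF runs_Seq[OF 1 runs_Seq[OF 2 runs_Seq[OF 3 4]]]]) auto
qed

definition append_sym :: "nat \<Rightarrow> ((nat \<Rightarrow> nat) \<Rightarrow> nat) \<Rightarrow> com" where
  "append_sym i f = Seq (Write i (\<lambda>rd _. f rd)) (Move i Move_Right)"

lemma wf_append_sym [simp]: "wf_com (append_sym i f) \<longleftrightarrow> (\<forall>rd. (\<forall>j. rd j < 6) \<longrightarrow> f rd < 6)"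
  by (auto simp: append_sym_def)

lemma runs_append_sym:
  assumes "s i = list_tape xs (int (length xs))" "f (reads s) = v"
  shows "runs (append_sym i f) s (s(i := list_tape (xs @ [v]) (int (length (xs @ [v]))))) 3"
proof -
  have a: "runs (Write i (\<lambda>rd _. f rd)) s (s(i := list_tape (xs @ [v]) (int (length xs)))) 1"
    by (rule runs_Write'[where v = v]) (use assms in \<open>auto simp: write_list_tape_append\<close>)
  have b: "runs (Move i Move_Right) (s(i := list_tape (xs @ [v]) (int (length xs))))
      (s(i := list_tape (xs @ [v]) (int (length (xs @ [v]))))) 1"
    by (rule runs_Move') (auto simp: move_list_tape algebra_simps)
  show ?thesis unfolding append_sym_def
    by (rule runs_cong[OF runs_Seq[OF a b]]) auto
qed

section \<open>Loops over tuples\<close>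

definition For :: "nat \<Rightarrow> com \<Rightarrow> com" where
  "For i c = Seq (While (\<lambda>rd. rd i \<noteq> 0) (Seq c (Move i Move_Right))) (rewind i)"

lemma wf_For [simp]: "wf_com (For i c) \<longleftrightarrow> wf_com c" by (simp add: For_def)

lemma runs_For:
  assumes nz: "0 \<notin> set xs"
    and body: "\<And>k. k < length xs \<Longrightarrow>
      runs c ((st k)(i := list_tape xs (int k))) ((st (Suc k))(i := list_tape xs (int k))) t"
  shows "runs (For i c) ((st 0)(i := list_tape xs 0)) ((st (length xs))(i := list_tape xs 0))
    (length xs * (t + 3) + 2 * length xs + 7)"
proof -
  let ?L = "length xs"
  define su where "su = (\<lambda>k. (st k)(i := list_tape xs (int k)))"
  have 1: "runs (While (\<lambda>rd. rd i \<noteq> 0) (Seq c (Move i Move_Right))) (su 0) (su ?L) (?L * ((t + 1 + 1) + 1) + 1)"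
  proof (rule runs_While)
    fix k assume k: "k < ?L"
    show "reads (su k) i \<noteq> 0" using k nz by (simp add: su_def read_list_tape_nonzero)
    have "runs (Move i Move_Right) ((st (Suc k))(i := list_tape xs (int k))) (su (Suc k)) 1"
      by (rule runs_Move') (auto simp: su_def move_list_tape algebra_simps)
    from runs_Seq[OF body[OF k] this]
    show "runs (Seq c (Move i Move_Right)) (su k) (su (Suc k)) (t + 1 + 1)" by (simp add: su_def)
  qed (simp add: su_def read_list_tape)
  have 2: "runs (rewind i) (su ?L) ((su ?L)(i := list_tape xs 0)) (2 * ?L + 5)"
    by (rule runs_rewind[where p = "int ?L"]) (use nz in \<open>auto simp: su_def\<close>)
  have 0: "(st 0)(i := list_tape xs 0) = su 0" by (simp add: su_def)
  show ?thesis unfolding For_def 0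
    by (rule runs_cong[OF runs_Seq[OF 1 2]]) (auto simp: su_def algebra_simps)
qed

text \<open>Base \<open>B\<close> with the most significant digit first and a fixed length: counting
  upwards runs through the tuples in the order of nested loops.\<close>

fun digits :: "nat \<Rightarrow> nat \<Rightarrow> nat \<Rightarrow> nat list" where
  "digits B 0 k = []"
| "digits B (Suc d) k = (k div B ^ d) # digits B d (k mod B ^ d)"

definition tuples :: "nat \<Rightarrow> nat \<Rightarrow> nat list set" where
  "tuples d B = {ts. length ts = d \<and> set ts \<subseteq> {..<B}}"

lemma finite_tuples [simp]: "finite (tuples d B)"
  unfolding tuples_def using finite_lists_length_eq[of "{..<B}" d] by (simp add: conj_commute)

lemma tuples_0: "tuples 0 B = {[]}" by (auto simp: tuples_def)

lemma tuples_Suc: "tuples (Suc d) B = (\<lambda>(a, ts). a # ts) ` ({..<B} \<times> tuples d B)"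
  by (auto simp: tuples_def length_Suc_conv image_iff)

lemma bij_digits: "bij_betw (digits B d) {..<B ^ d} (tuples d B)"
proof (induction d)
  case 0
  then show ?case by (auto simp: tuples_0 bij_betw_def inj_on_def)
next
  case (Suc d)
  have 1: "bij_betw (\<lambda>k. (k div B ^ d, k mod B ^ d)) {..<B ^ Suc d} ({..<B} \<times> {..<B ^ d})"
  proof (rule bij_betwI[where g = "\<lambda>(a, k). a * B ^ d + k"])
    show "(\<lambda>k. (k div B ^ d, k mod B ^ d)) \<in> {..<B ^ Suc d} \<rightarrow> {..<B} \<times> {..<B ^ d}"
      by (auto simp: less_mult_imp_div_less) (metis bot_nat_0.not_eq_extremum mod_less_divisor mult_0_right not_less_zero)
    show "(\<lambda>(a, k). a * B ^ d + k) \<in> {..<B} \<times> {..<B ^ d} \<rightarrow> {..<B ^ Suc d}"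
    proof (clarsimp)
      fix a k assume "a < B" "k < B ^ d"
      then have "a * B ^ d + k < a * B ^ d + B ^ d" by simp
      also have "\<dots> = Suc a * B ^ d" by simp
      also have "\<dots> \<le> B * B ^ d" using \<open>a < B\<close> by (intro mult_le_mono1) simp
      finally show "a * B ^ d + k < B * B ^ d" .
    qed
  qed (auto intro: div_mult_mod_eq)
  have 2: "bij_betw (\<lambda>(a, k). (a, digits B d k)) ({..<B} \<times> {..<B ^ d}) ({..<B} \<times> tuples d B)"
    using Suc.IH by (auto simp: bij_betw_def inj_on_def image_iff) (metis imageE)
  have 3: "bij_betw (\<lambda>(a, ts). a # ts) ({..<B} \<times> tuples d B) (tuples (Suc d) B)"
    by (auto simp: tuples_Suc bij_betw_def inj_on_def)
  have eq: "digits B (Suc d) = (\<lambda>(a, ts). a # ts) \<circ> ((\<lambda>(a, k). (a, digits B d k)) \<circ> (\<lambda>k. (k div B ^ d, k mod B ^ d)))"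
    by (simp add: fun_eq_iff)
  show ?case
    by (subst eq, rule bij_betw_trans[OF bij_betw_trans[OF 1 2] 3])
qed

lemma length_digits [simp]: "length (digits B d k) = d"
  by (induction d arbitrary: k) auto

lemma digits_in_tuples: "k < B ^ d \<Longrightarrow> digits B d k \<in> tuples d B"
  using bij_digits[of B d] by (auto simp: bij_betw_def)

text \<open>A loop variable is the head position on a fresh copy of the word from tape 0; the copies
  occupy the tapes from \<open>N\<close> on and are erased afterwards.\<close>

fun ForN :: "nat \<Rightarrow> nat \<Rightarrow> com \<Rightarrow> com" where
  "ForN N 0 c = c"
| "ForN N (Suc d) c = Seq (copy 0 N) (Seq (For N (ForN (Suc N) d c)) (erase N))"

lemma wf_ForN [simp]: "wf_com (ForN N d c) \<longleftrightarrow> wf_com c"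
  by (induction d arbitrary: N) auto

definition set_vars :: "nat list \<Rightarrow> nat \<Rightarrow> nat list \<Rightarrow> state \<Rightarrow> state" where
  "set_vars W N ts s = (\<lambda>i. if N \<le> i \<and> i < N + length ts then list_tape W (int (ts ! (i - N))) else s i)"

lemma set_vars_Nil [simp]: "set_vars W N [] s = s" by (auto simp: set_vars_def fun_eq_iff)

lemma set_vars_Cons: "set_vars W N (a # ts) s = set_vars W (Suc N) ts (s(N := list_tape W (int a)))"
  by (auto simp: set_vars_def fun_eq_iff nth_Cons' not_less_eq_eq)

fun ForN_time :: "nat \<Rightarrow> nat \<Rightarrow> nat \<Rightarrow> nat" where
  "ForN_time B 0 t = t"
| "ForN_time B (Suc d) t = B * ForN_time B d t + 21 * B + 29"

text \<open>The invariant \<open>st\<close> is indexed by the number of tuples already treated and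
  leaves out the loop tapes, which \<open>set_vars\<close> adds. An inner loop then only shifts the
  index by \<open>a * B ^ d\<close>.\<close>

lemma runs_ForN:
  assumes "0 \<notin> set W" "length W = B" "0 < N"
    and "\<And>k. k \<le> B ^ d \<Longrightarrow> st k 0 = list_tape W 0"
    and "\<And>k j. k \<le> B ^ d \<Longrightarrow> N \<le> j \<Longrightarrow> j < N + d \<Longrightarrow> st k j = blank"
    and "\<And>k. k < B ^ d \<Longrightarrow>
      runs c (set_vars W N (digits B d k) (st k)) (set_vars W N (digits B d k) (st (Suc k))) t"
  shows "runs (ForN N d c) (st 0) (st (B ^ d)) (ForN_time B d t)"
  using assms(3-)
proof (induction d arbitrary: N st)
  case 0
  then show ?case using "0.prems"(4)[of 0] by simp
next
  case (Suc d)
  let ?n = "B ^ d"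
  have bound: "a * ?n + k \<le> B ^ Suc d" if "a < B" "k \<le> ?n" for a k
  proof -
    have "a * ?n + k \<le> Suc a * ?n" using that by simp
    also have "\<dots> \<le> B * ?n" using that by (intro mult_le_mono1) simp
    finally show ?thesis by simp
  qed
  have inner: "runs (ForN (Suc N) d c) ((st (a * ?n))(N := list_tape W (int a)))
      ((st (Suc a * ?n))(N := list_tape W (int a))) (ForN_time B d t)" if a: "a < B" for a
  proof -
    define su where "su = (\<lambda>k. (st (a * ?n + k))(N := list_tape W (int a)))"
    have "runs (ForN (Suc N) d c) (su 0) (su ?n) (ForN_time B d t)"
    proof (rule Suc.IH)
      fix k assume k: "k < ?n"
      have dg: "digits B (Suc d) (a * ?n + k) = a # digits B d k"
      proof -
        have "?n \<noteq> 0" using k by linarith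
        then have "(a * ?n + k) div ?n = a" by (subst div_mult_self3) (use k in auto)
        then show ?thesis using k by simp
      qed
      have "a * ?n + k < B ^ Suc d"
        using bound[OF a, of "Suc k"] k by simp
      from Suc.prems(4)[OF this]
      show "runs c (set_vars W (Suc N) (digits B d k) (su k)) (set_vars W (Suc N) (digits B d k) (su (Suc k))) t"
        unfolding dg set_vars_Cons su_def by simp
    qed (use bound[OF a] Suc.prems in \<open>auto simp: su_def\<close>)
    then show ?thesis by (simp add: su_def add.commute)
  qed
  have 1: "runs (copy 0 N) (st 0) ((st 0)(N := list_tape W 0)) (10 * B + 13)"
    using runs_copy[of "st 0" 0 W N] Suc.prems assms(1,2) by simp
  have 2: "runs (For N (ForN (Suc N) d c)) ((st (0 * ?n))(N := list_tape W 0)) ((st (B * ?n))(N := list_tape W 0))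
     (B * (ForN_time B d t + 3) + 2 * B + 7)"
    using runs_For[OF assms(1), where st = "\<lambda>a. st (a * ?n)" and i = N and c = "ForN (Suc N) d c"
        and t = "ForN_time B d t"] inner assms(2) by simp
  have 3: "runs (erase N) ((st (B * ?n))(N := list_tape W 0)) ((st (B * ?n))) (6 * B + 7)"
    by (rule runs_cong[OF runs_erase[where xs = W and p = 0]])
       (use assms(1,2) Suc.prems(3)[of "B * ?n" N] in \<open>auto\<close>)
  show ?case
    by (simp, rule runs_cong[OF runs_Seq[OF 1 runs_Seq[OF 2[simplified] 3]]]) (auto simp: algebra_simps)
qed

section \<open>Polynomial bounds\<close>

definition pbound :: "(nat \<Rightarrow> nat) \<Rightarrow> bool" where
  "pbound f \<longleftrightarrow> (\<exists>p :: nat poly. \<forall>n. f n \<le> poly p n)"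

lemma pbound_const: "pbound (\<lambda>n. c)"
  unfolding pbound_def by (rule exI[of _ "[:c:]"]) simp

lemma pbound_id: "pbound (\<lambda>n. n)"
  unfolding pbound_def by (rule exI[of _ "[:0, 1:]"]) simp

lemma pbound_add: "pbound f \<Longrightarrow> pbound g \<Longrightarrow> pbound (\<lambda>n. f n + g n)"
  unfolding pbound_def by (metis add_mono poly_add)

lemma pbound_mult: "pbound f \<Longrightarrow> pbound g \<Longrightarrow> pbound (\<lambda>n. f n * g n)"
  unfolding pbound_def by (metis mult_le_mono poly_mult)

lemma pbound_power: "pbound f \<Longrightarrow> pbound (\<lambda>n. f n ^ k)"
  by (induction k) (simp_all add: pbound_const pbound_mult)

lemma pbound_Suc: "pbound f \<Longrightarrow> pbound (\<lambda>n. Suc (f n))"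
  using pbound_add[OF _ pbound_const[of 1]] by simp

lemma poly_mono_nat: "m \<le> n \<Longrightarrow> poly (p :: nat poly) m \<le> poly p n"
  by (induction p) (auto intro: add_mono mult_le_mono)

lemma pbound_compose: "pbound f \<Longrightarrow> pbound g \<Longrightarrow> pbound (\<lambda>n. f (g n))"
  unfolding pbound_def
  by (metis le_trans poly_mono_nat poly_pcompose)

lemma pbound_ForN_time: "pbound f \<Longrightarrow> pbound (\<lambda>n. ForN_time n d (f n))"
  by (induction d) (auto intro!: pbound_add pbound_mult pbound_const pbound_id)

lemmas pbound_intros = pbound_const pbound_id pbound_add pbound_mult pbound_power pbound_Suc
  pbound_ForN_time

section \<open>Definable relations\<close>

text \<open>
  A world consists of a padded input word, whose positions form the universe, and of random symbols
  indexed by triples of positions. A relation with arguments \<open>e 0, e 1, \<dots>\<close> (de Bruijn style) is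
  definable if, however the arguments are assigned to tapes, a program evaluates it in polynomial
  time. An argument is represented by a copy of the word with the head at the corresponding position.
  Tape 0 holds the word, tape 1 the random symbols, and tape 2 receives the result.
\<close>

type_synonym world = "nat list \<times> nat list"

abbreviation univ :: "world \<Rightarrow> nat" where
  "univ w \<equiv> length (fst w)"

abbreviation bt :: "bool \<Rightarrow> nat" where
  "bt b \<equiv> (if b then 2 else 1)"

abbreviation res :: "bool \<Rightarrow> tape" where
  "res b \<equiv> list_tape [bt b] 0"

definition valid :: "world \<Rightarrow> bool" where
  "valid w \<longleftrightarrow> 0 \<notin> set (fst w) \<and> length (snd w) = univ w ^ 3 \<and> set (snd w) \<subseteq> {1, 2}"

definition layout :: "world \<Rightarrow> (nat \<Rightarrow> nat) \<Rightarrow> (nat \<Rightarrow> nat) \<Rightarrow> nat \<Rightarrow> state \<Rightarrow> bool" where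
  "layout w e vs N s \<longleftrightarrow> s 0 = list_tape (fst w) 0 \<and> s 1 = list_tape (snd w) 0 \<and> (\<exists>b. s 2 = list_tape [b] 0) \<and>
     (\<forall>i. s (vs i) = list_tape (fst w) (int (e i)) \<and> e i < univ w) \<and> (\<forall>j\<ge>N. s j = blank)"

text \<open>Tape 0 may represent an argument, namely position 0. This is how the evaluation of a
  closed formula starts, before any other copy of the word exists.\<close>

definition alloc :: "(nat \<Rightarrow> nat) \<Rightarrow> nat \<Rightarrow> bool" where
  "alloc vs N \<longleftrightarrow> 3 \<le> N \<and> (\<forall>i. vs i < N \<and> vs i \<noteq> 1 \<and> vs i \<noteq> 2)"

definition computes ::
    "com \<Rightarrow> (nat \<Rightarrow> nat) \<Rightarrow> nat \<Rightarrow> (nat \<Rightarrow> nat) \<Rightarrow> (world \<Rightarrow> (nat \<Rightarrow> nat) \<Rightarrow> bool) \<Rightarrow> bool" where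
  "computes c vs N f F \<longleftrightarrow>
     (\<forall>w e s. valid w \<longrightarrow> layout w e vs N s \<longrightarrow> runs c s (s(2 := res (F w e))) (f (univ w)))"

definition definable :: "(world \<Rightarrow> (nat \<Rightarrow> nat) \<Rightarrow> bool) \<Rightarrow> bool" where
  "definable F \<longleftrightarrow>
     (\<forall>vs N. alloc vs N \<longrightarrow> (\<exists>c f. wf_com c \<and> pbound f \<and> computes c vs N f F))"

lemma layoutD:
  assumes "layout w e vs N s"
  shows "s 0 = list_tape (fst w) 0" "s 1 = list_tape (snd w) 0" "s (vs i) = list_tape (fst w) (int (e i))"
    "e i < univ w" "N \<le> j \<Longrightarrow> s j = blank"
  using assms by (auto simp: layout_def)

lemma definableE:
  assumes "definable F" "alloc vs N"
  obtains c f where "wf_com c" "pbound f" "computes c vs N f F"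
  using assms unfolding definable_def by blast

lemma definable_cong:
  assumes "\<And>w e. valid w \<Longrightarrow> (\<And>i. e i < univ w) \<Longrightarrow> F w e \<longleftrightarrow> G w e" "definable F"
  shows "definable G"
proof -
  have "computes c vs N f F \<Longrightarrow> computes c vs N f G" for c vs N f
    using assms(1) unfolding computes_def layout_def by metis
  then show ?thesis using assms(2) unfolding definable_def by blast
qed

lemma runs_set_reg:
  assumes "s i = list_tape [b] 0" "f (reads s) = v"
  shows "runs (Write i (\<lambda>rd _. f rd)) s (s(i := list_tape [v] 0)) 1"
  by (rule runs_Write'[where v = v]) (use assms in \<open>auto simp: write_list_tape_reg\<close>)

lemma runs_skip: "runs (Write i (\<lambda>rd _. rd i)) s s 1"
  by (rule runs_Write'[where v = "read_tape (s i)"]) (auto simp: read_tape_def)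

lemma definable_sym: "definable (\<lambda>w e. P (fst w ! e i))"
  unfolding definable_def
proof (intro allI impI exI conjI)
  fix vs N assume a: "alloc vs N"
  show "computes (Write 2 (\<lambda>rd _. bt (P (rd (vs i))))) vs N (\<lambda>_. 1) (\<lambda>w e. P (fst w ! e i))"
    unfolding computes_def
  proof (intro allI impI)
    fix w e s assume layout: "layout w e vs N s"
    then obtain b where b: "s 2 = list_tape [b] 0" unfolding layout_def by blast
    show "runs (Write 2 (\<lambda>rd _. bt (P (rd (vs i))))) s (s(2 := res (P (fst w ! e i)))) 1"
      using runs_set_reg[where b = b and s = s and i = 2 and f = "\<lambda>rd. bt (P (rd (vs i)))"
          and v = "bt (P (fst w ! e i))"] layoutD[OF layout] b
      by (simp add: read_list_tape)
  qed
qed (auto intro: pbound_const)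

lemma definable_const: "definable (\<lambda>w e. b)"
  using definable_sym[of "\<lambda>_. b"] by simp

lemma layout_reg: "layout w e vs N s \<Longrightarrow> alloc vs N \<Longrightarrow> layout w e vs N (s(2 := list_tape [b] 0))"
  by (auto simp: layout_def alloc_def)

lemma definable_not:
  assumes "definable F"
  shows "definable (\<lambda>w e. \<not> F w e)"
  unfolding definable_def
proof (intro allI impI)
  fix vs N assume a: "alloc vs N"
  obtain c f where c: "wf_com c" "pbound f" "computes c vs N f F"
    by (rule definableE[OF assms a])
  let ?c = "Seq c (Write 2 (\<lambda>rd _. bt (rd 2 \<noteq> 2)))"
  have "computes ?c vs N (\<lambda>n. f n + 1 + 1) (\<lambda>w e. \<not> F w e)"
    unfolding computes_def
  proof (intro allI impI)
    fix w e s assume layout: "valid w" "layout w e vs N s"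
    have 1: "runs c s (s(2 := res (F w e))) (f (univ w))"
      using c(3) layout unfolding computes_def by blast
    have 2: "runs (Write 2 (\<lambda>rd _. bt (rd 2 \<noteq> 2))) (s(2 := res (F w e)))
       ((s(2 := res (F w e)))(2 := res (\<not> F w e))) 1"
      by (rule runs_set_reg) (auto simp: read_list_tape)
    show "runs ?c s (s(2 := res (\<not> F w e))) (f (univ w) + 1 + 1)"
      by (rule runs_cong[OF runs_Seq[OF 1 2]]) auto
  qed
  with c show "\<exists>c f. wf_com c \<and> pbound f \<and> computes c vs N f (\<lambda>w e. \<not> F w e)"
    by (intro exI[of _ ?c] exI[of _ "\<lambda>n. f n + 1 + 1"]) (auto intro!: pbound_intros)
qed

lemma definable_conj:
  assumes "definable F" "definable G"
  shows "definable (\<lambda>w e. F w e \<and> G w e)"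
  unfolding definable_def
proof (intro allI impI)
  fix vs N assume a: "alloc vs N"
  obtain c f where c: "wf_com c" "pbound f" "computes c vs N f F"
    by (rule definableE[OF assms(1) a])
  obtain d g where d: "wf_com d" "pbound g" "computes d vs N g G"
    by (rule definableE[OF assms(2) a])
  let ?c = "Seq c (Cond (\<lambda>rd. rd 2 = 2) d (Write 2 (\<lambda>rd _. rd 2)))"
  have "computes ?c vs N (\<lambda>n. f n + (g n + 1 + 1) + 1) (\<lambda>w e. F w e \<and> G w e)"
    unfolding computes_def
  proof (intro allI impI)
    fix w e s assume layout: "valid w" "layout w e vs N s"
    have 1: "runs c s (s(2 := res (F w e))) (f (univ w))"
      using c(3) layout unfolding computes_def by blast
    have 2: "runs (if (\<lambda>rd. rd 2 = 2) (reads (s(2 := res (F w e)))) then d else Write 2 (\<lambda>rd _. rd 2)) (s(2 := res (F w e)))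
       (s(2 := res (F w e \<and> G w e))) (g (univ w) + 1)"
    proof (cases "F w e")
      case True
      have "runs d (s(2 := res True)) ((s(2 := res True))(2 := res (G w e))) (g (univ w))"
        using d(3) layout(1) layout_reg[OF layout(2) a] unfolding computes_def by blast
      from runs_cong[OF this refl, of "g (univ w) + 1"] show ?thesis
        using True by (simp add: read_list_tape)
    next
      case False
      then show ?thesis
        using runs_cong[OF runs_skip[of 2 "s(2 := res False)"] refl, of "g (univ w) + 1"]
        by (simp add: read_list_tape)
    qed
    show "runs ?c s (s(2 := res (F w e \<and> G w e))) (f (univ w) + (g (univ w) + 1 + 1) + 1)"
      by (rule runs_cong[OF runs_Seq[OF 1 runs_Cond[where g = "\<lambda>rd. rd 2 = 2", OF 2]]]) auto
  qed
  with c d show "\<exists>c f. wf_com c \<and> pbound f \<and> computes c vs N f (\<lambda>w e. F w e \<and> G w e)"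
    by (intro exI[of _ ?c] exI[of _ "\<lambda>n. f n + (g n + 1 + 1) + 1"]) (auto intro!: pbound_intros)
qed

lemma definable_disj:
  assumes "definable F" "definable G"
  shows "definable (\<lambda>w e. F w e \<or> G w e)"
  by (rule definable_cong[OF _ definable_not[OF definable_conj[OF definable_not[OF assms(1)] definable_not[OF assms(2)]]]]) blast

lemma definable_imp:
  assumes "definable F" "definable G"
  shows "definable (\<lambda>w e. F w e \<longrightarrow> G w e)"
  by (rule definable_cong[OF _ definable_disj[OF definable_not[OF assms(1)] assms(2)]]) blast

lemma definable_iff:
  assumes "definable F" "definable G"
  shows "definable (\<lambda>w e. F w e \<longleftrightarrow> G w e)"
  by (rule definable_cong[OF _ definable_conj[OF definable_imp[OF assms] definable_imp[OF assms(2,1)]]]) blast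

lemma runs_erase_sym:
  assumes "s i = list_tape (xs @ [v]) (int (length xs))"
  shows "runs (Write i (\<lambda>_ _. 0)) s (s(i := list_tape xs (int (length xs)))) 1"
  by (rule runs_Write'[where v = 0]) (use assms write_list_tape_erase[of xs v] in auto)

text \<open>Both heads are moved to the left until one of them leaves the word; a third tape counts the moves.\<close>

definition compare :: "nat \<Rightarrow> nat \<Rightarrow> nat \<Rightarrow> com" where
  "compare a b N =
     Seq (While (\<lambda>rd. rd a \<noteq> 0 \<and> rd b \<noteq> 0)
       (Seq (Move a Move_Left) (Seq (Move b Move_Left) (append_sym N (\<lambda>_. 1)))))
    (Seq (Write 2 (\<lambda>rd _. bt (rd a = 0)))
    (Seq (Move N Move_Left)
    (Seq (While (\<lambda>rd. rd N \<noteq> 0)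
       (Seq (Write N (\<lambda>_ _. 0)) (Seq (Move N Move_Left) (Seq (Move a Move_Right) (Move b Move_Right)))))
       (Move N Move_Right))))"

lemma runs_compare:
  assumes W: "0 \<notin> set W" and s: "s a = list_tape W (int x)" "s b = list_tape W (int y)" "s N = blank" "s 2 = list_tape [b0] 0"
    and xy: "x < length W" "y < length W" and ne: "a \<noteq> b" "a \<noteq> N" "b \<noteq> N" "a \<noteq> 2" "b \<noteq> 2" "N \<noteq> 2"
  shows "runs (compare a b N) s (s(2 := res (x \<le> y))) (20 * length W + 20)"
proof -
  \<comment> \<open>One move more than the smaller position: the head that started there then stands
    on the blank at -1.\<close>
  define m where "m = Suc (min x y)"
  define st where "st = (\<lambda>k. s(a := list_tape W (int x - int k), b := list_tape W (int y - int k),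
    N := list_tape (replicate k 1) (int k)))"
  have 1: "runs (While (\<lambda>rd. rd a \<noteq> 0 \<and> rd b \<noteq> 0)
      (Seq (Move a Move_Left) (Seq (Move b Move_Left) (append_sym N (\<lambda>_. 1))))) (st 0) (st m) (m * (7 + 1) + 1)"
  proof (rule runs_While)
    fix k assume k: "k < m"
    then show "reads (st k) a \<noteq> 0 \<and> reads (st k) b \<noteq> 0"
      using W xy ne by (auto simp: st_def read_list_tape_nonzero m_def)
    let ?s1 = "(st k)(a := list_tape W (int x - int (Suc k)))"
    let ?s2 = "?s1(b := list_tape W (int y - int (Suc k)))"
    have a: "runs (Move a Move_Left) (st k) ?s1 1"
      by (rule runs_Move') (use ne in \<open>auto simp: st_def move_list_tape fun_eq_iff algebra_simps\<close>)
    have b: "runs (Move b Move_Left) ?s1 ?s2 1"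
      by (rule runs_Move') (use ne in \<open>auto simp: st_def move_list_tape fun_eq_iff algebra_simps\<close>)
    have c: "runs (append_sym N (\<lambda>_. 1)) ?s2
        (?s2(N := list_tape (replicate k 1 @ [1]) (int (length (replicate k 1 @ [1 :: nat]))))) 3"
      by (rule runs_append_sym) (use ne in \<open>auto simp: st_def\<close>)
    show "runs (Seq (Move a Move_Left) (Seq (Move b Move_Left) (append_sym N (\<lambda>_. 1)))) (st k) (st (Suc k)) 7"
      by (rule runs_cong[OF runs_Seq[OF a runs_Seq[OF b c]]])
         (use ne in \<open>auto simp: st_def fun_eq_iff replicate_append_same algebra_simps\<close>)
  qed (use W xy ne in \<open>auto simp: st_def read_list_tape m_def min_def\<close>)
  have rd: "reads (st m) a = 0 \<longleftrightarrow> x \<le> y"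
    using read_list_tape_nonzero[OF W, of "int x - int m"] xy ne by (auto simp: st_def m_def min_def)
  have 2: "runs (Write 2 (\<lambda>rd _. bt (rd a = 0))) (st m) ((st m)(2 := res (x \<le> y))) 1"
    by (rule runs_set_reg[where b = b0]) (use ne s rd in \<open>simp_all add: st_def\<close>)
  define su where "su = (\<lambda>k. s(2 := res (x \<le> y), a := list_tape W (int x - int m + int k),
     b := list_tape W (int y - int m + int k), N := list_tape (replicate (m - k) 1) (int m - 1 - int k)))"
  have 3: "runs (Move N Move_Left) ((st m)(2 := res (x \<le> y))) (su 0) 1"
    by (rule runs_Move') (use ne in \<open>simp_all add: st_def su_def move_list_tape fun_eq_iff\<close>)
  have 4: "runs (While (\<lambda>rd. rd N \<noteq> 0)
       (Seq (Write N (\<lambda>_ _. 0)) (Seq (Move N Move_Left) (Seq (Move a Move_Right) (Move b Move_Right)))))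
      (su 0) (su m) (m * (7 + 1) + 1)"
  proof (rule runs_While)
    fix k assume k: "k < m"
    then show "reads (su k) N \<noteq> 0" by (auto simp: su_def read_list_tape)
    have rep: "replicate (m - k) 1 = replicate (m - Suc k) 1 @ [1 :: nat]"
      using k by (metis Suc_diff_Suc replicate_Suc replicate_append_same)
    have len: "int (length (replicate (m - Suc k) (1 :: nat))) = int m - 1 - int k"
      using k by simp
    let ?s1 = "(su k)(N := list_tape (replicate (m - Suc k) 1) (int m - 1 - int k))"
    let ?s2 = "?s1(N := list_tape (replicate (m - Suc k) 1) (int m - 1 - int (Suc k)))"
    let ?s3 = "?s2(a := list_tape W (int x - int m + int (Suc k)))"
    have a: "runs (Write N (\<lambda>_ _. 0)) (su k) ?s1 1"
      using runs_erase_sym[of "su k" N "replicate (m - Suc k) 1" 1] unfolding len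
      by (simp add: su_def rep del: One_nat_def)
    have b: "runs (Move N Move_Left) ?s1 ?s2 1"
      by (rule runs_Move') (simp_all add: move_list_tape algebra_simps)
    have c: "runs (Move a Move_Right) ?s2 ?s3 1"
      by (rule runs_Move') (use ne in \<open>simp_all add: su_def move_list_tape algebra_simps\<close>)
    have d: "runs (Move b Move_Right) ?s3 (su (Suc k)) 1"
      by (rule runs_Move') (use ne in \<open>simp_all add: su_def move_list_tape fun_eq_iff algebra_simps\<close>)
    show "runs (Seq (Write N (\<lambda>_ _. 0)) (Seq (Move N Move_Left) (Seq (Move a Move_Right) (Move b Move_Right))))
      (su k) (su (Suc k)) 7"
      by (rule runs_cong[OF runs_Seq[OF a runs_Seq[OF b runs_Seq[OF c d]]]]) auto
  qed (auto simp: su_def read_list_tape)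
  have 5: "runs (Move N Move_Right) (su m) (s(2 := res (x \<le> y))) 1"
    by (rule runs_Move') (use ne s in \<open>simp_all add: su_def move_list_tape fun_eq_iff\<close>)
  have 0: "s = st 0" using s by (auto simp: st_def fun_eq_iff)
  have "m \<le> length W" using xy by (auto simp: m_def)
  then show ?thesis unfolding compare_def
    using runs_cong[OF runs_Seq[OF 1 runs_Seq[OF 2 runs_Seq[OF 3 runs_Seq[OF 4 5]]]] refl, of "20 * length W + 20"]
    by (simp flip: 0)
qed

lemma definable_le: "definable (\<lambda>w e. e i \<le> e j)"
  unfolding definable_def
proof (intro allI impI)
  fix vs N assume a: "alloc vs N"
  show "\<exists>c f. wf_com c \<and> pbound f \<and> computes c vs N f (\<lambda>w e. e i \<le> e j)"
  proof (cases "vs i = vs j")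
    \<comment> \<open>\<open>compare\<close> moves two different tapes. Arguments represented by the
      same tape share its head position and are equal.\<close>
    case True
    obtain c f where c: "wf_com c" "pbound f" "computes c vs N f (\<lambda>_ _. True)"
      by (rule definableE[OF definable_const a])
    have "e i = e j" if "layout w e vs N s" for w e s
      using that True unfolding layout_def by (metis snd_list_tape int_int_eq)
    then have "computes c vs N f (\<lambda>w e. e i \<le> e j)"
      using c(3) unfolding computes_def by (metis le_refl)
    then show ?thesis using c by blast
  next
    case False
    have "computes (compare (vs i) (vs j) N) vs N (\<lambda>n. 20 * n + 20) (\<lambda>w e. e i \<le> e j)"
      unfolding computes_def
    proof (intro allI impI)
      fix w e s assume layout: "valid w" "layout w e vs N s"
      then obtain b where b: "s 2 = list_tape [b] 0" unfolding layout_def by blast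
      have "vs i < N" "vs j < N" "vs i \<noteq> 2" "vs j \<noteq> 2" "3 \<le> N"
        using a by (auto simp: alloc_def)
      then show "runs (compare (vs i) (vs j) N) s (s(2 := res (e i \<le> e j))) (20 * univ w + 20)"
        by (intro runs_compare[of "fst w" s "vs i" "e i" "vs j" "e j" N b])
          (use layout(1) layoutD[OF layout(2)] False b in \<open>simp_all add: valid_def\<close>)
    qed
    moreover have "wf_com (compare (vs i) (vs j) N)" by (simp add: compare_def)
    ultimately show ?thesis
      by (intro exI[of _ "compare (vs i) (vs j) N"] exI[of _ "\<lambda>n. 20 * n + 20"])
         (auto intro!: pbound_intros)
  qed
qed

lemma definable_less: "definable (\<lambda>w e. e i < e j)"
  using definable_not[OF definable_le[of j i]] by (simp add: not_le)

lemma definable_eq: "definable (\<lambda>w e. e i = e j)"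
  using definable_conj[OF definable_le[of i j] definable_le[of j i]] by (simp add: eq_iff)

section \<open>Quantifiers over tuples\<close>

definition ext :: "nat list \<Rightarrow> (nat \<Rightarrow> nat) \<Rightarrow> nat \<Rightarrow> nat" where
  "ext ts e = (\<lambda>i. if i < length ts then ts ! i else e (i - length ts))"

lemma map_ext: "length ts = d \<Longrightarrow> map (ext ts e) [0..<d] = ts"
  by (auto simp: ext_def intro!: nth_equalityI)

lemma ext_shift: "length ts = d \<Longrightarrow> (\<lambda>i. ext ts e (i + d)) = e"
  by (auto simp: ext_def)

definition vext :: "nat \<Rightarrow> nat \<Rightarrow> (nat \<Rightarrow> nat) \<Rightarrow> nat \<Rightarrow> nat" where
  "vext M d vs = (\<lambda>i. if i < d then M + i else vs (i - d))"

lemma alloc_vext: "alloc vs N \<Longrightarrow> N \<le> M \<Longrightarrow> M + d \<le> K \<Longrightarrow> alloc (vext M d vs) K"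
  by (auto simp: alloc_def vext_def intro: less_le_trans)

lemma layout_ext:
  assumes a: "alloc vs N" "N \<le> M" "M + d \<le> K" and layout: "layout w e vs N s"
    and ts: "ts \<in> tuples d (univ w)"
    and s': "\<And>j. j < N \<Longrightarrow> j \<noteq> 2 \<Longrightarrow> s' j = s j" "s' 2 = list_tape [b] 0" "\<And>j. K \<le> j \<Longrightarrow> s' j = blank"
  shows "layout w (ext ts e) (vext M d vs) K (set_vars (fst w) M ts s')"
proof -
  have len: "length ts = d" and bd: "\<And>i. i < d \<Longrightarrow> ts ! i < univ w"
    using ts nth_mem by (fastforce simp: tuples_def)+
  have N: "3 \<le> N" and vs: "\<And>i. vs i < N" "\<And>i. vs i \<noteq> 2" using a(1) by (auto simp: alloc_def)
  have "set_vars (fst w) M ts s' (vext M d vs i) = list_tape (fst w) (int (ext ts e i)) \<and> ext ts e i < univ w" for i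
  proof (cases "i < d")
    case True
    then show ?thesis using len bd by (simp add: set_vars_def vext_def ext_def)
  next
    case False
    have "\<not> M \<le> vs (i - d)" using vs(1)[of "i - d"] a(2) by simp
    then show ?thesis using False len layoutD(3,4)[OF layout, of "i - d"] s'(1)[OF vs(1) vs(2)]
      by (simp add: set_vars_def vext_def ext_def)
  qed
  moreover have "set_vars (fst w) M ts s' j = s' j" if "j < 3 \<or> K \<le> j" for j
    using that len N a by (auto simp: set_vars_def)
  ultimately show ?thesis using layoutD(1,2)[OF layout] s' N by (auto simp: layout_def)
qed

text \<open>One skeleton for quantifiers and parities. The accumulator on tape \<open>M + d\<close>
  is updated from its old value, the result of \<open>cF\<close> and the symbol scanned on tape
  \<open>V\<close>, and then \<open>cV\<close> advances \<open>V\<close>. For a plain quantifier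
  \<open>V\<close> is tape 0 and \<open>cV\<close> changes nothing.\<close>

definition fold_prog ::
    "nat \<Rightarrow> nat \<Rightarrow> nat \<Rightarrow> com \<Rightarrow> com \<Rightarrow> (bool \<Rightarrow> bool \<Rightarrow> bool \<Rightarrow> bool) \<Rightarrow> com" where
  "fold_prog M d V cF cV U =
     Seq (Write (M + d) (\<lambda>_ _. 1))
    (Seq (ForN M d (Seq cF (Seq
       (Write (M + d) (\<lambda>rd _. bt (U (rd (M + d) = 2) (rd 2 = 2) (rd V = 2)))) cV)))
    (Seq (Write 2 (\<lambda>rd _. rd (M + d))) (Write (M + d) (\<lambda>_ _. 0))))"

lemma wf_fold_prog: "wf_com cF \<Longrightarrow> wf_com cV \<Longrightarrow> wf_com (fold_prog M d V cF cV U)"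
  by (simp add: fold_prog_def)

lemma set_vars_upd:
  "j < M \<or> M + length ts \<le> j \<Longrightarrow> (set_vars W M ts s)(j := t) = set_vars W M ts (s(j := t))"
  by (auto simp: set_vars_def fun_eq_iff)

lemma set_vars_other:
  "j < M \<or> M + length ts \<le> j \<Longrightarrow> set_vars W M ts s j = s j"
  by (auto simp: set_vars_def)

lemma runs_fold:
  assumes W: "0 \<notin> set W" "length W = B" "2 < M" "s 0 = list_tape W 0"
    and V: "V < M" "V \<noteq> 2" "V = 0 \<Longrightarrow> \<forall>k. \<tau> k = list_tape W 0" "s V = \<tau> 0"
    and bl: "\<And>j. M \<le> j \<Longrightarrow> j \<le> M + d \<Longrightarrow> s j = blank" and s2: "s 2 = list_tape [b0] 0"
    and cV: "\<And>s k. s V = \<tau> k \<Longrightarrow> runs cV s (s(V := \<tau> (Suc k))) 1"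
    and cF: "\<And>k b a. k < B ^ d \<Longrightarrow>
      runs cF (set_vars W M (digits B d k) (s(V := \<tau> k, M + d := list_tape [a] 0, 2 := list_tape [b] 0)))
        (set_vars W M (digits B d k) (s(V := \<tau> k, M + d := list_tape [a] 0, 2 := res (F k)))) t"
    and A: "A 0 = False" "\<And>k. A (Suc k) = U (A k) (F k) (read_tape (\<tau> k) = 2)"
  shows "runs (fold_prog M d V cF cV U) s (s(V := \<tau> (B ^ d), 2 := res (A (B ^ d))))
    (ForN_time B d (t + 4) + 6)"
proof -
  \<comment> \<open>Tape 2 holds an unspecified symbol before the first round and the last value of
    \<open>F\<close> afterwards.\<close>
  define bb where "bb = (\<lambda>k. case k of 0 \<Rightarrow> b0 | Suc k \<Rightarrow> bt (F k))"
  define st where "st = (\<lambda>k. s(V := \<tau> k, M + d := res (A k), 2 := list_tape [bb k] 0))"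
  have 1: "runs (Write (M + d) (\<lambda>_ _. 1)) s (st 0) 1"
    by (rule runs_Write'[where v = 1])
       (use bl[of "M + d"] V s2 A W in \<open>simp_all add: st_def write_blank_reg bb_def fun_eq_iff\<close>)
  have 2: "runs (ForN M d (Seq cF (Seq
       (Write (M + d) (\<lambda>rd _. bt (U (rd (M + d) = 2) (rd 2 = 2) (rd V = 2)))) cV)))
     (st 0) (st (B ^ d)) (ForN_time B d (t + 4))"
  proof (rule runs_ForN[OF W(1,2)])
    fix k assume k: "k < B ^ d"
    let ?sv = "set_vars W M (digits B d k)"
    let ?s1 = "s(V := \<tau> k, M + d := res (A k), 2 := res (F k))"
    let ?s2 = "s(V := \<tau> k, M + d := res (A (Suc k)), 2 := res (F k))"
    have a: "runs cF (?sv (st k)) (?sv ?s1) t"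
      unfolding st_def by (rule cF[OF k])
    have "runs (Write (M + d) (\<lambda>rd _. bt (U (rd (M + d) = 2) (rd 2 = 2) (rd V = 2)))) (?sv ?s1)
       ((?sv ?s1)(M + d := list_tape [bt (A (Suc k))] 0)) 1"
      by (rule runs_set_reg) (use W V in \<open>auto simp: set_vars_other A(2) read_list_tape\<close>)
    moreover have "(?sv ?s1)(M + d := res (A (Suc k))) = ?sv ?s2"
      by (subst set_vars_upd, (use W V in simp)[1], rule arg_cong[where f = ?sv])
        (use W V in \<open>auto simp: fun_eq_iff\<close>)
    ultimately have b: "runs (Write (M + d) (\<lambda>rd _. bt (U (rd (M + d) = 2) (rd 2 = 2) (rd V = 2)))) (?sv ?s1)
       (?sv ?s2) 1" by simp
    have "runs cV (?sv ?s2) ((?sv ?s2)(V := \<tau> (Suc k))) 1"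
      by (rule cV) (use V in \<open>simp add: set_vars_other\<close>)
    moreover have "(?sv ?s2)(V := \<tau> (Suc k)) = ?sv (st (Suc k))"
      by (subst set_vars_upd, (use W V in simp)[1], rule arg_cong[where f = ?sv])
        (use W V in \<open>auto simp: st_def bb_def fun_eq_iff\<close>)
    ultimately have c: "runs cV (?sv ?s2) (?sv (st (Suc k))) 1" by simp
    show "runs (Seq cF (Seq (Write (M + d) (\<lambda>rd _. bt (U (rd (M + d) = 2) (rd 2 = 2) (rd V = 2)))) cV))
       (?sv (st k)) (?sv (st (Suc k))) (t + 4)"
      by (rule runs_cong[OF runs_Seq[OF a runs_Seq[OF b c]]]) simp_all
  next
    fix k
    show "st k 0 = list_tape W 0" using W V by (cases "V = 0") (auto simp: st_def)
  next
    fix k j assume "M \<le> j" "j < M + d"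
    then show "st k j = blank" using W V bl by (simp add: st_def)
  qed (use W in simp)
  let ?n = "B ^ d"
  have 3: "runs (Write 2 (\<lambda>rd _. rd (M + d))) (st ?n) ((st ?n)(2 := res (A ?n))) 1"
    by (rule runs_set_reg[where b = "bb ?n"]) (use W in \<open>auto simp: st_def read_list_tape\<close>)
  have 4: "runs (Write (M + d) (\<lambda>_ _. 0)) ((st ?n)(2 := res (A ?n))) (s(V := \<tau> ?n, 2 := res (A ?n))) 1"
    by (rule runs_Write'[where v = 0])
      (use W V bl[of "M + d"] in \<open>simp_all add: st_def write_reg_blank fun_eq_iff\<close>)
  show ?thesis unfolding fold_prog_def
    by (rule runs_cong[OF runs_Seq[OF 1 runs_Seq[OF 2 runs_Seq[OF 3 4]]]]) simp_all
qed

lemma definable_Ex_tuple: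
  assumes "definable (\<lambda>w e. F w (map e [0..<d]) (\<lambda>i. e (i + d)))"
  shows "definable (\<lambda>w e. \<exists>ts\<in>tuples d (univ w). F w ts e)"
  unfolding definable_def
proof (intro allI impI)
  fix vs N assume al: "alloc vs N"
  define G where "G = (\<lambda>w e. F w (map e [0..<d]) (\<lambda>i. e (i + d)))"
  have N: "3 \<le> N" using al by (simp add: alloc_def)
  have al': "alloc (vext N d vs) (N + d + 1)" using alloc_vext[OF al] by simp
  obtain c f where c: "wf_com c" "pbound f" "computes c (vext N d vs) (N + d + 1) f G"
    using definableE[OF assms al'] unfolding G_def by blast
  define c' where "c' = fold_prog N d 0 c (Write 0 (\<lambda>rd _. rd 0)) (\<lambda>a b _. a \<or> b)"
  have "computes c' vs N (\<lambda>n. ForN_time n d (f n + 4) + 6) (\<lambda>w e. \<exists>ts\<in>tuples d (univ w). F w ts e)"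
    unfolding computes_def
  proof (intro allI impI)
    fix w e s assume v: "valid w" and layout: "layout w e vs N s"
    obtain b0 where b0: "s 2 = list_tape [b0] 0" using layout unfolding layout_def by blast
    let ?B = "univ w"
    define Fk where "Fk = (\<lambda>k. F w (digits ?B d k) e)"
    define A where "A = (\<lambda>k. \<exists>j<k. Fk j)"
    have s0: "s(0 := list_tape (fst w) 0) = s" using layoutD(1)[OF layout] by auto
    have "runs c' s (s(0 := list_tape (fst w) 0, 2 := res (A (?B ^ d)))) (ForN_time ?B d (f ?B + 4) + 6)"
      unfolding c'_def
    proof (rule runs_fold[where W = "fst w" and ?b0.0 = b0 and F = Fk and \<tau> = "\<lambda>_. list_tape (fst w) 0"])
      fix k b a assume k: "k < ?B ^ d"
      let ?s = "s(0 := list_tape (fst w) 0, N + d := list_tape [a] 0, 2 := list_tape [b] 0)"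
      let ?t = "digits ?B d k"
      have t: "?t \<in> tuples d ?B" using k by (rule digits_in_tuples)
      have "layout w (ext ?t e) (vext N d vs) (N + d + 1) (set_vars (fst w) N ?t ?s)"
        by (rule layout_ext[where b = b, OF al _ _ layout t]) (use layoutD[OF layout] N in auto)
      with c(3) v have "runs c (set_vars (fst w) N ?t ?s)
         ((set_vars (fst w) N ?t ?s)(2 := res (G w (ext ?t e)))) (f ?B)"
        unfolding computes_def by blast
      moreover have "G w (ext ?t e) = Fk k"
        by (simp add: G_def Fk_def map_ext ext_shift)
      ultimately show "runs c (set_vars (fst w) N ?t ?s)
         (set_vars (fst w) N ?t (s(0 := list_tape (fst w) 0, N + d := list_tape [a] 0, 2 := res (Fk k)))) (f ?B)"
        using N by (simp add: set_vars_upd)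
    next
      fix s :: state assume "s 0 = list_tape (fst w) 0"
      then have "s(0 := list_tape (fst w) 0) = s" by auto
      then show "runs (Write 0 (\<lambda>rd _. rd 0)) s (s(0 := list_tape (fst w) 0)) 1" using runs_skip[of 0 s] by simp
    qed (use v N layoutD[OF layout] b0 in \<open>auto simp: valid_def A_def less_Suc_eq\<close>)
    moreover have "A (?B ^ d) \<longleftrightarrow> (\<exists>ts\<in>tuples d ?B. F w ts e)"
      using bij_digits[of ?B d] unfolding A_def Fk_def bij_betw_def by (metis (full_types) imageE imageI lessThan_iff)
    ultimately show "runs c' s (s(2 := res (\<exists>ts\<in>tuples d ?B. F w ts e))) (ForN_time ?B d (f ?B + 4) + 6)"
      by (simp add: s0)
  qed
  moreover have "wf_com c'" using c(1) by (simp add: c'_def wf_fold_prog)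
  ultimately show "\<exists>c f. wf_com c \<and> pbound f \<and>
      computes c vs N f (\<lambda>w e. \<exists>ts\<in>tuples d (univ w). F w ts e)"
    using c(2) by (intro exI[of _ c'] exI[of _ "\<lambda>n. ForN_time n d (f n + 4) + 6"]) (auto intro!: pbound_intros)
qed

lemma tuples_1: "tuples (Suc 0) B = (\<lambda>a. [a]) ` {..<B}"
  by (auto simp: tuples_Suc tuples_0)

lemma definable_Ex:
  assumes "definable (\<lambda>w e. F w (e 0) (\<lambda>i. e (Suc i)))"
  shows "definable (\<lambda>w e. \<exists>a<univ w. F w a e)"
  by (rule definable_cong[OF _ definable_Ex_tuple[where d = "Suc 0" and F = "\<lambda>w ts e. F w (hd ts) e"]])
    (use assms in \<open>auto simp: tuples_1\<close>)

lemma definable_All: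
  assumes "definable (\<lambda>w e. F w (e 0) (\<lambda>i. e (Suc i)))"
  shows "definable (\<lambda>w e. \<forall>a<univ w. F w a e)"
  by (rule definable_cong[OF _ definable_not[OF definable_Ex[OF definable_not[OF assms]]]]) auto

section \<open>Tables\<close>

definition truth_table :: "nat \<Rightarrow> nat \<Rightarrow> (nat list \<Rightarrow> bool) \<Rightarrow> nat list" where
  "truth_table d B P = map (\<lambda>k. bt (P (digits B d k))) [0..<B ^ d]"

lemma length_truth_table [simp]: "length (truth_table d B P) = B ^ d" by (simp add: truth_table_def)

lemma truth_table_nonzero [simp]: "0 \<notin> set (truth_table d B P)" by (auto simp: truth_table_def)

text \<open>The head on the table \<open>V\<close> advances in step with the loop over all tuples
  and thus always scans the entry of the current tuple; no address is ever computed. The update is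
  exclusive or, so the result is a parity.\<close>

definition scan_prog :: "nat \<Rightarrow> nat \<Rightarrow> nat \<Rightarrow> com \<Rightarrow> com" where
  "scan_prog M d V cF =
     Seq (fold_prog M d V cF (Move V Move_Right) (\<lambda>a b v. a \<noteq> (b \<and> v))) (rewind V)"

lemma wf_scan_prog: "wf_com cF \<Longrightarrow> wf_com (scan_prog M d V cF)"
  by (simp add: scan_prog_def wf_fold_prog)

lemma odd_card_Suc:
  "odd (card {j. j < Suc k \<and> Q j}) \<longleftrightarrow> odd (card {j. j < k \<and> Q j}) \<noteq> Q k"
proof -
  have "{j. j < Suc k \<and> Q j} = (if Q k then insert k {j. j < k \<and> Q j} else {j. j < k \<and> Q j})"
    by (auto simp: less_Suc_eq)
  then show ?thesis by auto
qed

lemma card_digits: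
  "card {k. k < B ^ d \<and> Q (digits B d k)} = card {ts \<in> tuples d B. Q ts}"
proof (rule bij_betw_same_card[where f = "digits B d"])
  have "inj_on (digits B d) {..<B ^ d}" "digits B d ` {..<B ^ d} = tuples d B"
    using bij_digits[of B d] by (auto simp: bij_betw_def)
  then show "bij_betw (digits B d) {k. k < B ^ d \<and> Q (digits B d k)} {ts \<in> tuples d B. Q ts}"
    unfolding bij_betw_def by (auto simp: inj_on_def)
qed

lemma runs_scan:
  assumes W: "0 \<notin> set W" "length W = B" "2 < M" "s 0 = list_tape W 0"
    and V: "V < M" "2 < V" "s V = list_tape (truth_table d B P) 0"
    and bl: "\<And>j. M \<le> j \<Longrightarrow> j \<le> M + d \<Longrightarrow> s j = blank" and s2: "s 2 = list_tape [b0] 0"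
    and cF: "\<And>ts b a v. ts \<in> tuples d B \<Longrightarrow>
      runs cF (set_vars W M ts (s(V := v, M + d := list_tape [a] 0, 2 := list_tape [b] 0)))
        (set_vars W M ts (s(V := v, M + d := list_tape [a] 0, 2 := res (F ts)))) t"
  shows "runs (scan_prog M d V cF) s (s(2 := res (odd (card {ts\<in>tuples d B. P ts \<and> F ts}))))
    (ForN_time B d (t + 4) + 2 * B ^ d + 12)"
proof -
  define A where "A = (\<lambda>k. odd (card {j. j < k \<and> F (digits B d j) \<and> read_tape (list_tape (truth_table d B P) (int j)) = 2}))"
  let ?n = "B ^ d"
  have 1: "runs (fold_prog M d V cF (Move V Move_Right) (\<lambda>a b v. a \<noteq> (b \<and> v))) s
     (s(V := list_tape (truth_table d B P) (int ?n), 2 := res (A ?n))) (ForN_time B d (t + 4) + 6)"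
  proof (rule runs_fold[where W = W and s = s and ?b0.0 = b0, OF W, where F = "\<lambda>k. F (digits B d k)" and \<tau> = "\<lambda>k. list_tape (truth_table d B P) (int k)"])
    fix s :: state and k assume "s V = list_tape (truth_table d B P) (int k)"
    then show "runs (Move V Move_Right) s (s(V := list_tape (truth_table d B P) (int (Suc k)))) 1"
      by (intro runs_Move') (auto simp: move_list_tape algebra_simps)
  qed (use V bl s2 cF digits_in_tuples in \<open>auto simp: A_def odd_card_Suc\<close>)
  have 2: "runs (rewind V) (s(V := list_tape (truth_table d B P) (int ?n), 2 := res (A ?n)))
     ((s(V := list_tape (truth_table d B P) (int ?n), 2 := res (A ?n)))(V := list_tape (truth_table d B P) 0)) (2 * length (truth_table d B P) + 5)"
    by (rule runs_rewind[where p = "int ?n"]) (use V in simp_all)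
  have "{j. j < ?n \<and> F (digits B d j) \<and> read_tape (list_tape (truth_table d B P) (int j)) = 2} =
      {j. j < ?n \<and> (P (digits B d j) \<and> F (digits B d j))}"
    by (auto simp: read_list_tape truth_table_def split: if_splits)
  then have A: "A ?n = odd (card {ts\<in>tuples d B. P ts \<and> F ts})"
    unfolding A_def using card_digits[of B d "\<lambda>ts. P ts \<and> F ts"] by simp
  show ?thesis unfolding scan_prog_def
    by (rule runs_cong[OF runs_Seq[OF 1 2]]) (use V A in \<open>simp_all add: fun_eq_iff\<close>)
qed

definition table_prog :: "nat \<Rightarrow> nat \<Rightarrow> nat \<Rightarrow> com \<Rightarrow> com" where
  "table_prog M d V cF =
     Seq (ForN M d (Seq cF (append_sym V (\<lambda>rd. rd 2)))) (Seq (rewind V) (Write 2 (\<lambda>_ _. 1)))"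

lemma wf_table_prog: "wf_com cF \<Longrightarrow> wf_com (table_prog M d V cF)"
  by (simp add: table_prog_def)

lemma runs_table:
  assumes W: "0 \<notin> set W" "length W = B" "2 < M" "s 0 = list_tape W 0"
    and V: "V < M" "2 < V" "s V = blank"
    and bl: "\<And>j. M \<le> j \<Longrightarrow> j < M + d \<Longrightarrow> s j = blank" and s2: "s 2 = list_tape [b0] 0"
    and cF: "\<And>ts b v. ts \<in> tuples d B \<Longrightarrow>
      runs cF (set_vars W M ts (s(V := v, 2 := list_tape [b] 0))) (set_vars W M ts (s(V := v, 2 := res (F ts)))) t"
  shows "runs (table_prog M d V cF) s (s(V := list_tape (truth_table d B F) 0, 2 := res False))
    (ForN_time B d (t + 4) + 2 * B ^ d + 8)"
proof -
  define bb where "bb = (\<lambda>k. case k of 0 \<Rightarrow> b0 | Suc k \<Rightarrow> bt (F (digits B d k)))"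
  define xs where "xs = (\<lambda>k. map (\<lambda>k. bt (F (digits B d k))) [0..<k])"
  define st where "st = (\<lambda>k. s(V := list_tape (xs k) (int k), 2 := list_tape [bb k] 0))"
  have 1: "runs (ForN M d (Seq cF (append_sym V (\<lambda>rd. rd 2)))) (st 0) (st (B ^ d)) (ForN_time B d (t + 4))"
  proof (rule runs_ForN[OF W(1,2)])
    fix k assume k: "k < B ^ d"
    let ?sv = "set_vars W M (digits B d k)"
    let ?s1 = "s(V := list_tape (xs k) (int k), 2 := res (F (digits B d k)))"
    have a: "runs cF (?sv (st k)) (?sv ?s1) t"
      unfolding st_def by (rule cF[OF digits_in_tuples[OF k]])
    have "runs (append_sym V (\<lambda>rd. rd 2)) (?sv ?s1)
       ((?sv ?s1)(V := list_tape (xs k @ [bt (F (digits B d k))]) (int (length (xs k @ [bt (F (digits B d k))]))))) 3"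
      by (rule runs_append_sym) (use W V in \<open>auto simp: set_vars_other read_list_tape xs_def\<close>)
    moreover have "(?sv ?s1)(V := list_tape (xs k @ [bt (F (digits B d k))]) (int (length (xs k @ [bt (F (digits B d k))])))) = ?sv (st (Suc k))"
      by (subst set_vars_upd, (use W V in simp)[1], rule arg_cong[where f = ?sv])
        (use W V in \<open>auto simp: st_def bb_def xs_def fun_eq_iff\<close>)
    ultimately have b: "runs (append_sym V (\<lambda>rd. rd 2)) (?sv ?s1) (?sv (st (Suc k))) 3" by simp
    show "runs (Seq cF (append_sym V (\<lambda>rd. rd 2))) (?sv (st k)) (?sv (st (Suc k))) (t + 4)"
      by (rule runs_cong[OF runs_Seq[OF a b]]) simp_all
  qed (use W V bl in \<open>auto simp: st_def\<close>)
  have 0: "st 0 = s" using V s2 by (auto simp: st_def xs_def bb_def fun_eq_iff)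
  have v: "xs (B ^ d) = truth_table d B F" by (simp add: xs_def truth_table_def)
  have 2: "runs (rewind V) (st (B ^ d)) ((st (B ^ d))(V := list_tape (truth_table d B F) 0)) (2 * length (truth_table d B F) + 5)"
    by (rule runs_rewind[where p = "int (B ^ d)"]) (use V v in \<open>simp_all add: st_def\<close>)
  have 3: "runs (Write 2 (\<lambda>_ _. 1)) ((st (B ^ d))(V := list_tape (truth_table d B F) 0))
      (((st (B ^ d))(V := list_tape (truth_table d B F) 0))(2 := list_tape [1] 0)) 1"
    by (rule runs_set_reg[where b = "bb (B ^ d)"]) (use V in \<open>auto simp: st_def\<close>)
  show ?thesis unfolding table_prog_def
    by (rule runs_cong[OF runs_Seq[OF 1[unfolded 0] runs_Seq[OF 2 3]]])
      (use V in \<open>simp_all add: st_def fun_eq_iff\<close>)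
qed

section \<open>Parities of numbers of walks\<close>

lemma computesD:
  assumes "computes c vs N f F" "valid w" "layout w e vs N s"
  shows "runs c s (s(2 := res (F w e))) (f (univ w))"
  using assms unfolding computes_def by blast

lemma definable_Ball_fin:
  fixes n :: nat
  assumes "\<And>i. i < n \<Longrightarrow> definable (F i)"
  shows "definable (\<lambda>w e. \<forall>i<n. F i w e)"
  using assms
proof (induction n)
  case 0
  then show ?case using definable_const[of True] by simp
next
  case (Suc n)
  have "definable (\<lambda>w e. (\<forall>i<n. F i w e) \<and> F n w e)"
    using Suc by (intro definable_conj) auto
  then show ?case by (rule definable_cong[rotated]) (auto simp: less_Suc_eq)
qed

lemma definable_Bex_fin:
  fixes n :: nat
  assumes "\<And>i. i < n \<Longrightarrow> definable (F i)"
  shows "definable (\<lambda>w e. \<exists>i<n. F i w e)"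
  by (rule definable_cong[OF _ definable_not[OF definable_Ball_fin[where F = "\<lambda>i w e. \<not> F i w e"]]])
    (use assms in \<open>auto intro: definable_not\<close>)

lemma definable_tuple_eq:
  assumes "length js = d"
  shows "definable (\<lambda>w e. map e [0..<d] = map (\<lambda>j. e (j + d)) js)"
  by (rule definable_cong[OF _ definable_Ball_fin[where n = d and F = "\<lambda>i w e. e i = e (js ! i + d)"]])
    (use assms in \<open>auto intro: definable_eq simp: list_eq_iff_nth_eq\<close>)

text \<open>A table lookup is a special parity: the tuples that lie in the table and equal
  \<open>map e js\<close> are one or none.\<close>

lemma runs_lookup:
  assumes al: "alloc vs N" and layout: "layout w e vs N s" and v: "valid w" and js: "length js = d"
    and Z: "\<And>j. j < N \<Longrightarrow> j \<noteq> 2 \<Longrightarrow> Z j = s j" "Z 2 = list_tape [b0] 0" "\<And>j. M \<le> j \<Longrightarrow> Z j = blank"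
    and V: "N \<le> V" "V < M" "Z V = list_tape (truth_table d (univ w) P) 0"
    and c: "computes c (vext M d vs) (M + d + 1) f (\<lambda>w e. map e [0..<d] = map (\<lambda>j. e (j + d)) js)"
  shows "runs (scan_prog M d V c) Z (Z(2 := res (P (map e js))))
    (ForN_time (univ w) d (f (univ w) + 4) + 2 * univ w ^ d + 12)"
proof -
  have N: "3 \<le> N" using al by (simp add: alloc_def)
  have "map e js \<in> tuples d (univ w)" using js layoutD(4)[OF layout] by (auto simp: tuples_def)
  then have "{ts \<in> tuples d (univ w). P ts \<and> ts = map e js} = (if P (map e js) then {map e js} else {})"
    by auto
  then have eq: "odd (card {ts \<in> tuples d (univ w). P ts \<and> ts = map e js}) = P (map e js)"
    by auto
  show ?thesis unfolding eq[symmetric]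
  proof (rule runs_scan[where W = "fst w" and ?b0.0 = b0])
    fix ts b a v' assume ts: "ts \<in> tuples d (univ w)"
    let ?s = "Z(V := v', M + d := list_tape [a] 0, 2 := list_tape [b] 0)"
    have "layout w (ext ts e) (vext M d vs) (M + d + 1) (set_vars (fst w) M ts ?s)"
      by (rule layout_ext[where b = b, OF al _ _ layout ts]) (use Z V N in auto)
    with c v have "runs c (set_vars (fst w) M ts ?s) ((set_vars (fst w) M ts ?s)
        (2 := res (map (ext ts e) [0..<d] = map (\<lambda>j. ext ts e (j + d)) js))) (f (univ w))"
      unfolding computes_def by blast
    moreover have "(map (ext ts e) [0..<d] = map (\<lambda>j. ext ts e (j + d)) js) = (ts = map e js)"
      using ts ext_shift[of ts d e] by (simp add: map_ext tuples_def fun_eq_iff)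
    ultimately show "runs c (set_vars (fst w) M ts ?s)
       (set_vars (fst w) M ts (Z(V := v', M + d := list_tape [a] 0, 2 := res (ts = map e js)))) (f (univ w))"
      using N V by (simp add: set_vars_upd)
  qed (use v Z V N layoutD[OF layout] in \<open>auto simp: valid_def\<close>)
qed

section \<open>The random symbols as a ternary relation\<close>

definition rnd :: "world \<Rightarrow> nat list \<Rightarrow> bool" where
  "rnd w ts \<longleftrightarrow> (\<exists>k<univ w ^ 3. digits (univ w) 3 k = ts \<and> snd w ! k = 2)"

lemma snd_eq_truth_table:
  assumes "valid w"
  shows "snd w = truth_table 3 (univ w) (rnd w)"
proof (rule nth_equalityI)
  show "length (snd w) = length (truth_table 3 (univ w) (rnd w))" using assms by (simp add: valid_def)
  fix k assume "k < length (snd w)"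
  then have k: "k < univ w ^ 3" and w: "snd w ! k \<in> {1, 2}"
    using assms nth_mem[of k "snd w"] unfolding valid_def by (metis, blast)
  have "inj_on (digits (univ w) 3) {..<univ w ^ 3}" using bij_digits by (auto simp: bij_betw_def)
  then have "rnd w (digits (univ w) 3 k) \<longleftrightarrow> snd w ! k = 2"
    using k unfolding rnd_def inj_on_def by auto
  then show "snd w ! k = truth_table 3 (univ w) (rnd w) ! k" using k w by (auto simp: truth_table_def)
qed

lemma definable_rnd_tuple:
  assumes "length js = 3"
  shows "definable (\<lambda>w e. rnd w (map e js))"
  unfolding definable_def
proof (intro allI impI)
  fix vs N assume al: "alloc vs N"
  have N: "3 \<le> N" using al by (simp add: alloc_def)
  have "alloc (vext (Suc N) 3 vs) (Suc N + 3 + 1)" using alloc_vext[OF al] by simp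
  from definableE[OF definable_tuple_eq[OF assms] this]
  obtain c f where c: "wf_com c" "pbound f"
    "computes c (vext (Suc N) 3 vs) (Suc N + 3 + 1) f (\<lambda>w e. map e [0..<3] = map (\<lambda>j. e (j + 3)) js)"
    by blast
  \<comment> \<open>Scanning moves the head of the table and expects it on a tape above 2, so the
    random symbols are first copied from tape 1.\<close>
  define c' where "c' = Seq (copy 1 N) (Seq (scan_prog (Suc N) 3 N c) (erase N))"
  define g where "g = (\<lambda>n. 20 * n ^ 3 + 60 + ForN_time n 3 (f n + 4))"
  have "computes c' vs N g (\<lambda>w e. rnd w (map e js))"
    unfolding computes_def
  proof (intro allI impI)
    fix w e s assume v: "valid w" and layout: "layout w e vs N s"
    obtain b0 where b0: "s 2 = list_tape [b0] 0" using layout unfolding layout_def by blast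
    let ?s1 = "s(N := list_tape (snd w) 0)"
    have len: "length (snd w) = univ w ^ 3" and nz: "0 \<notin> set (snd w)"
      using v by (auto simp: valid_def)
    have 1: "runs (copy 1 N) s ?s1 (10 * length (snd w) + 13)"
      by (rule runs_copy) (use layoutD[OF layout] nz N in auto)
    have 2: "runs (scan_prog (Suc N) 3 N c) ?s1 (?s1(2 := res (rnd w (map e js))))
       (ForN_time (univ w) 3 (f (univ w) + 4) + 2 * univ w ^ 3 + 12)"
      by (rule runs_lookup[OF al layout v assms _ _ _ _ _ _ c(3), where ?b0.0 = b0])
        (use N b0 layoutD[OF layout] snd_eq_truth_table[OF v] in auto)
    have 3: "runs (erase N) (?s1(2 := res (rnd w (map e js)))) ((?s1(2 := res (rnd w (map e js))))(N := blank))
       (6 * length (snd w) + 7)"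
      by (rule runs_erase[where p = 0]) (use N nz in auto)
    show "runs c' s (s(2 := res (rnd w (map e js)))) (g (univ w))"
      unfolding c'_def
      by (rule runs_cong[OF runs_Seq[OF 1 runs_Seq[OF 2 3]]])
        (use N layoutD(5)[OF layout, of N] in \<open>auto simp: fun_eq_iff g_def len\<close>)
  qed
  moreover have "wf_com c'" using c(1) by (simp add: c'_def wf_scan_prog)
  moreover have "pbound g" using c(2) unfolding g_def by (intro pbound_intros)
  ultimately show "\<exists>c f. wf_com c \<and> pbound f \<and> computes c vs N f (\<lambda>w e. rnd w (map e js))" by blast
qed

lemma definable_rnd: "definable (\<lambda>w e. rnd w [e i, e j, e k])"
  using definable_rnd_tuple[of "[i, j, k]"] by simp

text \<open>The parity of a number of walks is determined by the parities for walks that are one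
  step shorter. One bit per tuple is therefore kept, although the numbers themselves grow
  exponentially.\<close>

fun odd_walks :: "nat \<Rightarrow> nat \<Rightarrow> (nat list \<Rightarrow> bool) \<Rightarrow> (nat list \<Rightarrow> nat list \<Rightarrow> bool) \<Rightarrow> nat \<Rightarrow> nat list \<Rightarrow> bool" where
  "odd_walks d B I S 0 t = I t"
| "odd_walks d B I S (Suc n) t = odd (card {s \<in> tuples d B. odd_walks d B I S n s \<and> S s t})"

lemma map_ext2:
  assumes "length ss = d" "length ts = d"
  shows "map (ext ss (ext ts e)) [0..<d] = ss" "map (ext ss (ext ts e)) [d..<2 * d] = ts"
    "(\<lambda>i. ext ss (ext ts e) (i + 2 * d)) = e"
  using assms by (auto simp: ext_def fun_eq_iff intro!: nth_equalityI)

text \<open>One multiplication of a vector by the transition matrix over F_2: the new table is built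
  on tape \<open>N + 1\<close> from the old one on tape \<open>N\<close> and then takes its
  place.\<close>

lemma runs_odd_walks_step:
  fixes d :: nat
  assumes al: "alloc vs N" and layout: "layout w e vs N s" and v: "valid w"
    and Z: "\<And>j. j < N \<Longrightarrow> j \<noteq> 2 \<Longrightarrow> Z j = s j" "Z 2 = list_tape [b0] 0" "\<And>j. N + 3 \<le> j \<Longrightarrow> Z j = blank"
    and V: "Z N = list_tape (truth_table d (univ w) P) 0" "Z (N + 1) = blank"
    and M: "M = N + 3" "M2 = N + 3 + d"
    and c: "computes c (vext M2 d (vext M d vs)) (M2 + d + 1) f
      (\<lambda>w e. S w (map e [0..<d]) (map e [d..<2 * d]) (\<lambda>i. e (i + 2 * d)))"
  shows "runs (Seq (table_prog M d (N + 1) (scan_prog M2 d N c))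
      (Seq (erase N) (Seq (copy (N + 1) N) (erase (N + 1))))) Z
    (Z(N := list_tape (truth_table d (univ w) (\<lambda>t. odd (card {s \<in> tuples d (univ w). P s \<and> S w s t e}))) 0, 2 := res False))
    (ForN_time (univ w) d (ForN_time (univ w) d (f (univ w) + 4) + 2 * univ w ^ d + 12 + 4) + 30 * univ w ^ d + 60)"
proof -
  let ?B = "univ w"
  let ?F = "\<lambda>t. odd (card {s \<in> tuples d ?B. P s \<and> S w s t e})"
  have N: "3 \<le> N" using al by (simp add: alloc_def)
  have W: "0 \<notin> set (fst w)" using v by (simp add: valid_def)
  have al1: "alloc (vext M d vs) M2" using alloc_vext[OF al, of M d M2] M by simp
  have 1: "runs (table_prog M d (N + 1) (scan_prog M2 d N c)) Z
     (Z(N + 1 := list_tape (truth_table d ?B ?F) 0, 2 := res False))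
     (ForN_time ?B d (ForN_time ?B d (f ?B + 4) + 2 * ?B ^ d + 12 + 4) + 2 * ?B ^ d + 8)"
  proof (rule runs_table[where W = "fst w" and ?b0.0 = b0])
    fix ts b v' assume ts: "ts \<in> tuples d ?B"
    then have lts: "length ts = d" by (simp add: tuples_def)
    let ?s = "Z(N + 1 := v', 2 := list_tape [b] 0)"
    let ?z = "set_vars (fst w) M ts ?s"
    have ok1: "layout w (ext ts e) (vext M d vs) M2 ?z"
      by (rule layout_ext[where b = b, OF al _ _ layout ts]) (use Z N M in auto)
    have z2: "?z 2 = list_tape [b] 0" using N M lts by (simp add: set_vars_other)
    have "runs (scan_prog M2 d N c) ?z (?z(2 := res (?F ts))) (ForN_time ?B d (f ?B + 4) + 2 * ?B ^ d + 12)"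
    proof (rule runs_scan[where W = "fst w" and ?b0.0 = b])
      fix ss b' a v2 assume ss: "ss \<in> tuples d ?B"
      let ?t = "?z(N := v2, M2 + d := list_tape [a] 0, 2 := list_tape [b'] 0)"
      have z: "?z(N := v2) = set_vars (fst w) M ts (?s(N := v2))"
        using M lts by (simp add: set_vars_upd)
      have ok1': "layout w (ext ts e) (vext M d vs) M2 (?z(N := v2))"
        unfolding z by (rule layout_ext[where b = b, OF al _ _ layout ts]) (use Z N M in auto)
      have "layout w (ext ss (ext ts e)) (vext M2 d (vext M d vs)) (M2 + d + 1) (set_vars (fst w) M2 ss ?t)"
        by (rule layout_ext[where b = b', OF al1 _ _ ok1' ss]) (use Z N M lts in \<open>auto simp: set_vars_def\<close>)
      from computesD[OF c v this] map_ext2[of ss d ts e] ss ts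
      have "runs c (set_vars (fst w) M2 ss ?t)
         ((set_vars (fst w) M2 ss ?t)(2 := res (S w ss ts e))) (f ?B)"
        by (simp only: tuples_def mem_Collect_eq)
      then show "runs c (set_vars (fst w) M2 ss ?t)
         (set_vars (fst w) M2 ss (?z(N := v2, M2 + d := list_tape [a] 0, 2 := res (S w ss ts e)))) (f ?B)"
        using N M by (simp add: set_vars_upd)
    next
      fix j assume "M2 \<le> j" "j \<le> M2 + d"
      then show "?z j = blank" using layoutD(5)[OF ok1] by simp
    qed (use W N M V lts layoutD[OF ok1] z2 in \<open>auto simp: set_vars_other\<close>)
    then show "runs (scan_prog M2 d N c) ?z (set_vars (fst w) M ts (Z(N + 1 := v', 2 := res (?F ts))))
       (ForN_time ?B d (f ?B + 4) + 2 * ?B ^ d + 12)"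
      using N M by (simp add: set_vars_upd)
  qed (use W N M V Z layoutD[OF layout] in auto)
  let ?z1 = "Z(N + 1 := list_tape (truth_table d ?B ?F) 0, 2 := res False)"
  have 2: "runs (erase N) ?z1 (?z1(N := blank)) (6 * length (truth_table d ?B P) + 7)"
    by (rule runs_erase[where p = 0]) (use N V in auto)
  have 3: "runs (copy (N + 1) N) (?z1(N := blank)) ((?z1(N := blank))(N := list_tape (truth_table d ?B ?F) 0))
     (10 * length (truth_table d ?B ?F) + 13)"
    by (rule runs_copy) (use N in auto)
  have 4: "runs (erase (N + 1)) ((?z1(N := blank))(N := list_tape (truth_table d ?B ?F) 0))
     (((?z1(N := blank))(N := list_tape (truth_table d ?B ?F) 0))(N + 1 := blank)) (6 * length (truth_table d ?B ?F) + 7)"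
    by (rule runs_erase[where p = 0]) (use N in auto)
  show ?thesis
    by (rule runs_cong[OF runs_Seq[OF 1 runs_Seq[OF 2 runs_Seq[OF 3 4]]]])
      (use N V in \<open>auto simp: fun_eq_iff\<close>)
qed

theorem definable_odd_walks:
  assumes I: "definable (\<lambda>w e. I w (map e [0..<d]) (\<lambda>i. e (i + d)))"
    and S: "definable (\<lambda>w e. S w (map e [0..<d]) (map e [d..<2 * d]) (\<lambda>i. e (i + 2 * d)))"
    and js: "length js = d"
  shows "definable (\<lambda>w e. odd_walks d (univ w) (\<lambda>t. I w t e) (\<lambda>s t. S w s t e) (e T) (map e js))"
  unfolding definable_def
proof (intro allI impI)
  fix vs N assume al: "alloc vs N"
  have N: "3 \<le> N" using al by (simp add: alloc_def)
  define M where "M = N + 3"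
  define M2 where "M2 = N + 3 + d"
  have "alloc (vext M d vs) (M + d)" using alloc_vext[OF al] by (simp add: M_def)
  from definableE[OF I this] obtain cI fI where cI: "wf_com cI" "pbound fI"
    "computes cI (vext M d vs) (M + d) fI (\<lambda>w e. I w (map e [0..<d]) (\<lambda>i. e (i + d)))" by blast
  have "alloc (vext M2 d (vext M d vs)) (M2 + d + 1)"
    using alloc_vext[OF alloc_vext[OF al, of M d M2], of M2 d] by (simp add: M_def M2_def)
  from definableE[OF S this] obtain cS fS where cS: "wf_com cS" "pbound fS"
    "computes cS (vext M2 d (vext M d vs)) (M2 + d + 1) fS
      (\<lambda>w e. S w (map e [0..<d]) (map e [d..<2 * d]) (\<lambda>i. e (i + 2 * d)))" by blast
  have "alloc (vext (N + 2) 1 vs) M" using alloc_vext[OF al] by (simp add: M_def)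
  from definableE[OF definable_less[of 0 "Suc T"] this] obtain cL fL where cL: "wf_com cL" "pbound fL"
    "computes cL (vext (N + 2) 1 vs) M fL (\<lambda>w e. e 0 < e (Suc T))" by blast
  have "alloc (vext M d vs) (M + d + 1)" using alloc_vext[OF al] by (simp add: M_def)
  from definableE[OF definable_tuple_eq[OF js] this] obtain cQ fQ where cQ: "wf_com cQ" "pbound fQ"
    "computes cQ (vext M d vs) (M + d + 1) fQ (\<lambda>w e. map e [0..<d] = map (\<lambda>j. e (j + d)) js)" by blast
  define cT where "cT = Seq (table_prog M d (N + 1) (scan_prog M2 d N cS))
      (Seq (erase N) (Seq (copy (N + 1) N) (erase (N + 1))))"
  define cB where "cB = Seq cL (Seq (Cond (\<lambda>rd. rd 2 = 2) cT (Write 2 (\<lambda>rd _. rd 2))) (Write 2 (\<lambda>_ _. 1)))"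
  define c where "c = Seq (table_prog M d N cI) (Seq (ForN (N + 2) 1 cB) (Seq (scan_prog M d N cQ) (erase N)))"
  define gT where "gT = (\<lambda>n. ForN_time n d (ForN_time n d (fS n + 4) + 2 * n ^ d + 12 + 4) + 30 * n ^ d + 60)"
  define gB where "gB = (\<lambda>n. fL n + gT n + 5)"
  define g where "g = (\<lambda>n. (ForN_time n d (fI n + 4) + 2 * n ^ d + 8) + ForN_time n 1 (gB n)
     + (ForN_time n d (fQ n + 4) + 2 * n ^ d + 12) + 6 * n ^ d + 10)"
  have "computes c vs N g (\<lambda>w e. odd_walks d (univ w) (\<lambda>t. I w t e) (\<lambda>s t. S w s t e) (e T) (map e js))"
    unfolding computes_def
  proof (intro allI impI)
    fix w e s assume v: "valid w" and layout: "layout w e vs N s"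
    obtain b0 where b0: "s 2 = list_tape [b0] 0" using layout unfolding layout_def by blast
    let ?B = "univ w"
    define Q where "Q = odd_walks d ?B (\<lambda>t. I w t e) (\<lambda>s t. S w s t e)"
    have W: "0 \<notin> set (fst w)" using v by (simp add: valid_def)
    \<comment> \<open>The number of steps is itself an argument. The loop runs through the whole
      universe, and the rounds from \<open>e T\<close> on leave the table unchanged, which
      \<open>min\<close> expresses.\<close>
    define st where "st = (\<lambda>k. s(N := list_tape (truth_table d ?B (Q (min k (e T)))) 0, 2 := res False))"
    have 1: "runs (table_prog M d N cI) s (s(N := list_tape (truth_table d ?B (Q 0)) 0, 2 := res False))
       (ForN_time ?B d (fI ?B + 4) + 2 * ?B ^ d + 8)"
    proof (rule runs_table[where W = "fst w" and ?b0.0 = b0])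
      fix ts b v' assume ts: "ts \<in> tuples d ?B"
      let ?s = "s(N := v', 2 := list_tape [b] 0)"
      have "layout w (ext ts e) (vext M d vs) (M + d) (set_vars (fst w) M ts ?s)"
        by (rule layout_ext[where b = b, OF al _ _ layout ts]) (use layoutD[OF layout] N in \<open>auto simp: M_def\<close>)
      from computesD[OF cI(3) v this] map_ext[of ts d e] ext_shift[of ts d e] ts
      have "runs cI (set_vars (fst w) M ts ?s) ((set_vars (fst w) M ts ?s)(2 := res (Q 0 ts))) (fI ?B)"
        by (simp only: Q_def odd_walks.simps tuples_def mem_Collect_eq)
      then show "runs cI (set_vars (fst w) M ts ?s) (set_vars (fst w) M ts (s(N := v', 2 := res (Q 0 ts)))) (fI ?B)"
        using N by (simp add: set_vars_upd M_def)
    qed (use W N b0 layoutD[OF layout] in \<open>auto simp: M_def\<close>)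
    have s0: "s(N := list_tape (truth_table d ?B (Q 0)) 0, 2 := res False) = st 0" by (simp add: st_def)
    have 2: "runs (ForN (N + 2) 1 cB) (st 0) (st (?B ^ 1)) (ForN_time ?B 1 (gB ?B))"
    proof (rule runs_ForN[OF W refl])
      fix k assume "k < ?B ^ 1"
      then have k: "k < ?B" by simp
      have dk: "digits ?B 1 k = [k]" by simp
      have kt: "[k] \<in> tuples 1 ?B" using k by (simp add: tuples_def)
      let ?z = "set_vars (fst w) (N + 2) [k] (st k)"
      have "layout w (ext [k] e) (vext (N + 2) 1 vs) M ?z"
        by (rule layout_ext[where b = 1, OF al _ _ layout kt]) (use layoutD[OF layout] N in \<open>auto simp: st_def M_def\<close>)
      from computesD[OF cL(3) v this] have a: "runs cL ?z (?z(2 := res (k < e T))) (fL ?B)"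
        by (simp add: ext_def)
      let ?z' = "set_vars (fst w) (N + 2) [k] (st (Suc k))"
      have "runs (if k < e T then cT else Write 2 (\<lambda>rd _. rd 2)) (?z(2 := res (k < e T)))
         (?z'(2 := res False)) (gT ?B)"
      proof (cases "k < e T")
        case True
        have "runs cT (?z(2 := res True))
           ((?z(2 := res True))(N := list_tape (truth_table d ?B (\<lambda>t. odd (card {s \<in> tuples d ?B. Q k s \<and> S w s t e}))) 0,
             2 := res False)) (gT ?B)"
          unfolding cT_def gT_def
          by (rule runs_odd_walks_step[where P = "Q k" and ?b0.0 = 2, OF al layout v _ _ _ _ _ M_def M2_def cS(3)])
            (use N layoutD[OF layout] True in \<open>auto simp: set_vars_def st_def\<close>)
        moreover have "(\<lambda>t. odd (card {s \<in> tuples d ?B. Q k s \<and> S w s t e})) = Q (min (Suc k) (e T))"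
          using True by (auto simp: Q_def fun_eq_iff min_def Suc_le_eq)
        ultimately show ?thesis using True N
          by (auto simp: fun_eq_iff set_vars_def st_def elim!: back_subst[where P = "\<lambda>x. runs cT _ x _"])
      next
        case False
        have "?z(2 := res False) = ?z'(2 := res False)"
          using False by (auto simp: fun_eq_iff set_vars_def st_def min_def)
        moreover have "runs (Write 2 (\<lambda>rd _. rd 2)) (?z(2 := res False)) (?z(2 := res False)) (gT ?B)"
          by (rule runs_cong[OF runs_skip refl]) (simp add: gT_def)
        ultimately show ?thesis using False by simp
      qed
      then have b: "runs (if (\<lambda>rd. rd 2 = 2) (reads (?z(2 := res (k < e T)))) then cT else Write 2 (\<lambda>rd _. rd 2))
         (?z(2 := res (k < e T))) (?z'(2 := res False)) (gT ?B)"
        by (cases "k < e T") (simp_all add: read_list_tape)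
      have c: "runs (Write 2 (\<lambda>_ _. 1)) (?z'(2 := res False)) ((?z'(2 := res False))(2 := list_tape [1] 0)) 1"
        by (rule runs_set_reg[where b = 1]) simp_all
      have "runs cB ?z ?z' (gB ?B)"
        unfolding cB_def
        by (rule runs_cong[OF runs_Seq[OF a runs_Seq[OF runs_Cond[where g = "\<lambda>rd. rd 2 = 2", OF b] c]]])
          (use N in \<open>auto simp: fun_eq_iff set_vars_def st_def gB_def\<close>)
      then show "runs cB (set_vars (fst w) (N + 2) (digits ?B 1 k) (st k))
         (set_vars (fst w) (N + 2) (digits ?B 1 k) (st (Suc k))) (gB ?B)"
        unfolding dk .
    qed (use N layoutD[OF layout] in \<open>auto simp: st_def\<close>)
    have "e T < ?B" using layoutD(4)[OF layout] .
    then have sB: "st (?B ^ 1) = s(N := list_tape (truth_table d ?B (Q (e T))) 0, 2 := res False)"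
      by (simp add: st_def min_def)
    have 3: "runs (scan_prog M d N cQ) (st (?B ^ 1)) ((st (?B ^ 1))(2 := res (Q (e T) (map e js))))
       (ForN_time ?B d (fQ ?B + 4) + 2 * ?B ^ d + 12)"
      by (rule runs_lookup[where ?b0.0 = 1, OF al layout v js _ _ _ _ _ _ cQ(3)])
        (use N layoutD[OF layout] in \<open>auto simp: sB[simplified] M_def\<close>)
    have 4: "runs (erase N) ((st (?B ^ 1))(2 := res (Q (e T) (map e js))))
       (((st (?B ^ 1))(2 := res (Q (e T) (map e js))))(N := blank)) (6 * length (truth_table d ?B (Q (e T))) + 7)"
      by (rule runs_erase[where p = 0]) (use N in \<open>auto simp: sB[simplified]\<close>)
    have "runs c s (s(2 := res (Q (e T) (map e js)))) (g ?B)"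
      unfolding c_def
      by (rule runs_cong[OF runs_Seq[OF 1[unfolded s0] runs_Seq[OF 2 runs_Seq[OF 3 4]]]])
        (use N layoutD(5)[OF layout, of N] in \<open>auto simp: sB[simplified] fun_eq_iff g_def\<close>)
    then show "runs c s (s(2 := res (odd_walks d ?B (\<lambda>t. I w t e) (\<lambda>s t. S w s t e) (e T) (map e js)))) (g ?B)"
      unfolding Q_def .
  qed
  moreover have "wf_com c"
    using cI(1) cS(1) cL(1) cQ(1)
    by (simp add: c_def cB_def cT_def wf_table_prog wf_scan_prog)
  moreover have "pbound g"
    using cI(2) cS(2) cL(2) cQ(2) unfolding g_def gB_def gT_def by (intro pbound_intros)
  ultimately show "\<exists>c f. wf_com c \<and> pbound f \<and> computes c vs N f
      (\<lambda>w e. odd_walks d (univ w) (\<lambda>t. I w t e) (\<lambda>s t. S w s t e) (e T) (map e js))" by blast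
qed

section \<open>Machines for definable properties of random worlds\<close>

text \<open>The only program whose effect depends on its coins. The marks 1 on tape 1 fix how many
  symbols are drawn.\<close>

definition coin_loop :: com where
  "coin_loop = While (\<lambda>rd. rd 1 \<noteq> 0) (Seq (Write 1 (\<lambda>_ b. bt b)) (Move 1 Move_Right))"

lemma write_list_tape_app:
  "((fst (list_tape (xs @ v # ys) p))(int (length xs) := v'), q) = list_tape (xs @ v' # ys) q"
  by (auto simp: list_tape_def fun_eq_iff nth_append nth_Cons')

text \<open>Every iteration takes four steps, the third of which uses its coin.\<close>

lemma exec_coin_loop:
  assumes "s 1 = list_tape (xs @ replicate n 1) (int (length xs))" "length r = 4 * n + 1"
  shows "exec coin_loop s r
    (s(1 := list_tape (xs @ map (\<lambda>k. bt (r ! (4 * k + 2))) [0..<n]) (int (length xs + n))))"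
  using assms
proof (induction n arbitrary: s xs r)
  case 0
  then have "s = s(1 := list_tape xs (int (length xs)))" by auto
  moreover obtain b where "r = [b]" using 0 by (auto simp: length_Suc_conv)
  ultimately show ?case
    using exec_While_False[of "\<lambda>rd. rd 1 \<noteq> 0" s _ b] 0 unfolding coin_loop_def by (simp add: read_list_tape)
next
  case (Suc n)
  have "length r = Suc (Suc (Suc (Suc (4 * n + 1))))" using Suc.prems(2) by simp
  then obtain b0 b1 b2 b3 r' where r: "r = b0 # b1 # b2 # b3 # r'" "length r' = 4 * n + 1"
    by (metis length_Suc_conv)
  let ?s1 = "s(1 := list_tape (xs @ bt b2 # replicate n 1) (int (length xs)))"
  let ?s2 = "s(1 := list_tape ((xs @ [bt b2]) @ replicate n 1) (int (length (xs @ [bt b2]))))"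
  have w: "exec (Write 1 (\<lambda>_ b. bt b)) s [b2] ?s1"
    using exec_Write[of 1 "\<lambda>_ b. bt b" s b2] Suc.prems(1) write_list_tape_app[of xs 1 "replicate n 1"] by simp
  have m: "exec (Move 1 Move_Right) ?s1 [b3] ?s2"
    using exec_Move[of 1 Move_Right ?s1 b3] by (simp add: move_list_tape algebra_simps)
  have body: "exec (Seq (Write 1 (\<lambda>_ b. bt b)) (Move 1 Move_Right)) s [b1, b2, b3] ?s2"
    using exec_Seq[OF w m, of b1] by simp
  have rest: "exec coin_loop ?s2 r' (?s2(1 := list_tape ((xs @ [bt b2]) @ map (\<lambda>k. bt (r' ! (4 * k + 2))) [0..<n])
     (int (length (xs @ [bt b2]) + n))))"
    by (rule Suc.IH) (use r in auto)
  have "exec coin_loop s (b0 # [b1, b2, b3] @ r') (?s2(1 := list_tape ((xs @ [bt b2]) @ map (\<lambda>k. bt (r' ! (4 * k + 2))) [0..<n])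
     (int (length (xs @ [bt b2]) + n))))"
    unfolding coin_loop_def
    by (rule exec_While_True[OF _ body rest[unfolded coin_loop_def]]) (use Suc.prems in \<open>simp add: read_list_tape\<close>)
  moreover have eq: "map (\<lambda>k. bt (r ! (4 * k + 2))) [0..<Suc n] = bt b2 # map (\<lambda>k. bt (r' ! (4 * k + 2))) [0..<n]"
    using r(1) by (subst upt_conv_Cons, simp, subst map_Suc_upt[symmetric], simp add: numeral_2_eq_2)
  have "?s2(1 := list_tape ((xs @ [bt b2]) @ map (\<lambda>k. bt (r' ! (4 * k + 2))) [0..<n])
     (int (length (xs @ [bt b2]) + n))) =
     s(1 := list_tape (xs @ map (\<lambda>k. bt (r ! (4 * k + 2))) [0..<Suc n]) (int (length xs + Suc n)))"
    unfolding eq fun_upd_upd by simp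
  ultimately show ?case using r(1) by (simp only: append_Cons append_Nil)
qed

text \<open>The square makes the universe exceed \<open>L * L\<close>, which bounds the degrees of
  the squared matching weights. The padding also supplies positions above all cells, one of which
  serves as the final head of a clow sequence.\<close>

definition pad :: "bool list \<Rightarrow> nat list" where
  "pad x = map bt x @ replicate (length x * length x + 1) 3"

lemma length_pad [simp]: "length (pad x) = length x + length x * length x + 1"
  by (simp add: pad_def)

lemma pad_nonzero [simp]: "0 \<notin> set (pad x)"
  by (auto simp: pad_def)

text \<open>Two nested loops over copies of the input write the \<open>L * L\<close> padding
  symbols, and a loop over all triples of positions marks out the tape for the random symbols; no
  number has to be computed.\<close>

definition prep :: com where
  "prep = Seq (copy 0 3) (Seq (copy 0 4) (Seq (goto_end 0) (Seq (For 3 (For 4 (append_sym 0 (\<lambda>_. 3))))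
    (Seq (append_sym 0 (\<lambda>_. 3)) (Seq (rewind 0) (Seq (erase 3) (Seq (erase 4)
    (Seq (ForN 3 3 (append_sym 1 (\<lambda>_. 1))) (Seq (rewind 1) (Write 2 (\<lambda>_ _. 1)))))))))))"

lemma wf_prep: "wf_com prep" by (simp add: prep_def)

lemma input_state_list_tape: "input_state x = (\<lambda>_. blank)(0 := list_tape (map bt x) 0)"
  by (auto simp: input_state_def input_tape_def list_tape_def fun_eq_iff)

lemma runs_prep:
  obtains f where "pbound f" "\<And>x. runs prep (input_state x)
    ((\<lambda>_. blank)(0 := list_tape (pad x) 0, 1 := list_tape (replicate (length (pad x) ^ 3) 1) 0, 2 := list_tape [1] 0)) (f (length x))"
proof -
  define f where "f = (\<lambda>n :: nat. (10 * n + 13) + (10 * n + 13) + (2 * n + 1)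
    + (n * ((n * (3 + 3) + 2 * n + 7) + 3) + 2 * n + 7) + 3 + (2 * (n + n * n + 1) + 5)
    + (6 * n + 7) + (6 * n + 7) + ForN_time (n + n * n + 1) 3 3 + (2 * (n + n * n + 1) ^ 3 + 5) + 20)"
  have "runs prep (input_state x)
    ((\<lambda>_. blank)(0 := list_tape (pad x) 0, 1 := list_tape (replicate (length (pad x) ^ 3) 1) 0, 2 := list_tape [1] 0)) (f (length x))"
    for x
  proof -
    define xs where "xs = map bt x"
    define L where "L = length xs"
    let ?bl = "(\<lambda>_. blank) :: state"
    have nz: "0 \<notin> set xs" by (auto simp: xs_def)
    have nzr: "0 \<notin> set (xs @ replicate m 3)" for m using nz by auto
    have 1: "runs (copy 0 3) (?bl(0 := list_tape xs 0)) (?bl(0 := list_tape xs 0, 3 := list_tape xs 0)) (10 * L + 13)"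
      by (rule runs_cong[OF runs_copy[where xs = xs]]) (use nz in \<open>simp_all add: L_def\<close>)
    have 2: "runs (copy 0 4) (?bl(0 := list_tape xs 0, 3 := list_tape xs 0)) (?bl(0 := list_tape xs 0, 3 := list_tape xs 0, 4 := list_tape xs 0)) (10 * L + 13)"
      by (rule runs_cong[OF runs_copy[where xs = xs]]) (use nz in \<open>simp_all add: L_def\<close>)
    define st where "st = (\<lambda>m. ?bl(3 := list_tape xs 0, 4 := list_tape xs 0, 0 := list_tape (xs @ replicate m 3) (int (L + m))))"
    have 3: "runs (goto_end 0) (?bl(0 := list_tape xs 0, 3 := list_tape xs 0, 4 := list_tape xs 0)) (st 0) (2 * L + 1)"
      by (rule runs_cong[OF runs_goto_end[where xs = xs and p = 0]])
        (use nz in \<open>simp_all add: L_def st_def fun_eq_iff\<close>)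
    have 4: "runs (For 3 (For 4 (append_sym 0 (\<lambda>_. 3)))) (st 0) (st (L * L))
      (L * ((L * (3 + 3) + 2 * L + 7) + 3) + 2 * L + 7)"
    proof -
      have ap: "runs (append_sym 0 (\<lambda>_. 3)) ((st m)(3 := t3, 4 := t4)) ((st (Suc m))(3 := t3, 4 := t4)) 3" for m t3 t4
        by (rule runs_cong[OF runs_append_sym[where xs = "xs @ replicate m 3" and v = 3]])
          (simp_all add: st_def L_def fun_eq_iff replicate_append_same algebra_simps)
      have inner: "runs (For 4 (append_sym 0 (\<lambda>_. 3))) ((st m)(3 := t3)) ((st (m + L))(3 := t3)) (L * (3 + 3) + 2 * L + 7)" for m t3
      proof -
        have "runs (For 4 (append_sym 0 (\<lambda>_. 3))) (((st (m + 0))(3 := t3))(4 := list_tape xs 0))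
           (((st (m + length xs))(3 := t3))(4 := list_tape xs 0)) (length xs * (3 + 3) + 2 * length xs + 7)"
          by (rule runs_For[OF nz, where st = "\<lambda>k. (st (m + k))(3 := t3)"]) (use ap in simp)
        moreover have "((st k)(3 := t3))(4 := list_tape xs 0) = (st k)(3 := t3)" for k
          by (simp add: st_def fun_eq_iff)
        ultimately show ?thesis by (simp add: L_def)
      qed
      have "runs (For 3 (For 4 (append_sym 0 (\<lambda>_. 3)))) ((st (0 * L))(3 := list_tape xs 0)) ((st (length xs * L))(3 := list_tape xs 0))
        (length xs * ((L * (3 + 3) + 2 * L + 7) + 3) + 2 * length xs + 7)"
        by (rule runs_For[OF nz, where st = "\<lambda>k. st (k * L)"]) (use inner in \<open>simp only: mult_Suc add.commute[of L]\<close>)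
      moreover have "(st k)(3 := list_tape xs 0) = st k" for k
        by (simp add: st_def fun_eq_iff)
      ultimately show ?thesis by (simp add: L_def)
    qed
    have 5: "runs (append_sym 0 (\<lambda>_. 3)) (st (L * L)) (st (L * L + 1)) 3"
      by (rule runs_cong[OF runs_append_sym[where xs = "xs @ replicate (L * L) 3" and v = 3]])
        (simp_all add: st_def L_def fun_eq_iff replicate_append_same algebra_simps)
    have W: "pad x = xs @ replicate (L * L + 1) 3" by (simp add: pad_def xs_def L_def)
    have lW: "length (pad x) = L + L * L + 1" by (simp add: xs_def L_def)
    have 6: "runs (rewind 0) (st (L * L + 1)) (?bl(3 := list_tape xs 0, 4 := list_tape xs 0, 0 := list_tape (pad x) 0)) (2 * (L + L * L + 1) + 5)"
      unfolding lW[symmetric]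
      by (rule runs_cong[OF runs_rewind[where xs = "pad x" and p = "int (L + (L * L + 1))"]])
        (use lW in \<open>simp_all add: st_def W fun_eq_iff nz algebra_simps\<close>)
    have 7: "runs (erase 3) (?bl(3 := list_tape xs 0, 4 := list_tape xs 0, 0 := list_tape (pad x) 0)) (?bl(4 := list_tape xs 0, 0 := list_tape (pad x) 0)) (6 * L + 7)"
      by (rule runs_cong[OF runs_erase[where xs = xs and p = 0]]) (use nz in \<open>auto simp: L_def fun_eq_iff\<close>)
    have 8: "runs (erase 4) (?bl(4 := list_tape xs 0, 0 := list_tape (pad x) 0)) (?bl(0 := list_tape (pad x) 0)) (6 * L + 7)"
      by (rule runs_cong[OF runs_erase[where xs = xs and p = 0]]) (use nz in \<open>auto simp: L_def fun_eq_iff\<close>)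
    let ?B = "L + L * L + 1"
    define su where "su = (\<lambda>m. ?bl(0 := list_tape (pad x) 0, 1 := list_tape (replicate m 1) (int m)))"
    have 9: "runs (ForN 3 3 (append_sym 1 (\<lambda>_. 1))) (su 0) (su (?B ^ 3)) (ForN_time ?B 3 3)"
    proof (rule runs_ForN[OF pad_nonzero lW])
      fix k
      let ?sv = "set_vars (pad x) 3 (digits ?B 3 k)"
      show "runs (append_sym 1 (\<lambda>_. 1)) (?sv (su k)) (?sv (su (Suc k))) 3"
        by (rule runs_cong[OF runs_append_sym[where xs = "replicate k 1" and v = 1]])
          (simp_all add: set_vars_other set_vars_upd su_def replicate_append_same)
    qed (simp_all add: su_def)
    have s0: "su 0 = ?bl(0 := list_tape (pad x) 0)" by (simp add: su_def fun_eq_iff)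
    let ?s = "?bl(0 := list_tape (pad x) 0, 1 := list_tape (replicate (?B ^ 3) 1) 0)"
    have 10: "runs (rewind 1) (su (?B ^ 3)) ?s (2 * ?B ^ 3 + 5)"
      by (rule runs_cong[OF runs_rewind[where xs = "replicate (?B ^ 3) 1" and p = "int (?B ^ 3)"]])
        (simp_all add: su_def)
    have 11: "runs (Write 2 (\<lambda>_ _. 1)) ?s (?s(2 := list_tape [1] 0)) 1"
      by (rule runs_Write'[where v = 1]) (simp_all add: write_blank_reg[simplified])
    have "runs prep (?bl(0 := list_tape xs 0)) (?s(2 := list_tape [1] 0)) (f L)"
      unfolding prep_def
      by (rule runs_cong[OF runs_Seq[OF 1 runs_Seq[OF 2 runs_Seq[OF 3 runs_Seq[OF 4 runs_Seq[OF 5 runs_Seq[OF 6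
          runs_Seq[OF 7 runs_Seq[OF 8 runs_Seq[OF 9[unfolded s0] runs_Seq[OF 10 11]]]]]]]]]] refl])
        (simp add: f_def)
    then show ?thesis using lW by (simp add: input_state_list_tape xs_def L_def)
  qed
  moreover have "pbound (\<lambda>n. ForN_time (n + n * n + 1) 3 3)"
    by (rule pbound_compose[where f = "\<lambda>n. ForN_time n 3 3"]) (intro pbound_intros)+
  then have "pbound f" unfolding f_def
    by (intro pbound_add pbound_mult pbound_power pbound_const pbound_id)
  ultimately show ?thesis using that by blast
qed

definition world_of :: "bool list \<Rightarrow> (nat \<Rightarrow> bool) \<Rightarrow> world" where
  "world_of x \<rho> = (pad x, map (\<lambda>k. bt (\<rho> k)) [0..<length (pad x) ^ 3])"

lemma valid_world_of: "valid (world_of x \<rho>)"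
  by (auto simp: valid_def world_of_def)

text \<open>After the preparation one coin is tossed for each triple of positions, and
  \<open>F\<close> is evaluated without further coins. As the durations do not depend on the coins,
  the random symbols come from fixed indices of the coin string.\<close>

theorem definable_machine:
  assumes "definable F"
  obtains M p pos where "ptm_wf M" "\<And>x. pos x + 4 * length (pad x) ^ 3 \<le> poly p (length x)"
    "\<And>x r. length r = poly p (length x) \<Longrightarrow> halted M (ptm_run M x r) \<and>
       (fst (ptm_run M x r) = accept_state M \<longleftrightarrow> F (world_of x (\<lambda>k. r ! (pos x + 4 * k))) (\<lambda>_. 0))"
proof -
  have "alloc (\<lambda>_. 0) 3" by (simp add: alloc_def)
  from definableE[OF assms this] obtain c f where c: "wf_com c" "pbound f" "computes c (\<lambda>_. 0) 3 f F" by blast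
  obtain g where g: "pbound g" "\<And>x. runs prep (input_state x)
    ((\<lambda>_. blank)(0 := list_tape (pad x) 0, 1 := list_tape (replicate (length (pad x) ^ 3) 1) 0, 2 := list_tape [1] 0)) (g (length x))"
    using runs_prep by blast
  define c' where "c' = Seq prep (Seq coin_loop (Seq (rewind 1) c))"
  define B where "B = (\<lambda>n :: nat. n + n * n + 1)"
  define h where "h = (\<lambda>n. g n + 6 * B n ^ 3 + f (B n) + 20)"
  have "pbound (\<lambda>n. f (B n))" unfolding B_def
    by (rule pbound_compose[OF c(2)]) (intro pbound_intros)
  then have "pbound h" unfolding h_def B_def
    by (intro pbound_add pbound_mult pbound_power pbound_const pbound_id g(1))
  then obtain p where p: "\<And>n. h n \<le> poly p n" unfolding pbound_def by blast
  have "wf_com c'" using c(1) by (simp add: c'_def wf_prep coin_loop_def)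
  from compile_correct[OF this] obtain M where M: "ptm_wf M" "accept_state M = 0"
    "\<And>x r b s'. fold com_step r ([c'], input_state x) = ([], s') \<Longrightarrow>
       halted M (ptm_run M x (r @ [b])) \<and> (fst (ptm_run M x (r @ [b])) = 0 \<longleftrightarrow> read_tape (s' 2) = 2)"
    by blast
  define s1 :: "bool list \<Rightarrow> state" where "s1 = (\<lambda>x. (\<lambda>_. blank)(0 := list_tape (pad x) 0, 1 := list_tape (replicate (length (pad x) ^ 3) 1) 0, 2 := list_tape [1] 0))"
  have "\<exists>n\<le>g (length x). \<forall>r. length r = n \<longrightarrow> exec prep (input_state x) r (s1 x)" for x
    using g(2)[of x] unfolding runs_def s1_def .
  then obtain n1 where n1: "\<And>x. n1 x \<le> g (length x)"
    "\<And>x r. length r = n1 x \<Longrightarrow> exec prep (input_state x) r (s1 x)" by metis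
  \<comment> \<open>The first random symbol is preceded by \<open>n1 x\<close> steps of
    \<open>prep\<close>, two steps unfolding the outer \<open>Seq\<close> commands, the first loop
    test and the \<open>Seq\<close> of the loop body.\<close>
  define pos where "pos = (\<lambda>x. n1 x + 4)"
  have B: "B (length x) = length (pad x)" for x by (simp add: B_def)
  have pos: "pos x + 4 * length (pad x) ^ 3 \<le> poly p (length x)" for x
    using n1(1)[of x] p[of "length x"] by (simp add: pos_def h_def B)
  have main: "halted M (ptm_run M x r) \<and>
       (fst (ptm_run M x r) = accept_state M \<longleftrightarrow> F (world_of x (\<lambda>k. r ! (pos x + 4 * k))) (\<lambda>_. 0))"
    if r: "length r = poly p (length x)" for x r
  proof -
    let ?n = "length (pad x) ^ 3"
    define w where "w = world_of x (\<lambda>k. r ! (pos x + 4 * k))"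
    have w: "fst w = pad x" "snd w = map (\<lambda>k. bt (r ! (pos x + 4 * k))) [0..<?n]"
      by (simp_all add: w_def world_of_def)
    define q1 where "q1 = take (n1 x) (drop 1 r)"
    define q2 where "q2 = take (4 * ?n + 1) (drop (n1 x + 2) r)"
    have len: "g (length x) + 6 * ?n + f (length (pad x)) + 20 \<le> length r"
      using p[of "length x"] r by (simp add: h_def B)
    have l: "length q1 = n1 x" "length q2 = 4 * ?n + 1"
      using len n1(1)[of x] by (auto simp: q1_def q2_def)
    have e1: "exec prep (input_state x) q1 (s1 x)" by (rule n1(2)[OF l(1)])
    have "exec coin_loop (s1 x) q2 ((s1 x)(1 := list_tape ([] @ map (\<lambda>k. bt (q2 ! (4 * k + 2))) [0..<?n]) (int (length ([] :: nat list) + ?n))))"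
      by (rule exec_coin_loop) (use l in \<open>simp_all add: s1_def\<close>)
    moreover have "map (\<lambda>k. bt (q2 ! (4 * k + 2))) [0..<?n] = snd w"
      unfolding w
    proof (intro map_cong refl)
      fix k assume "k \<in> set [0..<?n]"
      then have k: "k < ?n" by simp
      have idx: "n1 x + 2 + (4 * k + 2) = pos x + 4 * k" by (simp add: pos_def)
      have "q2 ! (4 * k + 2) = drop (n1 x + 2) r ! (4 * k + 2)"
        unfolding q2_def using k by (intro nth_take) linarith
      also have "\<dots> = r ! (n1 x + 2 + (4 * k + 2))"
        using len n1(1)[of x] by (intro nth_drop) linarith
      finally show "bt (q2 ! (4 * k + 2)) = bt (r ! (pos x + 4 * k))" unfolding idx by simp
    qed
    ultimately have e2: "exec coin_loop (s1 x) q2 ((s1 x)(1 := list_tape (snd w) (int ?n)))" by simp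
    let ?s2 = "(s1 x)(1 := list_tape (snd w) 0)"
    have v: "valid w" by (simp add: w_def valid_world_of)
    have 3: "runs (rewind 1) ((s1 x)(1 := list_tape (snd w) (int ?n))) ?s2 (2 * ?n + 5)"
      by (rule runs_cong[OF runs_rewind[where xs = "snd w" and p = "int ?n"]])
        (use v in \<open>auto simp: w valid_def\<close>)
    have "layout w (\<lambda>_. 0) (\<lambda>_. 0) 3 ?s2" by (auto simp: layout_def w s1_def)
    from computesD[OF c(3) v this]
    have 4: "runs c ?s2 (?s2(2 := res (F w (\<lambda>_. 0)))) (f (length (pad x)))" by (simp add: w)
    obtain n3 where n3: "n3 \<le> 2 * ?n + 5 + f (length (pad x)) + 1"
      "\<And>r. length r = n3 \<Longrightarrow> exec (Seq (rewind 1) c) ((s1 x)(1 := list_tape (snd w) (int ?n))) r (?s2(2 := res (F w (\<lambda>_. 0))))"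
      using runs_Seq[OF 3 4] unfolding runs_def by blast
    define q3 where "q3 = take n3 (drop (n1 x + 2 + (4 * ?n + 1)) r)"
    have l3: "length q3 = n3" using len n1(1)[of x] n3(1) by (simp add: q3_def)
    define m where "m = n1 x + 2 + (4 * ?n + 1) + n3"
    have m: "m < length r" using len n1(1)[of x] n3(1) by (simp add: m_def)
    have e: "exec c' (input_state x) (r ! 0 # q1 @ r ! (n1 x + 1) # q2 @ q3) (?s2(2 := res (F w (\<lambda>_. 0))))"
      unfolding c'_def by (rule exec_Seq[OF e1 exec_Seq[OF e2 n3(2)[OF l3]]])
    have "take m r = r ! 0 # q1 @ r ! (n1 x + 1) # q2 @ q3"
    proof -
      have "take m r = take 1 r @ take (n1 x) (drop 1 r) @ take 1 (drop (n1 x + 1) r) @ q2 @ q3"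
      proof -
        have mm: "m = 1 + (n1 x + (1 + ((4 * ?n + 1) + n3)))" by (simp add: m_def)
        show ?thesis
          unfolding mm take_add drop_drop q2_def q3_def by (simp only: ac_simps one_add_one[symmetric])
      qed
      moreover have "take 1 r = [r ! 0]" "take 1 (drop (n1 x + 1) r) = [r ! (n1 x + 1)]"
        using m take_Suc_conv_app_nth[of 0 r] take_Suc_conv_app_nth[of 0 "drop (n1 x + 1) r"]
        by (cases r; simp add: m_def)+
      ultimately show ?thesis by (simp add: q1_def)
    qed
    with e have "fold com_step (take m r) ([c'], input_state x) = ([], ?s2(2 := res (F w (\<lambda>_. 0))))"
      unfolding exec_def by simp
    from M(3)[OF this, of "r ! m"] m
    have H: "halted M (ptm_run M x (take (Suc m) r))"
      "fst (ptm_run M x (take (Suc m) r)) = 0 \<longleftrightarrow> F w (\<lambda>_. 0)"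
      by (simp_all add: take_Suc_conv_app_nth read_list_tape)
    \<comment> \<open>A halted machine ignores the remaining coins, so the exact running time may be
      rounded up to the polynomial.\<close>
    have stay: "fold (ptm_step M) q C = C" if "halted M C" for q C
      using that by (induction q) (simp_all add: ptm_step_def)
    have "ptm_run M x r = fold (ptm_step M) (drop (Suc m) r) (ptm_run M x (take (Suc m) r))"
      unfolding ptm_run_def by (metis append_take_drop_id fold_append o_apply)
    then have "ptm_run M x r = ptm_run M x (take (Suc m) r)" using stay[OF H(1)] by simp
    then show ?thesis using H M(2) by (simp add: w_def)
  qed
  show ?thesis using that[OF M(1) pos main] .
qed

section \<open>Matchings and closed walks in characteristic two\<close>

lemma double_zero:
  fixes x :: "'a :: comm_ring_1"
  assumes "(1 :: 'a) + 1 = 0"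
  shows "x + x = 0"
  by (metis assms distrib_left mult_1_right mult_zero_right)

text \<open>The terms at \<open>(u, v)\<close> and \<open>(v, u)\<close> are equal and cancel; only
  the diagonal survives.\<close>

lemma symmetric_sum_char2:
  fixes f :: "'b \<Rightarrow> 'b \<Rightarrow> 'a :: comm_ring_1"
  assumes two: "(1 :: 'a) + 1 = 0" and "finite S" and sym: "\<And>u v. u \<in> S \<Longrightarrow> v \<in> S \<Longrightarrow> f u v = f v u"
  shows "(\<Sum>u\<in>S. \<Sum>v\<in>S. f u v) = (\<Sum>u\<in>S. f u u)"
  using assms(2,3)
proof (induction S rule: finite_induct)
  case (insert x S)
  have "(\<Sum>u\<in>insert x S. \<Sum>v\<in>insert x S. f u v) =
     f x x + (\<Sum>v\<in>S. f x v) + ((\<Sum>u\<in>S. f u x) + (\<Sum>u\<in>S. \<Sum>v\<in>S. f u v))"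
    using insert.hyps by (simp add: sum.distrib)
  also have "(\<Sum>u\<in>S. f u x) = (\<Sum>v\<in>S. f x v)"
    using insert.prems by (intro sum.cong) auto
  also have "f x x + (\<Sum>v\<in>S. f x v) + ((\<Sum>v\<in>S. f x v) + (\<Sum>u\<in>S. \<Sum>v\<in>S. f u v)) =
     f x x + (\<Sum>u\<in>S. \<Sum>v\<in>S. f u v) + ((\<Sum>v\<in>S. f x v) + (\<Sum>v\<in>S. f x v))"
    by (simp add: algebra_simps)
  also have "\<dots> = f x x + (\<Sum>u\<in>S. \<Sum>v\<in>S. f u v)"
    by (simp only: double_zero[OF two] add_0_right)
  finally show ?case using insert by simp
qed simp

definition matchings :: "'v set \<Rightarrow> 'v set set set" where
  "matchings S = {M. M \<subseteq> {e. e \<subseteq> S \<and> card e = 2} \<and> pairwise disjnt M}"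

lemma finite_matchings: "finite S \<Longrightarrow> finite (matchings S)"
  unfolding matchings_def
  by (rule finite_subset[of _ "Pow (Pow S)"]) auto

lemma finite_matching: "finite S \<Longrightarrow> M \<in> matchings S \<Longrightarrow> finite M"
  unfolding matchings_def by (auto intro: finite_subset[of _ "Pow S"])

lemma matchings_covering:
  assumes v: "v \<in> S"
  shows "{M \<in> matchings S. v \<in> \<Union>M} = (\<Union>u\<in>S - {v}. insert {v, u} ` matchings (S - {v, u}))"
proof (intro equalityI subsetI)
  fix M assume "M \<in> {M \<in> matchings S. v \<in> \<Union>M}"
  then obtain e where M: "M \<in> matchings S" and e: "e \<in> M" "v \<in> e" by auto
  have "e \<subseteq> S" "card e = 2" using M e by (auto simp: matchings_def)
  then obtain u where u: "e = {v, u}" "u \<noteq> v" "u \<in> S"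
    using e(2) by (auto simp: card_2_iff)
  have "M - {e} \<in> matchings (S - {v, u})"
  proof -
    have "f \<inter> e = {}" if "f \<in> M - {e}" for f
      using M e(1) that unfolding matchings_def pairwise_def disjnt_def by blast
    then show ?thesis using M u unfolding matchings_def pairwise_def by blast
  qed
  then show "M \<in> (\<Union>u\<in>S - {v}. insert {v, u} ` matchings (S - {v, u}))"
    using u e(1) by (intro UN_I[of u] image_eqI[of _ _ "M - {e}"]) auto
next
  fix M assume "M \<in> (\<Union>u\<in>S - {v}. insert {v, u} ` matchings (S - {v, u}))"
  then obtain u M' where u: "u \<in> S" "u \<noteq> v" and M': "M' \<in> matchings (S - {v, u})" "M = insert {v, u} M'"
    by auto
  have "f \<inter> {v, u} = {}" if "f \<in> M'" for f using M'(1) that unfolding matchings_def by blast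
  then show "M \<in> {M \<in> matchings S. v \<in> \<Union>M}"
    using M' u v unfolding matchings_def pairwise_def disjnt_def by (auto simp: card_2_iff)
qed

text \<open>Either \<open>v\<close> is uncovered or it has a unique partner \<open>u\<close>, and
  removing their edge leaves a matching of the other vertices.\<close>

lemma sum_matchings_rec:
  fixes \<beta> :: "'v set \<Rightarrow> 'a :: comm_ring_1"
  assumes S: "finite S" "v \<in> S"
  shows "(\<Sum>M\<in>matchings S. prod \<beta> M) =
     (\<Sum>M\<in>matchings (S - {v}). prod \<beta> M) +
     (\<Sum>u\<in>S - {v}. \<beta> {v, u} * (\<Sum>M\<in>matchings (S - {v, u}). prod \<beta> M))"
proof -
  have nin: "{v, u} \<notin> M" if "M \<in> matchings (S - {v, u})" for M u
    using that by (auto simp: matchings_def)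
  have "(\<Sum>M\<in>matchings S. prod \<beta> M) =
      (\<Sum>M\<in>{M \<in> matchings S. v \<notin> \<Union>M}. prod \<beta> M) + (\<Sum>M\<in>{M \<in> matchings S. v \<in> \<Union>M}. prod \<beta> M)"
    using finite_matchings[OF S(1)]
    by (subst sum.union_disjoint[symmetric]) (auto intro!: sum.cong)
  also have "{M \<in> matchings S. v \<notin> \<Union>M} = matchings (S - {v})"
    by (auto simp: matchings_def)
  also have "(\<Sum>M\<in>{M \<in> matchings S. v \<in> \<Union>M}. prod \<beta> M) =
      (\<Sum>u\<in>S - {v}. \<Sum>M\<in>insert {v, u} ` matchings (S - {v, u}). prod \<beta> M)"
    unfolding matchings_covering[OF S(2)]
  proof (rule sum.UNION_disjoint)
    show "\<forall>u\<in>S - {v}. \<forall>u'\<in>S - {v}. u \<noteq> u' \<longrightarrow>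
      insert {v, u} ` matchings (S - {v, u}) \<inter> insert {v, u'} ` matchings (S - {v, u'}) = {}"
    proof (intro ballI impI)
      fix u u' assume u: "u \<in> S - {v}" "u' \<in> S - {v}" "u \<noteq> u'"
      have False if "M \<in> matchings (S - {v, u})" "M' \<in> matchings (S - {v, u'})"
        "insert {v, u} M = insert {v, u'} M'" for M M'
      proof -
        have "{v, u'} \<in> M" using that(3) u by (auto simp: doubleton_eq_iff)
        then show False using that(1) by (auto simp: matchings_def)
      qed
      then show "insert {v, u} ` matchings (S - {v, u}) \<inter> insert {v, u'} ` matchings (S - {v, u'}) = {}"
        by blast
    qed
  qed (use S finite_matchings in auto)
  also have "\<dots> = (\<Sum>u\<in>S - {v}. \<beta> {v, u} * (\<Sum>M\<in>matchings (S - {v, u}). prod \<beta> M))"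
  proof (intro sum.cong refl)
    fix u
    have "inj_on (insert {v, u}) (matchings (S - {v, u}))"
      using nin[of _ u] by (auto simp: inj_on_def) (metis insert_ident)+
    then have "(\<Sum>M\<in>insert {v, u} ` matchings (S - {v, u}). prod \<beta> M) =
        (\<Sum>M\<in>matchings (S - {v, u}). prod \<beta> (insert {v, u} M))"
      by (simp add: sum.reindex)
    also have "\<dots> = (\<Sum>M\<in>matchings (S - {v, u}). \<beta> {v, u} * prod \<beta> M)"
      using nin[of _ u] finite_matching[of "S - {v, u}"] S(1) by (intro sum.cong refl prod.insert) auto
    finally show "(\<Sum>M\<in>insert {v, u} ` matchings (S - {v, u}). prod \<beta> M) =
        \<beta> {v, u} * (\<Sum>M\<in>matchings (S - {v, u}). prod \<beta> M)"
      by (simp add: sum_distrib_left)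
  qed
  finally show ?thesis .
qed

section \<open>Generating functions of walks and clow sequences in characteristic two\<close>

context
  fixes \<alpha> :: "nat set \<Rightarrow> 'a :: comm_ring_1"
  assumes two: "(1 :: 'a) + 1 = 0"
begin

definition adj :: "nat \<Rightarrow> nat \<Rightarrow> 'a" where
  "adj u v = (if u = v then 0 else \<alpha> {u, v})"

definition adjX :: "nat \<Rightarrow> nat \<Rightarrow> 'a fps" where
  "adjX u v = fps_const (adj u v) * fps_X"

fun walks :: "nat set \<Rightarrow> nat \<Rightarrow> nat \<Rightarrow> nat \<Rightarrow> 'a" where
  "walks S 0 u v = (if u = v then 1 else 0)"
| "walks S (Suc l) u v = (\<Sum>x\<in>S. adj u x * walks S l x v)"

text \<open>With \<open>A\<close> the weighted adjacency matrix on \<open>S\<close>, these are the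
  entries of the inverse of \<open>1 - X A\<close>.\<close>

definition walksX :: "nat set \<Rightarrow> nat \<Rightarrow> nat \<Rightarrow> 'a fps" where
  "walksX S u v = Abs_fps (\<lambda>l. walks S l u v)"

lemma adj_sym: "adj u v = adj v u" by (simp add: adj_def insert_commute)

lemma adjX_sym: "adjX u v = adjX v u" by (simp add: adjX_def adj_sym)

lemma adjX_self [simp]: "adjX u u = 0" by (simp add: adjX_def adj_def)

lemma walks_right:
  assumes "finite S" "u \<in> S" "v \<in> S"
  shows "walks S (Suc l) u v = (\<Sum>x\<in>S. walks S l u x * adj x v)"
  using assms(2)
proof (induction l arbitrary: u)
  case 0
  then show ?case using assms by (simp add: if_distrib[of "\<lambda>t. _ * t"] if_distrib[of "\<lambda>t. t * _"] sum.delta cong: if_cong)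
next
  case (Suc l)
  have "walks S (Suc (Suc l)) u v = (\<Sum>y\<in>S. adj u y * walks S (Suc l) y v)" by simp
  also have "\<dots> = (\<Sum>y\<in>S. adj u y * (\<Sum>x\<in>S. walks S l y x * adj x v))"
    using Suc.IH by (intro sum.cong) auto
  also have "\<dots> = (\<Sum>x\<in>S. (\<Sum>y\<in>S. adj u y * walks S l y x) * adj x v)"
    by (simp add: sum_distrib_left sum_distrib_right mult.assoc) (rule sum.swap)
  finally show ?case by simp
qed

lemma walks_sym:
  assumes "finite S" "u \<in> S" "v \<in> S"
  shows "walks S l u v = walks S l v u"
  using assms(2,3)
proof (induction l arbitrary: u v)
  case (Suc l)
  have "walks S (Suc l) u v = (\<Sum>x\<in>S. adj u x * walks S l x v)" by simp
  also have "\<dots> = (\<Sum>x\<in>S. walks S l v x * adj x u)"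
    using Suc by (intro sum.cong) (auto simp: adj_sym mult.commute)
  also have "\<dots> = walks S (Suc l) v u" using walks_right[OF assms(1)] Suc.prems by metis
  finally show ?case .
qed auto

lemma walksX_sym: "finite S \<Longrightarrow> u \<in> S \<Longrightarrow> v \<in> S \<Longrightarrow> walksX S u v = walksX S v u"
  by (simp add: walksX_def walks_sym)

lemma walksX_left:
  assumes "u \<in> S" "v \<in> S"
  shows "walksX S u v = (if u = v then 1 else 0) + (\<Sum>x\<in>S. adjX u x * walksX S x v)"
proof (rule fps_ext)
  fix l
  show "fps_nth (walksX S u v) l = fps_nth ((if u = v then 1 else 0) + (\<Sum>x\<in>S. adjX u x * walksX S x v)) l"
    by (cases l) (auto simp: walksX_def adjX_def fps_sum_nth mult.assoc)
qed

lemma walksX_right: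
  assumes "finite S" "u \<in> S" "v \<in> S"
  shows "walksX S u v = (if u = v then 1 else 0) + (\<Sum>x\<in>S. walksX S u x * adjX x v)"
proof -
  have "walksX S u v = walksX S v u" using assms by (rule walksX_sym)
  also have "\<dots> = (if u = v then 1 else 0) + (\<Sum>x\<in>S. adjX v x * walksX S x u)"
    using walksX_left[of v S u] assms by auto
  also have "(\<Sum>x\<in>S. adjX v x * walksX S x u) = (\<Sum>x\<in>S. walksX S u x * adjX x v)"
    using assms by (intro sum.cong) (auto simp: adjX_sym[of v] walksX_sym[of S _ u] mult.commute)
  finally show ?thesis .
qed

text \<open>The system reads \<open>(1 - X A) Y = c\<close>. Multiplying it from the left by
  \<open>walksX S\<close>, the inverse matrix, isolates \<open>Y u\<close>.\<close>

lemma linear_system_unique: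
  assumes S: "finite S" "u \<in> S"
    and Y: "\<And>u. u \<in> S \<Longrightarrow> Y u = c u + (\<Sum>x\<in>S. adjX u x * Y x)"
  shows "Y u = (\<Sum>x\<in>S. walksX S u x * c x)"
proof -
  have "(\<Sum>x\<in>S. walksX S u x * Y x) =
      (\<Sum>x\<in>S. walksX S u x * c x) + (\<Sum>x\<in>S. \<Sum>y\<in>S. walksX S u x * adjX x y * Y y)"
  proof -
    have "walksX S u x * Y x = walksX S u x * c x + (\<Sum>y\<in>S. walksX S u x * adjX x y * Y y)" if "x \<in> S" for x
      by (subst Y[OF that]) (simp add: distrib_left sum_distrib_left mult.assoc)
    then show ?thesis by (simp add: sum.distrib)
  qed
  also have "(\<Sum>x\<in>S. \<Sum>y\<in>S. walksX S u x * adjX x y * Y y) = (\<Sum>y\<in>S. (\<Sum>x\<in>S. walksX S u x * adjX x y) * Y y)"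
    by (subst sum.swap) (simp add: sum_distrib_right)
  also have "\<dots> = (\<Sum>y\<in>S. (walksX S u y - (if u = y then 1 else 0)) * Y y)"
    using S walksX_right[OF S] by (intro sum.cong refl) simp
  also have "\<dots> = (\<Sum>y\<in>S. walksX S u y * Y y) - (\<Sum>y\<in>S. if u = y then Y y else 0)"
    by (simp add: left_diff_distrib sum_subtractf if_distrib[of "\<lambda>t. t * _"] cong: if_cong)
  also have "(\<Sum>y\<in>S. if u = y then Y y else 0) = Y u" using S by simp
  finally show ?thesis by simp
qed

text \<open>Closed walks at \<open>v\<close> whose inner vertices all lie in \<open>T\<close>; when
  \<open>v\<close> is not in \<open>T\<close>, these are the first returns to
  \<open>v\<close>.\<close>

definition returns :: "nat set \<Rightarrow> nat \<Rightarrow> 'a fps" where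
  "returns T v = (\<Sum>u\<in>T. \<Sum>x\<in>T. adjX v u * walksX T u x * adjX x v)"

text \<open>The squares are dictated by the walks: going back and forth along a matched edge uses
  its weight twice and has length two.\<close>

definition matchX :: "nat set \<Rightarrow> 'a fps" where
  "matchX S = (\<Sum>M\<in>matchings S. \<Prod>e\<in>M. (fps_const (\<alpha> e) * fps_X)\<^sup>2)"

lemma twoX: "(1 :: 'a fps) + 1 = 0"
proof -
  have "(1 :: 'a fps) + 1 = fps_const (1 + 1)" by (simp only: fps_const_add[symmetric] fps_const_1_eq_1)
  then show ?thesis by (simp only: two fps_const_0_eq_0)
qed

text \<open>A closed walk at \<open>u\<close> is a sequence of first returns, which gives the
  geometric series of \<open>returns (S - {u}) u\<close>; in characteristic two \<open>1 - r\<close>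
  is \<open>1 + r\<close>.\<close>

lemma walksX_diag:
  assumes S: "finite S" "u \<in> S"
  shows "walksX S u u * (1 + returns (S - {u}) u) = 1"
proof -
  let ?T = "S - {u}"
  have T: "finite ?T" using S by simp
  have ins: "S = insert u ?T" using S by auto
  have split: "(\<Sum>x\<in>S. g x) = g u + (\<Sum>x\<in>?T. g x)" for g :: "nat \<Rightarrow> 'a fps"
    using S by (simp add: sum.remove)
  \<comment> \<open>Decomposition at the first visit to \<open>u\<close>: up to its predecessor
    \<open>y\<close> the walk stays in \<open>?T\<close>.\<close>
  have off: "walksX S x u = (\<Sum>y\<in>?T. walksX ?T x y * (adjX y u * walksX S u u))" if x: "x \<in> ?T" for x
  proof (rule linear_system_unique[OF T x])
    fix x assume "x \<in> ?T"
    then show "walksX S x u = adjX x u * walksX S u u + (\<Sum>y\<in>?T. adjX x y * walksX S y u)"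
      using walksX_left[of x S u] S(2) split by auto
  qed
  have "walksX S u u = 1 + (\<Sum>x\<in>?T. adjX u x * walksX S x u)"
    using walksX_left[OF S(2) S(2)] split by simp
  also have "(\<Sum>x\<in>?T. adjX u x * walksX S x u) =
      (\<Sum>x\<in>?T. adjX u x * (\<Sum>y\<in>?T. walksX ?T x y * (adjX y u * walksX S u u)))"
    using off by (intro sum.cong) auto
  also have "\<dots> = returns ?T u * walksX S u u"
    by (simp add: returns_def sum_distrib_left sum_distrib_right mult.assoc)
  finally have "walksX S u u = 1 + returns ?T u * walksX S u u" .
  then have "walksX S u u + returns ?T u * walksX S u u =
      (1 + returns ?T u * walksX S u u) + returns ?T u * walksX S u u"
    by (rule arg_cong[where f = "\<lambda>t. t + returns ?T u * walksX S u u"])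
  also have "\<dots> = 1" by (simp only: add.assoc double_zero[OF twoX] add_0_right)
  finally show ?thesis by (simp add: distrib_left mult.commute)
qed

text \<open>Reversal exchanges the first and the last inner vertex of a returning walk, so the terms
  in which these differ cancel. What remains leaves and returns along the same edge.\<close>

lemma returns_char2:
  assumes "finite T"
  shows "returns T v = (\<Sum>u\<in>T. (adjX v u)\<^sup>2 * walksX T u u)"
proof -
  have "returns T v = (\<Sum>u\<in>T. adjX v u * walksX T u u * adjX u v)"
    unfolding returns_def
    using assms by (intro symmetric_sum_char2[OF twoX])
      (auto simp: walksX_sym[of T] adjX_sym mult_ac)
  then show ?thesis by (simp add: adjX_sym[of _ v] power2_eq_square mult_ac)
qed

lemma matchX_rec:
  assumes "finite S" "v \<in> S"
  shows "matchX S = matchX (S - {v}) + (\<Sum>u\<in>S - {v}. (adjX v u)\<^sup>2 * matchX (S - {v} - {u}))"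
proof -
  have "(fps_const (\<alpha> {v, u}) * fps_X)\<^sup>2 = (adjX v u)\<^sup>2" if "u \<in> S - {v}" for u
    using that by (auto simp: adjX_def adj_def)
  moreover have "S - {v, u} = S - {v} - {u}" for u by auto
  ultimately show ?thesis unfolding matchX_def sum_matchings_rec[OF assms] by simp
qed

text \<open>
  In characteristic two the closed walks that differ from their reversal cancel, so that the walks
  returning to \<open>v\<close> satisfy the recursion of the matchings covering \<open>v\<close>.
\<close>

theorem matchX_eq:
  assumes "finite S" "v \<in> S"
  shows "matchX S = (1 + returns (S - {v}) v) * matchX (S - {v})"
  using assms
proof (induction "card S" arbitrary: S v rule: less_induct)
  case less
  let ?T = "S - {v}"
  have T: "finite ?T" "card ?T < card S" using less.prems by (auto intro!: psubset_card_mono simp del: card_Diff_insert)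
  \<comment> \<open>The induction hypothesis for \<open>?T\<close> at \<open>u\<close> contains the
    factor \<open>1 + returns (?T - {u}) u\<close>, and the diagonal entry of \<open>walksX\<close>
    is its inverse.\<close>
  have "matchX (?T - {u}) = walksX ?T u u * matchX ?T" if u: "u \<in> ?T" for u
    using less.hyps[OF T(2) T(1) u] walksX_diag[OF T(1) u] by (simp flip: mult.assoc)
  then have "(\<Sum>u\<in>?T. (adjX v u)\<^sup>2 * matchX (?T - {u})) = returns ?T v * matchX ?T"
    by (simp add: returns_char2[OF T(1)] sum_distrib_right mult.assoc)
  then show ?case using matchX_rec[OF less.prems] by (simp add: algebra_simps)
qed

text \<open>
  A clow sequence is traversed as a walk on pairs of its current head \<open>h\<close> and its current vertex
  \<open>u\<close>: a step leads to a vertex above the head, or back to the head, where a larger head is chosen.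
\<close>

definition clow_step :: "nat \<Rightarrow> nat \<Rightarrow> nat \<Rightarrow> nat \<Rightarrow> 'a" where
  "clow_step h u h' u' =
     (if h' = h \<and> h < u' then adj u u' else 0) + (if u' = h' \<and> h < h' then adj u h else 0)"

text \<open>The walks start at \<open>(h, h)\<close> for every \<open>h\<close> at once, so that the
  choice of the first head is part of the sum.\<close>

fun clows :: "nat \<Rightarrow> nat \<Rightarrow> nat \<Rightarrow> nat \<Rightarrow> 'a" where
  "clows B 0 h u = (if h = u then 1 else 0)"
| "clows B (Suc n) h' u' = (\<Sum>h<B. \<Sum>u<B. clows B n h u * clow_step h u h' u')"

definition clowsX :: "nat \<Rightarrow> nat \<Rightarrow> nat \<Rightarrow> 'a fps" where
  "clowsX B h u = Abs_fps (\<lambda>n. clows B n h u)"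

lemma clows_below: "u < h \<Longrightarrow> clows B n h u = 0"
  by (cases n) (auto simp: clow_step_def intro!: sum.neutral)

lemma adjX_nth_0 [simp]: "fps_nth (adjX u v) 0 = 0" by (simp add: adjX_def)

lemma nth_mult_adjX [simp]:
  "fps_nth (A * adjX u v) 0 = 0" "fps_nth (A * adjX u v) (Suc n) = fps_nth A n * adj u v"
  by (simp_all add: adjX_def mult.assoc[symmetric] fps_mult_nth_0)

lemma nth_adjX_mult [simp]:
  "fps_nth (adjX u v * A) 0 = 0" "fps_nth (adjX u v * A) (Suc n) = adj u v * fps_nth A n"
  by (simp_all add: mult.commute[of "adjX u v"] mult.commute[of "adj u v"])

lemma clowsX_above:
  assumes "h < u" "u < B"
  shows "clowsX B h u = clowsX B h h * adjX h u + (\<Sum>x\<in>{h<..<B}. adjX u x * clowsX B h x)"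
proof (rule fps_ext)
  fix n
  have split: "(\<Sum>x<B. g x) = (\<Sum>x<h. g x) + (g h + (\<Sum>x\<in>{h<..<B}. g x))" for g :: "nat \<Rightarrow> 'a"
  proof -
    have "(\<Sum>x<B. g x) = sum g ({..<h} \<union> insert h {h<..<B})"
      by (rule arg_cong[where f = "sum g"]) (use assms in auto)
    also have "\<dots> = sum g {..<h} + sum g (insert h {h<..<B})"
      by (rule sum.union_disjoint) auto
    finally show ?thesis by simp
  qed
  have "clows B (Suc n) h u = clows B n h h * adj h u + (\<Sum>x\<in>{h<..<B}. adj u x * clows B n h x)" for n
  proof -
    have "clows B (Suc n) h u = (\<Sum>h'<B. \<Sum>x<B. if h' = h then clows B n h' x * adj x u else 0)"
      using assms by (auto simp: clow_step_def intro!: sum.cong)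
    also have "\<dots> = (\<Sum>h'<B. if h' = h then \<Sum>x<B. clows B n h' x * adj x u else 0)"
      by (intro sum.cong) auto
    also have "\<dots> = (\<Sum>x<B. clows B n h x * adj x u)" using assms by simp
    also have "\<dots> = clows B n h h * adj h u + (\<Sum>x\<in>{h<..<B}. adj u x * clows B n h x)"
      unfolding split by (simp add: clows_below adj_sym[of u] mult.commute)
    finally show ?thesis .
  qed
  then show "fps_nth (clowsX B h u) n =
     fps_nth (clowsX B h h * adjX h u + (\<Sum>x\<in>{h<..<B}. adjX u x * clowsX B h x)) n"
    using assms by (cases n) (simp_all add: clowsX_def fps_sum_nth del: clows.simps(2))
qed

text \<open>The pair \<open>(h, h)\<close> is a starting point or is entered by closing a clow with
  a smaller head \<open>g\<close>; the heads in between are skipped.\<close>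

lemma clowsX_diag:
  assumes "h < B"
  shows "clowsX B h h = 1 + (\<Sum>g<h. \<Sum>x\<in>{g<..<B}. clowsX B g x * adjX x g)"
proof (rule fps_ext)
  fix n
  have "clows B (Suc n) h h = (\<Sum>g<h. \<Sum>x\<in>{g<..<B}. clows B n g x * adj x g)" for n
  proof -
    have "clows B (Suc n) h h = (\<Sum>g<B. if g < h then \<Sum>x<B. clows B n g x * adj x g else 0)"
      by (auto simp: clow_step_def intro!: sum.cong sum.neutral)
    also have "\<dots> = (\<Sum>g<h. \<Sum>x<B. clows B n g x * adj x g)"
      using assms by (intro sum.mono_neutral_cong_right) auto
    also have "\<dots> = (\<Sum>g<h. \<Sum>x\<in>{g<..<B}. clows B n g x * adj x g)"
    proof (rule sum.cong[OF refl], rule sum.mono_neutral_right)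
      fix g
      show "\<forall>x\<in>{..<B} - {g<..<B}. clows B n g x * adj x g = 0"
      proof
        fix x assume "x \<in> {..<B} - {g<..<B}"
        then have "x < g \<or> x = g" by auto
        then show "clows B n g x * adj x g = 0" by (auto simp: clows_below adj_def)
      qed
    qed auto
    finally show ?thesis .
  qed
  then show "fps_nth (clowsX B h h) n = fps_nth (1 + (\<Sum>g<h. \<Sum>x\<in>{g<..<B}. clowsX B g x * adjX x g)) n"
    by (cases n) (simp_all add: clowsX_def fps_sum_nth del: clows.simps(2))
qed

text \<open>The vertex \<open>h\<close> heads no closed walk or exactly one, whose inner vertices
  all lie above \<open>h\<close>. The latter case is the additional summand \<open>g = h\<close> in
  \<open>clowsX_diag\<close>.\<close>

lemma clowsX_Suc:
  assumes "Suc h < B"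
  shows "clowsX B (Suc h) (Suc h) = clowsX B h h * (1 + returns {h<..<B} h)"
proof -
  let ?T = "{h<..<B}"
  have "clowsX B h x = (\<Sum>y\<in>?T. walksX ?T x y * (clowsX B h h * adjX h y))" if "x \<in> ?T" for x
    using that by (intro linear_system_unique[where Y = "clowsX B h"]) (auto intro: clowsX_above)
  then have "(\<Sum>x\<in>?T. clowsX B h x * adjX x h) =
      (\<Sum>x\<in>?T. (\<Sum>y\<in>?T. walksX ?T x y * (clowsX B h h * adjX h y)) * adjX x h)"
    by simp
  also have "\<dots> = clowsX B h h * returns ?T h"
    unfolding returns_def
    by (simp add: sum_distrib_left sum_distrib_right adjX_sym[of _ h] mult_ac)
  finally show ?thesis
    using clowsX_diag[OF assms] clowsX_diag[of h B] assms by (simp add: algebra_simps)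
qed

text \<open>By \<open>clowsX_Suc\<close> and \<open>matchX_eq\<close> the product of
  \<open>clowsX B h h\<close> and \<open>matchX {h..<B}\<close> does not depend on \<open>h\<close>.
  For \<open>h = 0\<close> it is the sum over all matchings, and for \<open>h = z\<close>, above all
  edges, its second factor is 1.\<close>

theorem clows_matchings:
  assumes z: "z < B" and edges: "\<And>e. e \<subseteq> {..<B} \<Longrightarrow> \<not> e \<subseteq> {..<z} \<Longrightarrow> \<alpha> e = 0"
  shows "clows B n z z = (\<Sum>M\<in>{M \<in> matchings {..<B}. 2 * card M = n}. (\<Prod>e\<in>M. \<alpha> e)\<^sup>2)"
proof -
  have "clowsX B h h * matchX {h..<B} = matchX {..<B}" if "h < B" for h
    using that
  proof (induction h)
    case 0
    then show ?case using clowsX_diag[of 0 B] by (simp add: atLeast0LessThan)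
  next
    case (Suc h)
    have "{h..<B} - {h} = {Suc h..<B}" "{h<..<B} = {Suc h..<B}" by auto
    then have "matchX {h..<B} = (1 + returns {h<..<B} h) * matchX {Suc h..<B}"
      using matchX_eq[of "{h..<B}" h] Suc.prems by simp
    then show ?case using Suc clowsX_Suc[OF Suc.prems] by (simp add: mult.assoc)
  qed
  from this[OF z] have "clowsX B z z * matchX {z..<B} = matchX {..<B}" .
  moreover have "matchX {z..<B} = 1"
  proof -
    have 0: "{} \<in> matchings {z..<B}" by (auto simp: matchings_def)
    have "(\<Prod>e\<in>M. (fps_const (\<alpha> e) * fps_X)\<^sup>2) = 0" if M: "M \<in> matchings {z..<B} - {{}}" for M
    proof -
      obtain e where e: "e \<in> M" using M by auto
      then have "e \<subseteq> {z..<B}" "card e = 2" using M by (auto simp: matchings_def)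
      then have "e \<subseteq> {..<B}" "\<not> e \<subseteq> {..<z}" by (auto simp: card_2_iff)
      then have "\<alpha> e = 0" by (rule edges)
      then show ?thesis using e M finite_matching[of "{z..<B}" M]
        by (intro prod_zero bexI[of _ e]) auto
    qed
    then have "matchX {z..<B} = (\<Sum>M\<in>{{}}. \<Prod>e\<in>M. (fps_const (\<alpha> e) * fps_X)\<^sup>2)"
      unfolding matchX_def using 0 finite_matchings[of "{z..<B}"]
      by (intro sum.mono_neutral_right) auto
    then show ?thesis by simp
  qed
  ultimately have eq: "clowsX B z z = matchX {..<B}" by simp
  have wt: "(\<Prod>e\<in>M. (fps_const (\<alpha> e) * fps_X)\<^sup>2) = fps_const ((\<Prod>e\<in>M. \<alpha> e)\<^sup>2) * fps_X ^ (2 * card M)" for M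
  proof (induction M rule: infinite_finite_induct)
    case (insert e M)
    have "(\<Prod>e\<in>insert e M. (fps_const (\<alpha> e) * fps_X)\<^sup>2) =
        fps_const ((\<alpha> e)\<^sup>2) * fps_X\<^sup>2 * (fps_const ((\<Prod>e\<in>M. \<alpha> e)\<^sup>2) * fps_X ^ (2 * card M))"
      using insert by (simp add: power_mult_distrib fps_const_power)
    also have "\<dots> = (fps_const ((\<alpha> e)\<^sup>2) * fps_const ((\<Prod>e\<in>M. \<alpha> e)\<^sup>2)) * (fps_X\<^sup>2 * fps_X ^ (2 * card M))"
      by (simp only: mult_ac)
    also have "\<dots> = fps_const ((\<Prod>e\<in>insert e M. \<alpha> e)\<^sup>2) * fps_X ^ (2 * card (insert e M))"
      using insert by (simp add: power_mult_distrib flip: power_add)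
    finally show ?case .
  qed simp_all
  have "clows B n z z = fps_nth (matchX {..<B}) n" using eq by (simp add: clowsX_def fps_eq_iff)
  also have "\<dots> = (\<Sum>M\<in>matchings {..<B}. if 2 * card M = n then (\<Prod>e\<in>M. \<alpha> e)\<^sup>2 else 0)"
    unfolding matchX_def wt by (auto simp: fps_sum_nth fps_X_power_nth intro!: sum.cong)
  also have "\<dots> = (\<Sum>M\<in>{M \<in> matchings {..<B}. 2 * card M = n}. (\<Prod>e\<in>M. \<alpha> e)\<^sup>2)"
    using finite_matchings[of "{..<B}"] by (simp add: sum.If_cases Int_def)
  finally show ?thesis .
qed

end

section \<open>Walk parities as coefficients\<close>

lemma lookup_mult_single:
  fixes f :: "('m :: cancel_comm_monoid_add) \<Rightarrow>\<^sub>0 ('r :: comm_semiring_1)"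
  shows "Poly_Mapping.lookup (f * Poly_Mapping.single m q) (k + m) = Poly_Mapping.lookup f k * q"
    and "(\<And>l. k' \<noteq> l + m) \<Longrightarrow> Poly_Mapping.lookup (f * Poly_Mapping.single m q) k' = 0"
proof -
  have *: "Poly_Mapping.lookup (f * Poly_Mapping.single m q) k = Sum_any (\<lambda>l. Poly_Mapping.lookup f l * q when k = l + m)" for k
  proof -
    have "Sum_any (\<lambda>q'. Poly_Mapping.lookup (Poly_Mapping.single m q) q' when k = l + q') = (q when k = l + m)" for l
    proof -
      have *: "(\<lambda>q'. Poly_Mapping.lookup (Poly_Mapping.single m q) q' when k = l + q') = (\<lambda>q'. (q when k = l + m) when q' = m)"
        by (auto simp: lookup_single when_def fun_eq_iff)
      show ?thesis unfolding * by (rule Sum_any_when_equal)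
    qed
    then show ?thesis by (simp add: lookup_mult mult_when)
  qed
  show "Poly_Mapping.lookup (f * Poly_Mapping.single m q) (k + m) = Poly_Mapping.lookup f k * q"
  proof -
    have **: "(\<lambda>l. Poly_Mapping.lookup f l * q when k + m = l + m) = (\<lambda>l. Poly_Mapping.lookup f l * q when l = k)"
      by (auto simp: when_def fun_eq_iff)
    show ?thesis unfolding * ** by (rule Sum_any_when_equal)
  qed
  show "Poly_Mapping.lookup (f * Poly_Mapping.single m q) k' = 0" if "\<And>l. k' \<noteq> l + m"
    unfolding * using that by simp
qed

lemma lookup_sum_fun: "Poly_Mapping.lookup (sum f A) k = (\<Sum>x\<in>A. Poly_Mapping.lookup (f x) k)"
  by (induction A rule: infinite_finite_induct) (simp_all add: lookup_add)

lemma odd_card_bit: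
  assumes "finite A"
  shows "odd (card {x \<in> A. P x}) \<longleftrightarrow> (\<Sum>x\<in>A. of_bool (P x) :: bit) = 1"
proof -
  have "(\<Sum>x\<in>A. of_bool (P x) :: bit) = of_nat (card {x \<in> A. P x})"
    using assms by (simp add: of_bool_def sum.If_cases Int_def)
  moreover have "(of_nat n :: bit) = 1 \<longleftrightarrow> odd n" for n
    by (induction n) (auto simp: bit_not_one_iff[symmetric] simp del: bit_not_one_iff)
  ultimately show ?thesis by simp
qed

text \<open>Polynomials in the type indeterminates over F_2[x]. The ring F_2[x] replaces a large
  field of characteristic two: it has no zero divisors, and reading off a coefficient yields a
  single bit.\<close>

type_synonym wring = "(nat \<Rightarrow>\<^sub>0 nat) \<Rightarrow>\<^sub>0 bit poly"

lemma two_wring: "(1 :: wring) + 1 = 0"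
proof -
  have "(1 :: bit poly) + 1 = [:1 + 1:]" by (simp only: one_pCons add_pCons add_0_left)
  also have "\<dots> = 0" by simp
  finally have "(1 :: bit poly) + 1 = 0" .
  then show ?thesis by (metis single_add single_one single_zero)
qed

definition expo :: "nat list \<Rightarrow> nat \<Rightarrow>\<^sub>0 nat" where
  "expo cs = (\<Sum>t<length cs. Poly_Mapping.single t (cs ! t))"

lemma lookup_expo: "Poly_Mapping.lookup (expo cs) t = (if t < length cs then cs ! t else 0)"
  by (simp add: expo_def lookup_sum_fun lookup_single when_def)

lemma expo_upd:
  assumes "t < length cs"
  shows "expo (cs[t := m + n]) = expo (cs[t := m]) + Poly_Mapping.single t n"
  by (rule poly_mapping_eqI) (use assms in \<open>auto simp: lookup_expo lookup_add lookup_single when_def nth_list_update\<close>)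

text \<open>
  Edges \<open>e\<close> carry a type \<open>\<tau> e\<close> and random bits \<open>r e\<close>, the coefficients of a random polynomial. The
  weight of an edge is that polynomial times the indeterminate of its type.
\<close>

definition rpoly :: "nat \<Rightarrow> (nat set \<Rightarrow> nat \<Rightarrow> bool) \<Rightarrow> nat set \<Rightarrow> bit poly" where
  "rpoly L r e = (\<Sum>j<L. monom (of_bool (r e j)) j)"

lemma coeff_rpoly: "coeff (rpoly L r e) j = of_bool (j < L \<and> r e j)"
  by (simp add: rpoly_def coeff_sum)

definition weight :: "nat \<Rightarrow> (nat set \<Rightarrow> nat option) \<Rightarrow> (nat set \<Rightarrow> nat \<Rightarrow> bool) \<Rightarrow> nat set \<Rightarrow> wring" where
  "weight L \<tau> r e =
     (case \<tau> e of None \<Rightarrow> 0 | Some t \<Rightarrow> Poly_Mapping.single (Poly_Mapping.single t 1) (rpoly L r e))"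

text \<open>Traversing an edge includes the choice of one nonzero term \<open>x ^ j\<close> of its
  polynomial. The exponent of x is accumulated in \<open>w\<close>, those of the type indeterminates
  in \<open>cs\<close>.\<close>

definition traverse ::
    "nat \<Rightarrow> (nat set \<Rightarrow> nat option) \<Rightarrow> (nat set \<Rightarrow> nat \<Rightarrow> bool) \<Rightarrow> nat \<Rightarrow> nat \<Rightarrow>
     nat \<Rightarrow> nat list \<Rightarrow> nat \<Rightarrow> nat list \<Rightarrow> bool" where
  "traverse L \<tau> r u v w cs w' cs' \<longleftrightarrow>
     (\<exists>t j. u \<noteq> v \<and> \<tau> {u, v} = Some t \<and> j < L \<and> r {u, v} j \<and> w' = w + j \<and> cs' = cs[t := Suc (cs ! t)])"

text \<open>On coefficients, multiplication by the weight of an edge is a 0-1 matrix over F_2,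
  namely that of the relation \<open>traverse\<close>.\<close>

lemma coeff_traverse:
  assumes \<tau>: "\<And>e t. \<tau> e = Some t \<Longrightarrow> t < K" and w': "w' < B" and cs': "cs' \<in> tuples K B"
  shows "coeff (Poly_Mapping.lookup (P * adj (weight L \<tau> r) u v) (expo cs')) w' =
    (\<Sum>w<B. \<Sum>cs\<in>tuples K B. coeff (Poly_Mapping.lookup P (expo cs)) w * of_bool (traverse L \<tau> r u v w cs w' cs'))"
proof (cases "u \<noteq> v \<and> \<tau> {u, v} \<noteq> None")
  case False
  then have "adj (weight L \<tau> r) u v = 0" by (auto simp: adj_def[OF two_wring] weight_def)
  moreover have "\<not> traverse L \<tau> r u v w cs w' cs'" for w cs
    using False by (auto simp: traverse_def)
  ultimately show ?thesis by simp
next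
  case True
  then obtain t where t: "\<tau> {u, v} = Some t" and uv: "u \<noteq> v" by auto
  have len: "length cs' = K" and tK: "t < K" using cs' \<tau>[OF t] by (auto simp: tuples_def)
  let ?q = "rpoly L r {u, v}"
  have adj: "adj (weight L \<tau> r) u v = Poly_Mapping.single (Poly_Mapping.single t 1) ?q"
    using uv t by (simp add: adj_def[OF two_wring] weight_def)
  have tr: "traverse L \<tau> r u v w cs w' cs' \<longleftrightarrow>
      cs' = cs[t := Suc (cs ! t)] \<and> w \<le> w' \<and> coeff ?q (w' - w) = 1" for w cs
    using uv t by (auto simp: traverse_def coeff_rpoly of_bool_def split: if_splits)
  show ?thesis
  proof (cases "cs' ! t")
    \<comment> \<open>The target exponent of \<open>t\<close> is 0: no monomial becomes this one by
      multiplication with the indeterminate of \<open>t\<close>, and no \<open>cs\<close> has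
      \<open>cs'\<close> as successor.\<close>
    case 0
    have "expo cs' \<noteq> l + Poly_Mapping.single t 1" for l
    proof
      assume "expo cs' = l + Poly_Mapping.single t 1"
      then have "Poly_Mapping.lookup (expo cs') t = Poly_Mapping.lookup l t + 1" by (simp add: lookup_add)
      then show False using 0 tK len by (simp add: lookup_expo)
    qed
    then have "Poly_Mapping.lookup (P * adj (weight L \<tau> r) u v) (expo cs') = 0"
      unfolding adj by (rule lookup_mult_single(2))
    moreover have "\<not> traverse L \<tau> r u v w cs w' cs'" if "cs \<in> tuples K B" for w cs
      unfolding tr using 0 tK that by (auto simp: tuples_def)
    ultimately show ?thesis by simp
  next
    case (Suc m)
    \<comment> \<open>The only exponent vector from which a step of type \<open>t\<close> leads to
      \<open>cs'\<close>.\<close>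
    define c0 where "c0 = cs'[t := m]"
    have c0: "c0 \<in> tuples K B"
    proof -
      have "m < B" using Suc cs' tK nth_mem[of t cs'] len by (auto simp: tuples_def)
      then show ?thesis using cs' set_update_subset_insert[of cs' t m] by (auto simp: tuples_def c0_def)
    qed
    have "expo cs' = expo (cs'[t := m + 1])" using Suc by (metis Suc_eq_plus1 list_update_id)
    then have ex: "expo cs' = expo c0 + Poly_Mapping.single t 1"
      using expo_upd[of t cs' m 1] tK len by (simp add: c0_def)
    have c0_iff: "cs' = cs[t := Suc (cs ! t)] \<longleftrightarrow> cs = c0" if "cs \<in> tuples K B" for cs
    proof
      assume *: "cs' = cs[t := Suc (cs ! t)]"
      have "length cs = K" using that by (simp add: tuples_def)
      then have "cs ! t = m" using * Suc tK by simp
      then show "cs = c0" unfolding c0_def * by (metis list_update_id list_update_overwrite)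
    next
      assume "cs = c0"
      then show "cs' = cs[t := Suc (cs ! t)]" using tK len Suc unfolding c0_def
        by (metis list_update_id list_update_overwrite nth_list_update_eq)
    qed
    have "coeff (Poly_Mapping.lookup (P * adj (weight L \<tau> r) u v) (expo cs')) w' = coeff (Poly_Mapping.lookup P (expo c0) * ?q) w'"
      unfolding adj ex lookup_mult_single(1) ..
    also have "\<dots> = (\<Sum>w\<le>w'. coeff (Poly_Mapping.lookup P (expo c0)) w * coeff ?q (w' - w))"
      by (rule coeff_mult)
    also have "\<dots> = (\<Sum>w<B. coeff (Poly_Mapping.lookup P (expo c0)) w * of_bool (w \<le> w' \<and> coeff ?q (w' - w) = 1))"
    proof (rule sum.mono_neutral_cong_left)
      show "{..w'} \<subseteq> {..<B}" using w' by auto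
      show "\<forall>i\<in>{..<B} - {..w'}. coeff (Poly_Mapping.lookup P (expo c0)) i * of_bool (i \<le> w' \<and> coeff ?q (w' - i) = 1) = 0"
        by auto
      fix w assume "w \<in> {..w'}"
      then show "coeff (Poly_Mapping.lookup P (expo c0)) w * coeff ?q (w' - w) =
          coeff (Poly_Mapping.lookup P (expo c0)) w * of_bool (w \<le> w' \<and> coeff ?q (w' - w) = 1)"
        by (auto simp: coeff_rpoly)
    qed simp
    also have "\<dots> = (\<Sum>w<B. \<Sum>cs\<in>tuples K B. if cs = c0 then coeff (Poly_Mapping.lookup P (expo cs)) w * of_bool (w \<le> w' \<and> coeff ?q (w' - w) = 1) else 0)"
      using c0 by simp
    also have "\<dots> = (\<Sum>w<B. \<Sum>cs\<in>tuples K B. coeff (Poly_Mapping.lookup P (expo cs)) w * of_bool (traverse L \<tau> r u v w cs w' cs'))"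
      unfolding tr using c0_iff by (intro sum.cong refl) auto
    finally show ?thesis .
  qed
qed

text \<open>A tuple has the form \<open>h # u # w # cs\<close>: the head, the current vertex, the
  exponent of x, and the exponents of the type indeterminates.\<close>

definition walk_init :: "nat \<Rightarrow> nat list \<Rightarrow> bool" where
  "walk_init K ts \<longleftrightarrow> ts ! 0 = ts ! 1 \<and> ts ! 2 = 0 \<and> (\<forall>t<K. ts ! (3 + t) = 0)"

definition walk_step ::
    "nat \<Rightarrow> (nat set \<Rightarrow> nat option) \<Rightarrow> (nat set \<Rightarrow> nat \<Rightarrow> bool) \<Rightarrow> nat list \<Rightarrow> nat list \<Rightarrow> bool" where
  "walk_step L \<tau> r s s' \<longleftrightarrow> (\<exists>v. traverse L \<tau> r (s ! 1) v (s ! 2) (drop 3 s) (s' ! 2) (drop 3 s') \<and>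
     (s' ! 0 = s ! 0 \<and> s' ! 1 = v \<and> s ! 0 < v \<or> v = s ! 0 \<and> s' ! 1 = s' ! 0 \<and> s ! 0 < s' ! 0))"

lemma tuples_3:
  "tuples (3 + K) B = (\<lambda>(h, u, w, cs). h # u # w # cs) ` ({..<B} \<times> {..<B} \<times> {..<B} \<times> tuples K B)"
  by (simp add: numeral_3_eq_3 tuples_Suc image_image) (force simp: image_iff)

lemma sum_tuples_3:
  "(\<Sum>s\<in>tuples (3 + K) B. g s) =
     (\<Sum>h<B. \<Sum>u<B. \<Sum>w<B. \<Sum>cs\<in>tuples K B. g (h # u # w # cs))"
proof -
  have "(\<Sum>s\<in>tuples (3 + K) B. g s) =
      (\<Sum>(h, u, w, cs)\<in>{..<B} \<times> {..<B} \<times> {..<B} \<times> tuples K B. g (h # u # w # cs))"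
    unfolding tuples_3 by (subst sum.reindex) (auto simp: inj_on_def intro!: sum.cong)
  then show ?thesis by (simp add: sum.cartesian_product)
qed

text \<open>Both sides satisfy the same recursion over F_2: \<open>walk_step\<close> describes how
  the factor \<open>clow_step\<close> acts on coefficients, and the parity of a cardinality is a sum
  of bits.\<close>

theorem odd_walks_clows:
  assumes \<tau>: "\<And>e t. \<tau> e = Some t \<Longrightarrow> t < K"
    and "h < B" "u < B" "w < B" "cs \<in> tuples K B"
  shows "odd_walks (3 + K) B (walk_init K) (walk_step L \<tau> r) n (h # u # w # cs) \<longleftrightarrow>
    coeff (Poly_Mapping.lookup (clows (weight L \<tau> r) B n h u) (expo cs)) w = 1"
  using assms(2-)
proof (induction n arbitrary: h u w cs)
  case 0
  have len: "length cs = K" using "0.prems"(4) by (simp add: tuples_def)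
  have "expo cs = 0 \<longleftrightarrow> (\<forall>t<K. cs ! t = 0)"
    using len by (auto simp: poly_mapping_eq_iff fun_eq_iff lookup_expo)
  moreover have "walk_init K (h # u # w # cs) \<longleftrightarrow> h = u \<and> w = 0 \<and> (\<forall>t<K. cs ! t = 0)"
    by (simp add: walk_init_def numeral_3_eq_3 numeral_2_eq_2)
  ultimately have init: "walk_init K (h # u # w # cs) \<longleftrightarrow> h = u \<and> w = 0 \<and> expo cs = 0" by simp
  show ?case
    unfolding odd_walks.simps init clows.simps[OF two_wring]
    by (cases "h = u"; cases "expo cs = 0"; cases "w = 0") (simp_all add: lookup_one when_def)
next
  case (Suc n h' u' w' cs')
  let ?c = "\<lambda>h u. clows (weight L \<tau> r) B n h u"
  let ?S = "\<lambda>h u w cs. walk_step L \<tau> r (h # u # w # cs) (h' # u' # w' # cs')"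
  have step: "?S h u w cs \<longleftrightarrow> (h' = h \<and> h < u' \<and> traverse L \<tau> r u u' w cs w' cs') \<or>
      (u' = h' \<and> h < h' \<and> traverse L \<tau> r u h w cs w' cs')" for h u w cs
    by (auto simp: walk_step_def numeral_3_eq_3 numeral_2_eq_2)
  have one: "coeff (Poly_Mapping.lookup (?c h u * clow_step (weight L \<tau> r) h u h' u') (expo cs')) w' =
      (\<Sum>w<B. \<Sum>cs\<in>tuples K B. coeff (Poly_Mapping.lookup (?c h u) (expo cs)) w * of_bool (?S h u w cs))" for h u
  proof -
    \<comment> \<open>The two kinds of steps exclude each other, since one keeps the head and the
      other raises it. Hence the disjunction in \<open>walk_step\<close> matches the sum in
      \<open>clow_step\<close>.\<close>
    consider (a) "h' = h \<and> h < u'" | (b) "u' = h' \<and> h < h'" | (c) "\<not> (h' = h \<and> h < u')" "\<not> (u' = h' \<and> h < h')"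
      by blast
    then show ?thesis
    proof cases
      case a
      then have "clow_step (weight L \<tau> r) h u h' u' = adj (weight L \<tau> r) u u'"
        by (auto simp: clow_step_def[OF two_wring])
      moreover have "?S h u w cs \<longleftrightarrow> traverse L \<tau> r u u' w cs w' cs'" for w cs
        unfolding step using a by auto
      ultimately show ?thesis using coeff_traverse[OF \<tau> Suc.prems(3,4)] by simp
    next
      case b
      then have "clow_step (weight L \<tau> r) h u h' u' = adj (weight L \<tau> r) u h"
        by (auto simp: clow_step_def[OF two_wring])
      moreover have "?S h u w cs \<longleftrightarrow> traverse L \<tau> r u h w cs w' cs'" for w cs
        unfolding step using b by auto
      ultimately show ?thesis using coeff_traverse[OF \<tau> Suc.prems(3,4)] by simp
    next
      case c
      then have "clow_step (weight L \<tau> r) h u h' u' = 0"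
        by (auto simp: clow_step_def[OF two_wring])
      moreover have "\<not> ?S h u w cs" for w cs
        unfolding step using c by blast
      ultimately show ?thesis by simp
    qed
  qed
  have "odd_walks (3 + K) B (walk_init K) (walk_step L \<tau> r) (Suc n) (h' # u' # w' # cs') \<longleftrightarrow>
      (\<Sum>s\<in>tuples (3 + K) B. of_bool (odd_walks (3 + K) B (walk_init K) (walk_step L \<tau> r) n s \<and>
         walk_step L \<tau> r s (h' # u' # w' # cs')) :: bit) = 1"
    unfolding odd_walks.simps by (rule odd_card_bit) simp
  also have "(\<Sum>s\<in>tuples (3 + K) B. of_bool (odd_walks (3 + K) B (walk_init K) (walk_step L \<tau> r) n s \<and>
         walk_step L \<tau> r s (h' # u' # w' # cs')) :: bit) =
      (\<Sum>h<B. \<Sum>u<B. \<Sum>w<B. \<Sum>cs\<in>tuples K B. coeff (Poly_Mapping.lookup (?c h u) (expo cs)) w * of_bool (?S h u w cs))"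
    unfolding sum_tuples_3
    using Suc.IH by (intro sum.cong refl) (auto simp: of_bool_def split: if_splits)
  also have "\<dots> = coeff (Poly_Mapping.lookup (clows (weight L \<tau> r) B (Suc n) h' u') (expo cs')) w'"
    by (simp add: clows.simps[OF two_wring] lookup_sum_fun coeff_sum one)
  finally show ?case .
qed

text \<open>The factors 2 come from the squared weights: each edge counts twice in the length and in
  the exponent of its type.\<close>

definition typed_matchings ::
    "(nat set \<Rightarrow> nat option) \<Rightarrow> nat \<Rightarrow> nat \<Rightarrow> nat list \<Rightarrow> nat set set set" where
  "typed_matchings \<tau> B n cs = {M \<in> matchings {..<B}. 2 * card M = n \<and> (\<forall>e\<in>M. \<tau> e \<noteq> None) \<and>
     (\<forall>t<length cs. cs ! t = 2 * card {e \<in> M. \<tau> e = Some t})}"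

lemma prod_weight:
  assumes "finite M" "\<And>e. e \<in> M \<Longrightarrow> \<tau> e \<noteq> None"
  shows "(\<Prod>e\<in>M. weight L \<tau> r e) =
    Poly_Mapping.single (\<Sum>e\<in>M. Poly_Mapping.single (the (\<tau> e)) 1) (\<Prod>e\<in>M. rpoly L r e)"
  using assms
proof (induction M rule: finite_induct)
  case (insert e M)
  then obtain t where "\<tau> e = Some t" by auto
  then show ?case using insert by (simp add: weight_def mult_single)
qed simp

text \<open>The monomial \<open>expo cs\<close> selects the matchings with the prescribed numbers of
  edges of each type. As \<open>z\<close> lies above all typed edges, the clow sequences that end
  there account for all matchings.\<close>

theorem odd_walks_matchings:
  assumes \<tau>: "\<And>e t. \<tau> e = Some t \<Longrightarrow> t < K" "\<And>e t. \<tau> e = Some t \<Longrightarrow> e \<subseteq> {..<z}"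
    and z: "z < B" "w < B" "cs \<in> tuples K B"
  shows "odd_walks (3 + K) B (walk_init K) (walk_step L \<tau> r) n (z # z # w # cs) \<longleftrightarrow>
    coeff (\<Sum>M\<in>typed_matchings \<tau> B n cs. (\<Prod>e\<in>M. rpoly L r e)\<^sup>2) w = 1"
proof -
  have len: "length cs = K" using z(3) by (simp add: tuples_def)
  have "weight L \<tau> r e = 0" if "\<not> e \<subseteq> {..<z}" for e
    using \<tau>(2)[of e] that by (cases "\<tau> e") (auto simp: weight_def)
  then have "clows (weight L \<tau> r) B n z z =
      (\<Sum>M\<in>{M \<in> matchings {..<B}. 2 * card M = n}. (\<Prod>e\<in>M. weight L \<tau> r e)\<^sup>2)"
    by (intro clows_matchings[OF two_wring z(1)])
  then have "Poly_Mapping.lookup (clows (weight L \<tau> r) B n z z) (expo cs) =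
      (\<Sum>M\<in>{M \<in> matchings {..<B}. 2 * card M = n}. Poly_Mapping.lookup ((\<Prod>e\<in>M. weight L \<tau> r e)\<^sup>2) (expo cs))"
    by (simp add: lookup_sum_fun)
  also have "\<dots> = (\<Sum>M\<in>typed_matchings \<tau> B n cs. (\<Prod>e\<in>M. rpoly L r e)\<^sup>2)"
  proof (rule sum.mono_neutral_cong_right)
    show "finite {M \<in> matchings {..<B}. 2 * card M = n}" using finite_matchings[of "{..<B}"] by simp
    show "typed_matchings \<tau> B n cs \<subseteq> {M \<in> matchings {..<B}. 2 * card M = n}"
      by (auto simp: typed_matchings_def)
    have main: "Poly_Mapping.lookup ((\<Prod>e\<in>M. weight L \<tau> r e)\<^sup>2) (expo cs) =
        (if (\<forall>t<K. cs ! t = 2 * card {e \<in> M. \<tau> e = Some t}) then (\<Prod>e\<in>M. rpoly L r e)\<^sup>2 else 0)"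
      if M: "finite M" "\<forall>e\<in>M. \<tau> e \<noteq> None" for M
    proof -
      let ?m = "\<Sum>e\<in>M. Poly_Mapping.single (the (\<tau> e)) (1 :: nat)"
      have lm: "Poly_Mapping.lookup ?m t = card {e \<in> M. \<tau> e = Some t}" for t
      proof -
        have "Poly_Mapping.lookup ?m t = (\<Sum>e\<in>M. if \<tau> e = Some t then 1 else 0)"
          unfolding lookup_sum_fun using M by (intro sum.cong) (auto simp: lookup_single when_def)
        then show ?thesis using M(1) by (simp add: sum.If_cases Int_def)
      qed
      have "(?m + ?m = expo cs) \<longleftrightarrow> (\<forall>t. Poly_Mapping.lookup ?m t + Poly_Mapping.lookup ?m t = Poly_Mapping.lookup (expo cs) t)"
        by (simp add: poly_mapping_eq_iff fun_eq_iff lookup_add)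
      also have "\<dots> \<longleftrightarrow> (\<forall>t<K. cs ! t = 2 * card {e \<in> M. \<tau> e = Some t})"
      proof -
        have "{e \<in> M. \<tau> e = Some t} = {}" if "\<not> t < K" for t using \<tau>(1) that by blast
        then have "card {e \<in> M. \<tau> e = Some t} = 0" if "\<not> t < K" for t using that by (metis card.empty)
        then show ?thesis unfolding lm lookup_expo len by (auto simp: mult_2)
      qed
      finally have eq: "?m + ?m = expo cs \<longleftrightarrow> (\<forall>t<K. cs ! t = 2 * card {e \<in> M. \<tau> e = Some t})" .
      have "(\<Prod>e\<in>M. weight L \<tau> r e)\<^sup>2 = Poly_Mapping.single (?m + ?m) ((\<Prod>e\<in>M. rpoly L r e)\<^sup>2)"
        using prod_weight[OF M(1), of \<tau> L r] M(2) by (simp add: power2_eq_square mult_single)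
      then show ?thesis using eq by (simp add: lookup_single when_def)
    qed
    show "\<forall>M\<in>{M \<in> matchings {..<B}. 2 * card M = n} - typed_matchings \<tau> B n cs.
        Poly_Mapping.lookup ((\<Prod>e\<in>M. weight L \<tau> r e)\<^sup>2) (expo cs) = 0"
    proof
      fix M assume M: "M \<in> {M \<in> matchings {..<B}. 2 * card M = n} - typed_matchings \<tau> B n cs"
      then have fin: "finite M" using finite_matching[of "{..<B}"] by blast
      show "Poly_Mapping.lookup ((\<Prod>e\<in>M. weight L \<tau> r e)\<^sup>2) (expo cs) = 0"
      proof (cases "\<forall>e\<in>M. \<tau> e \<noteq> None")
        case True
        then show ?thesis using M main[OF fin True] by (auto simp: typed_matchings_def len)
      next
        case False
        then obtain e where "e \<in> M" "weight L \<tau> r e = 0" by (auto simp: weight_def)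
        then have "(\<Prod>e\<in>M. weight L \<tau> r e) = 0" using fin by (intro prod_zero) auto
        then show ?thesis by simp
      qed
    qed
    fix M assume M: "M \<in> typed_matchings \<tau> B n cs"
    then have "finite M" "\<forall>e\<in>M. \<tau> e \<noteq> None" using finite_matching[of "{..<B}"]
      by (auto simp: typed_matchings_def)
    from main[OF this] M show "Poly_Mapping.lookup ((\<Prod>e\<in>M. weight L \<tau> r e)\<^sup>2) (expo cs) = (\<Prod>e\<in>M. rpoly L r e)\<^sup>2"
      by (auto simp: typed_matchings_def len)
  qed
  finally show ?thesis using odd_walks_clows[OF \<tau>(1) z(1,1,2,3)] by simp
qed

section \<open>Derived definable relations\<close>

text \<open>The renaming is absorbed into the assignment of arguments to tapes, over which
  definability quantifies.\<close>

lemma definable_rename: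
  assumes "definable F"
  shows "definable (\<lambda>w e. F w (\<lambda>i. e (\<sigma> i)))"
  unfolding definable_def
proof (intro allI impI)
  fix vs N assume "alloc vs N"
  then have "alloc (\<lambda>i. vs (\<sigma> i)) N" by (simp add: alloc_def)
  from definableE[OF assms this] obtain c f where c: "wf_com c" "pbound f"
    "computes c (\<lambda>i. vs (\<sigma> i)) N f F" .
  have "layout w e vs N s \<Longrightarrow> layout w (\<lambda>i. e (\<sigma> i)) (\<lambda>i. vs (\<sigma> i)) N s" for w e s
    by (simp add: layout_def)
  then have "computes c vs N f (\<lambda>w e. F w (\<lambda>i. e (\<sigma> i)))"
    using c(3) unfolding computes_def by blast
  with c show "\<exists>c f. wf_com c \<and> pbound f \<and> computes c vs N f (\<lambda>w e. F w (\<lambda>i. e (\<sigma> i)))" by blast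
qed

text \<open>Even numbers of walks would go unnoticed, so this is reachability only along
  deterministic steps, where no two walks of the same length have the same end.\<close>

definition reach :: "nat \<Rightarrow> world \<Rightarrow> (nat list \<Rightarrow> bool) \<Rightarrow> (nat list \<Rightarrow> nat list \<Rightarrow> bool) \<Rightarrow> nat list \<Rightarrow> bool" where
  "reach d w I R t \<longleftrightarrow> (\<exists>n<univ w. odd_walks d (univ w) I R n t)"

lemma definable_reach:
  assumes I: "definable (\<lambda>w e. I w (map e [0..<d]) (\<lambda>i. e (i + d)))"
    and S: "definable (\<lambda>w e. S w (map e [0..<d]) (map e [d..<2 * d]) (\<lambda>i. e (i + 2 * d)))"
    and js: "length js = d"
  shows "definable (\<lambda>w e. reach d w (\<lambda>t. I w t e) (\<lambda>s t. S w s t e) (map e js))"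
proof -
  \<comment> \<open>Quantifying over the number of steps inserts a new argument in front of the
    parameters, which move up by one.\<close>
  have I': "definable (\<lambda>w e. I w (map e [0..<d]) (\<lambda>i. e (Suc i + d)))"
  proof (rule definable_cong[OF _ definable_rename[OF I, of "\<lambda>i. if i < d then i else Suc i"]])
    fix w :: world and e :: "nat \<Rightarrow> nat"
    have m: "map (\<lambda>i. e (if i < d then i else Suc i)) [0..<d] = map e [0..<d]" by simp
    show "I w (map (\<lambda>i. e (if i < d then i else Suc i)) [0..<d])
        (\<lambda>i. e (if i + d < d then i + d else Suc (i + d))) \<longleftrightarrow> I w (map e [0..<d]) (\<lambda>i. e (Suc i + d))"
      unfolding m by simp
  qed
  have S': "definable (\<lambda>w e. S w (map e [0..<d]) (map e [d..<2 * d]) (\<lambda>i. e (Suc i + 2 * d)))"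
  proof (rule definable_cong[OF _ definable_rename[OF S, of "\<lambda>i. if i < 2 * d then i else Suc i"]])
    fix w :: world and e :: "nat \<Rightarrow> nat"
    have m: "map (\<lambda>i. e (if i < 2 * d then i else Suc i)) [0..<d] = map e [0..<d]"
      "map (\<lambda>i. e (if i < 2 * d then i else Suc i)) [d..<2 * d] = map e [d..<2 * d]" by simp_all
    show "S w (map (\<lambda>i. e (if i < 2 * d then i else Suc i)) [0..<d])
        (map (\<lambda>i. e (if i < 2 * d then i else Suc i)) [d..<2 * d])
        (\<lambda>i. e (if i + 2 * d < 2 * d then i + 2 * d else Suc (i + 2 * d))) \<longleftrightarrow>
        S w (map e [0..<d]) (map e [d..<2 * d]) (\<lambda>i. e (Suc i + 2 * d))"
      unfolding m by simp
  qed
  have "definable (\<lambda>w e. odd_walks d (univ w) (\<lambda>t. I w t (\<lambda>i. e (Suc i))) (\<lambda>s t. S w s t (\<lambda>i. e (Suc i)))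
      (e 0) (map e (map Suc js)))"
    by (rule definable_odd_walks[where I = "\<lambda>w t e. I w t (\<lambda>i. e (Suc i))" and S = "\<lambda>w s t e. S w s t (\<lambda>i. e (Suc i))"])
      (use I' S' js in simp_all)
  then show ?thesis unfolding reach_def
    by (intro definable_Ex) (simp add: comp_def)
qed

definition reach1 :: "world \<Rightarrow> (nat \<Rightarrow> bool) \<Rightarrow> (nat \<Rightarrow> nat \<Rightarrow> bool) \<Rightarrow> nat \<Rightarrow> bool" where
  "reach1 w I R a = reach 1 w (\<lambda>t. I (t ! 0)) (\<lambda>s t. R (s ! 0) (t ! 0)) [a]"

definition reach2 :: "world \<Rightarrow> (nat \<Rightarrow> nat \<Rightarrow> bool) \<Rightarrow> (nat \<Rightarrow> nat \<Rightarrow> nat \<Rightarrow> nat \<Rightarrow> bool) \<Rightarrow> nat \<Rightarrow> nat \<Rightarrow> bool" where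
  "reach2 w I R a b = reach 2 w (\<lambda>t. I (t ! 0) (t ! 1)) (\<lambda>s t. R (s ! 0) (s ! 1) (t ! 0) (t ! 1)) [a, b]"

definition reach3 :: "world \<Rightarrow> (nat \<Rightarrow> nat \<Rightarrow> nat \<Rightarrow> bool) \<Rightarrow>
    (nat \<Rightarrow> nat \<Rightarrow> nat \<Rightarrow> nat \<Rightarrow> nat \<Rightarrow> nat \<Rightarrow> bool) \<Rightarrow> nat \<Rightarrow> nat \<Rightarrow> nat \<Rightarrow> bool" where
  "reach3 w I R a b c = reach 3 w (\<lambda>t. I (t ! 0) (t ! 1) (t ! 2))
     (\<lambda>s t. R (s ! 0) (s ! 1) (s ! 2) (t ! 0) (t ! 1) (t ! 2)) [a, b, c]"

lemma definable_reach1: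
  assumes "definable (\<lambda>w e. I w (e 0) (\<lambda>i. e (Suc i)))"
    and "definable (\<lambda>w e. S w (e 0) (e (Suc 0)) (\<lambda>i. e (Suc (Suc i))))"
  shows "definable (\<lambda>w e. reach1 w (\<lambda>a. I w a e) (\<lambda>a b. S w a b e) (e i))"
  using definable_reach[where d = 1 and js = "[i]" and I = "\<lambda>w t e. I w (t ! 0) e"
      and S = "\<lambda>w s t e. S w (s ! 0) (t ! 0) e"] assms
  by (simp add: reach1_def)

lemma definable_reach2:
  assumes "definable (\<lambda>w e. I w (e 0) (e (Suc 0)) (\<lambda>i. e (Suc (Suc i))))"
    and "definable (\<lambda>w e. S w (e 0) (e (Suc 0)) (e (Suc (Suc 0))) (e (Suc (Suc (Suc 0))))
      (\<lambda>i. e (Suc (Suc (Suc (Suc i))))))"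
  shows "definable (\<lambda>w e. reach2 w (\<lambda>a b. I w a b e) (\<lambda>a b a' b'. S w a b a' b' e) (e i) (e j))"
  using definable_reach[where d = 2 and js = "[i, j]" and I = "\<lambda>w t e. I w (t ! 0) (t ! 1) e"
      and S = "\<lambda>w s t e. S w (s ! 0) (s ! 1) (t ! 0) (t ! 1) e"] assms
  by (simp add: reach2_def numeral_eq_Suc)

lemma definable_reach3:
  assumes "definable (\<lambda>w e. I w (e 0) (e (Suc 0)) (e (Suc (Suc 0))) (\<lambda>i. e (Suc (Suc (Suc i)))))"
    and "definable (\<lambda>w e. S w (e 0) (e (Suc 0)) (e (Suc (Suc 0))) (e (Suc (Suc (Suc 0))))
      (e (Suc (Suc (Suc (Suc 0))))) (e (Suc (Suc (Suc (Suc (Suc 0))))))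
      (\<lambda>i. e (Suc (Suc (Suc (Suc (Suc (Suc i))))))))"
  shows "definable (\<lambda>w e. reach3 w (\<lambda>a b c. I w a b c e) (\<lambda>a b c a' b' c'. S w a b c a' b' c' e) (e i) (e j) (e k))"
  using definable_reach[where d = 3 and js = "[i, j, k]" and I = "\<lambda>w t e. I w (t ! 0) (t ! 1) (t ! 2) e"
      and S = "\<lambda>w s t e. S w (s ! 0) (s ! 1) (s ! 2) (t ! 0) (t ! 1) (t ! 2) e"] assms
  by (simp add: reach3_def numeral_eq_Suc)

lemmas definable_intros = definable_not definable_conj definable_disj definable_imp definable_iff
  definable_le definable_less definable_eq definable_Ex definable_All definable_rnd definable_const
  definable_reach1 definable_reach2 definable_reach3

lemma definable_zero: "definable (\<lambda>w e. e i = 0)"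
proof -
  have "definable (\<lambda>w e. \<not> (\<exists>k<univ w. k < e i))" by (intro definable_intros)
  then show ?thesis by (rule definable_cong[rotated]) (metis gr0I less_trans not_less0)
qed

lemma definable_Suc: "definable (\<lambda>w e. e j = Suc (e i))"
proof -
  have "definable (\<lambda>w e. e i < e j \<and> \<not> (\<exists>k<univ w. e i < k \<and> k < e j))" by (intro definable_intros)
  then show ?thesis
  proof (rule definable_cong[rotated])
    fix w :: world and e :: "nat \<Rightarrow> nat" assume "\<And>i. e i < univ w"
    then have B: "Suc (e i) < e j \<Longrightarrow> Suc (e i) < univ w" by (meson less_trans)
    show "(e i < e j \<and> \<not> (\<exists>k<univ w. e i < k \<and> k < e j)) = (e j = Suc (e i))"
    proof
      assume *: "e i < e j \<and> \<not> (\<exists>k<univ w. e i < k \<and> k < e j)"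
      then have "\<not> Suc (e i) < e j" using B lessI by blast
      with * show "e j = Suc (e i)" by linarith
    qed auto
  qed
qed

lemmas definable_intros' = definable_intros definable_zero definable_Suc

lemma definable_one: "definable (\<lambda>w e. e i = Suc 0)"
proof -
  have "definable (\<lambda>w e. \<exists>k<univ w. k = 0 \<and> e i = Suc k)" by (intro definable_intros')
  then show ?thesis
    by (rule definable_cong[rotated]) (auto intro: le_less_trans[OF le0])
qed

lemma definable_Suc_Suc: "definable (\<lambda>w e. e j = Suc (Suc (e i)))"
proof -
  have "definable (\<lambda>w e. \<exists>k<univ w. k = Suc (e i) \<and> e j = Suc k)" by (intro definable_intros')
  then show ?thesis
  proof (rule definable_cong[rotated])
    fix w :: world and e :: "nat \<Rightarrow> nat" assume "\<And>i. e i < univ w"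
    from this[of j] show "(\<exists>k<univ w. k = Suc (e i) \<and> e j = Suc k) = (e j = Suc (Suc (e i)))" by auto
  qed
qed

definition isT :: "world \<Rightarrow> nat \<Rightarrow> bool" where "isT w p \<longleftrightarrow> fst w ! p = 2"

definition isPad :: "world \<Rightarrow> nat \<Rightarrow> bool" where "isPad w p \<longleftrightarrow> fst w ! p = 3"

lemma definable_isT: "definable (\<lambda>w e. isT w (e i))"
  unfolding isT_def by (rule definable_sym)

lemma definable_isPad: "definable (\<lambda>w e. isPad w (e i))"
  unfolding isPad_def by (rule definable_sym)

text \<open>In \<open>enc_nat\<close> each bit is announced by \<open>True\<close>; \<open>p\<close>
  is the position of the announcement.\<close>

definition bit_at :: "world \<Rightarrow> nat \<Rightarrow> bool" where
  "bit_at w p \<longleftrightarrow> (\<exists>q<univ w. q = Suc p \<and> isT w q)"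

lemmas definable_rules1 = definable_intros' definable_one definable_Suc_Suc definable_isT definable_isPad

lemma definable_bit_at: "definable (\<lambda>w e. bit_at w (e i))"
  unfolding bit_at_def by (intro definable_rules1)

section \<open>Formulas for colored gourd placement\<close>

text \<open>
  In the following relations the arguments \<open>p\<close>, \<open>q\<close> are positions in the input at which the encoding
  of a number, a coordinate, a cell or a gourd starts.
\<close>

definition skip_nat :: "world \<Rightarrow> nat \<Rightarrow> nat \<Rightarrow> bool" where
  "skip_nat w p q \<longleftrightarrow> (\<exists>a<univ w. reach1 w (\<lambda>b. b = p) (\<lambda>b c. isT w b \<and> c = Suc (Suc b)) a \<and>
     \<not> isT w a \<and> q = Suc a)"

lemma definable_skip_nat: "definable (\<lambda>w e. skip_nat w (e i) (e j))"
  unfolding skip_nat_def by (intro definable_rules1)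

text \<open>
  The numbers at \<open>p\<close> and \<open>q\<close> are read in parallel; \<open>c\<close> is the carry, which is \<open>k\<close> at the start.
\<close>

definition add_init :: "bool \<Rightarrow> nat \<Rightarrow> nat \<Rightarrow> nat \<Rightarrow> nat \<Rightarrow> nat \<Rightarrow> bool" where
  "add_init k p q a b c \<longleftrightarrow> a = p \<and> b = q \<and> (if k then c = Suc 0 else c = 0)"

definition add_step :: "world \<Rightarrow> nat \<Rightarrow> nat \<Rightarrow> nat \<Rightarrow> nat \<Rightarrow> nat \<Rightarrow> nat \<Rightarrow> bool" where
  "add_step w a b c a' b' c' \<longleftrightarrow> isT w a \<and> isT w b \<and> a' = Suc (Suc a) \<and> b' = Suc (Suc b) \<and>
     (bit_at w b \<longleftrightarrow> \<not> (bit_at w a \<longleftrightarrow> c = Suc 0)) \<and>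
     (c = Suc 0 \<and> bit_at w a \<and> c' = Suc 0 \<or> \<not> (c = Suc 0 \<and> bit_at w a) \<and> c' = 0)"

text \<open>If the first number ends while the carry is 1, then exactly one digit 1 must be left of
  the second number.\<close>

definition add_end :: "world \<Rightarrow> nat \<Rightarrow> nat \<Rightarrow> nat \<Rightarrow> bool" where
  "add_end w a b c \<longleftrightarrow> \<not> isT w a \<and> (\<not> isT w b \<and> c = 0 \<or>
     c = Suc 0 \<and> isT w b \<and> bit_at w b \<and> (\<exists>b'<univ w. b' = Suc (Suc b) \<and> \<not> isT w b'))"

text \<open>With \<open>k = False\<close> this is equality of two encoded numbers, otherwise the
  successor relation. Comparing colors and stepping between coordinates require no other
  arithmetic.\<close>

definition add_nat :: "bool \<Rightarrow> world \<Rightarrow> nat \<Rightarrow> nat \<Rightarrow> bool" where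
  "add_nat k w p q \<longleftrightarrow> (\<exists>a<univ w. \<exists>b<univ w. \<exists>c<univ w.
     reach3 w (\<lambda>a b c. add_init k p q a b c) (\<lambda>a b c a' b' c'. add_step w a b c a' b' c') a b c \<and>
     add_end w a b c)"

lemma definable_add_init: "definable (\<lambda>w e. add_init k (e i) (e j) (e l) (e m) (e n))"
  unfolding add_init_def by (cases k) (simp_all, (intro definable_rules1)+)

lemma definable_add_step: "definable (\<lambda>w e. add_step w (e i) (e j) (e l) (e m) (e n) (e o'))"
  unfolding add_step_def by (intro definable_rules1 definable_bit_at)

lemma definable_add_end: "definable (\<lambda>w e. add_end w (e i) (e j) (e l))"
  unfolding add_end_def by (intro definable_rules1 definable_bit_at)

lemma definable_add_nat: "definable (\<lambda>w e. add_nat k w (e i) (e j))"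
  unfolding add_nat_def by (intro definable_rules1 definable_add_init definable_add_step definable_add_end)

section \<open>Coordinates, cells and adjacency as definable relations\<close>

definition eq_int :: "world \<Rightarrow> nat \<Rightarrow> nat \<Rightarrow> bool" where
  "eq_int w p q \<longleftrightarrow> (\<exists>p'<univ w. \<exists>q'<univ w. p' = Suc p \<and> q' = Suc q \<and>
     (isT w p \<longleftrightarrow> isT w q) \<and> add_nat False w p' q')"

text \<open>From a negative number the absolute value decreases by one. The result is negative or 0,
  and 0 has the sign of the nonnegative numbers, so it is recognized by its digits, which are
  empty.\<close>

definition suc_int :: "world \<Rightarrow> nat \<Rightarrow> nat \<Rightarrow> bool" where
  "suc_int w p q \<longleftrightarrow> (\<exists>p'<univ w. \<exists>q'<univ w. p' = Suc p \<and> q' = Suc q \<and>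
     (\<not> isT w p \<and> \<not> isT w q \<and> add_nat True w p' q' \<or>
      isT w p \<and> add_nat True w q' p' \<and> (isT w q \<or> \<not> isT w q')))"

lemmas definable_rules2 = definable_rules1 definable_skip_nat definable_add_nat

lemma definable_eq_int: "definable (\<lambda>w e. eq_int w (e i) (e j))"
  unfolding eq_int_def by (intro definable_rules2)

lemma definable_suc_int: "definable (\<lambda>w e. suc_int w (e i) (e j))"
  unfolding suc_int_def by (intro definable_rules2)

text \<open>Two positions precede the absolute value of the first coordinate: the announcement of
  the list element and the sign.\<close>

definition y_pos :: "world \<Rightarrow> nat \<Rightarrow> nat \<Rightarrow> bool" where
  "y_pos w p q \<longleftrightarrow> (\<exists>a<univ w. a = Suc (Suc p) \<and> skip_nat w a q)"

definition color_pos :: "world \<Rightarrow> nat \<Rightarrow> nat \<Rightarrow> bool" where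
  "color_pos w p q \<longleftrightarrow> (\<exists>s<univ w. y_pos w p s \<and> (\<exists>a<univ w. a = Suc s \<and> skip_nat w a q))"

definition next_cell :: "world \<Rightarrow> nat \<Rightarrow> nat \<Rightarrow> bool" where
  "next_cell w p q \<longleftrightarrow> isT w p \<and> (\<exists>c<univ w. color_pos w p c \<and> skip_nat w c q)"

definition cell_reached :: "world \<Rightarrow> nat \<Rightarrow> bool" where
  "cell_reached w p \<longleftrightarrow> reach1 w (\<lambda>a. a = 0) (\<lambda>a b. next_cell w a b) p"

definition is_cell :: "world \<Rightarrow> nat \<Rightarrow> bool" where
  "is_cell w p \<longleftrightarrow> cell_reached w p \<and> isT w p"

lemma definable_y_pos: "definable (\<lambda>w e. y_pos w (e i) (e j))"
  unfolding y_pos_def by (intro definable_rules2)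

lemma definable_color_pos: "definable (\<lambda>w e. color_pos w (e i) (e j))"
  unfolding color_pos_def by (intro definable_rules2 definable_y_pos)

lemma definable_next_cell: "definable (\<lambda>w e. next_cell w (e i) (e j))"
  unfolding next_cell_def by (intro definable_rules2 definable_color_pos)

lemma definable_cell_reached: "definable (\<lambda>w e. cell_reached w (e i))"
  unfolding cell_reached_def by (intro definable_rules2 definable_next_cell)

lemma definable_is_cell: "definable (\<lambda>w e. is_cell w (e i))"
  unfolding is_cell_def by (intro definable_rules2 definable_cell_reached)

definition adj_cells :: "world \<Rightarrow> nat \<Rightarrow> nat \<Rightarrow> bool" where
  "adj_cells w u v \<longleftrightarrow> (\<exists>x<univ w. x = Suc u \<and> (\<exists>x'<univ w. x' = Suc v \<and>
     (\<exists>y<univ w. y_pos w u y \<and> (\<exists>y'<univ w. y_pos w v y' \<and>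
     (suc_int w x x' \<and> eq_int w y y' \<or> eq_int w x x' \<and> suc_int w y y' \<or>
      suc_int w x' x \<and> suc_int w y y' \<or> suc_int w x' x \<and> eq_int w y y' \<or>
      eq_int w x x' \<and> suc_int w y' y \<or> suc_int w x x' \<and> suc_int w y' y)))))"

lemma definable_adj_cells: "definable (\<lambda>w e. adj_cells w (e i) (e j))"
  unfolding adj_cells_def by (intro definable_rules2 definable_y_pos definable_eq_int definable_suc_int)

section \<open>The gourd list and the comparison of colors\<close>

definition next_gourd :: "world \<Rightarrow> nat \<Rightarrow> nat \<Rightarrow> bool" where
  "next_gourd w p q \<longleftrightarrow> isT w p \<and> (\<exists>a<univ w. a = Suc p \<and> (\<exists>b<univ w. skip_nat w a b \<and> skip_nat w b q))"

definition first_gourd :: "world \<Rightarrow> nat \<Rightarrow> bool" where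
  "first_gourd w p \<longleftrightarrow> (\<exists>z<univ w. cell_reached w z \<and> \<not> isT w z \<and> p = Suc z)"

definition is_gourd :: "world \<Rightarrow> nat \<Rightarrow> bool" where
  "is_gourd w p \<longleftrightarrow> reach1 w (\<lambda>a. first_gourd w a) (\<lambda>a b. next_gourd w a b) p \<and> isT w p"

lemma definable_next_gourd: "definable (\<lambda>w e. next_gourd w (e i) (e j))"
  unfolding next_gourd_def by (intro definable_rules2)

lemma definable_first_gourd: "definable (\<lambda>w e. first_gourd w (e i))"
  unfolding first_gourd_def by (intro definable_rules2 definable_cell_reached)

lemma definable_is_gourd: "definable (\<lambda>w e. is_gourd w (e i))"
  unfolding is_gourd_def by (intro definable_rules2 definable_first_gourd definable_next_gourd)

definition fits :: "world \<Rightarrow> nat \<Rightarrow> nat \<Rightarrow> nat \<Rightarrow> bool" where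
  "fits w c c' g \<longleftrightarrow> is_gourd w g \<and> (\<exists>a<univ w. a = Suc g \<and> (\<exists>b<univ w. skip_nat w a b \<and>
     (add_nat False w c a \<and> add_nat False w c' b \<or> add_nat False w c b \<and> add_nat False w c' a)))"

definition fits_cells :: "world \<Rightarrow> nat \<Rightarrow> nat \<Rightarrow> nat \<Rightarrow> bool" where
  "fits_cells w u v g \<longleftrightarrow> (\<exists>c<univ w. color_pos w u c \<and> (\<exists>c'<univ w. color_pos w v c' \<and> fits w c c' g))"

definition fits_gourd :: "world \<Rightarrow> nat \<Rightarrow> nat \<Rightarrow> bool" where
  "fits_gourd w p g \<longleftrightarrow> (\<exists>c<univ w. c = Suc p \<and> (\<exists>c'<univ w. skip_nat w c c' \<and> fits w c c' g))"

lemma definable_fits: "definable (\<lambda>w e. fits w (e i) (e j) (e k))"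
  unfolding fits_def by (intro definable_rules2 definable_is_gourd)

lemma definable_fits_cells: "definable (\<lambda>w e. fits_cells w (e i) (e j) (e k))"
  unfolding fits_cells_def by (intro definable_rules2 definable_fits definable_color_pos)

lemma definable_fits_gourd: "definable (\<lambda>w e. fits_gourd w (e i) (e j))"
  unfolding fits_gourd_def by (intro definable_rules2 definable_fits)

text \<open>
  The positions \<open>g 0, \<dots>, g (K - 1)\<close> are meant to represent all types of gourds; the type of a gourd
  and of a pair of cells is the index of the first representative of the same colors.
\<close>

definition edge_type :: "world \<Rightarrow> (nat \<Rightarrow> nat) \<Rightarrow> nat \<Rightarrow> nat \<Rightarrow> nat \<Rightarrow> bool" where
  "edge_type w g t u v \<longleftrightarrow> is_cell w u \<and> is_cell w v \<and> adj_cells w u v \<and> fits_cells w u v (g t) \<and>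
     (\<forall>t'<t. \<not> fits_cells w u v (g t'))"

definition gourd_type :: "world \<Rightarrow> (nat \<Rightarrow> nat) \<Rightarrow> nat \<Rightarrow> nat \<Rightarrow> bool" where
  "gourd_type w g t p \<longleftrightarrow> fits_gourd w p (g t) \<and> (\<forall>t'<t. \<not> fits_gourd w p (g t'))"

lemma definable_edge_type: "definable (\<lambda>w e. edge_type w (\<lambda>t. e (g t)) t (e i) (e j))"
  unfolding edge_type_def
  by (intro definable_rules2 definable_is_cell definable_adj_cells definable_fits_cells definable_Ball_fin)

lemma definable_gourd_type: "definable (\<lambda>w e. gourd_type w (\<lambda>t. e (g t)) t (e i))"
  unfolding gourd_type_def by (intro definable_rules2 definable_fits_gourd definable_Ball_fin)

definition covering :: "nat \<Rightarrow> world \<Rightarrow> (nat \<Rightarrow> nat) \<Rightarrow> bool" where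
  "covering K w g \<longleftrightarrow> (\<forall>p<univ w. is_gourd w p \<longrightarrow> (\<exists>t<K. fits_gourd w p (g t)))"

lemma definable_covering: "definable (\<lambda>w e. covering K w (\<lambda>t. e (g t)))"
  unfolding covering_def by (intro definable_rules2 definable_is_gourd definable_fits_gourd definable_Bex_fin)

definition count_init :: "world \<Rightarrow> nat \<Rightarrow> nat \<Rightarrow> bool" where
  "count_init w p c \<longleftrightarrow> first_gourd w p \<and> c = 0"

definition count_step :: "world \<Rightarrow> (nat \<Rightarrow> nat) \<Rightarrow> nat \<Rightarrow> nat \<Rightarrow> nat \<Rightarrow> nat \<Rightarrow> nat \<Rightarrow> bool" where
  "count_step w g t p c p' c' \<longleftrightarrow> next_gourd w p p' \<and>
     (gourd_type w g t p \<and> c' = Suc (Suc c) \<or> \<not> gourd_type w g t p \<and> c' = c)"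

text \<open>Every gourd contributes 2, because both directions of a matched edge are traversed.\<close>

definition gourd_count :: "world \<Rightarrow> (nat \<Rightarrow> nat) \<Rightarrow> nat \<Rightarrow> nat \<Rightarrow> bool" where
  "gourd_count w g t c \<longleftrightarrow> (\<exists>p<univ w.
     reach2 w (\<lambda>p c. count_init w p c) (\<lambda>p c p' c'. count_step w g t p c p' c') p c \<and> \<not> isT w p)"

lemma definable_count_init: "definable (\<lambda>w e. count_init w (e i) (e j))"
  unfolding count_init_def by (intro definable_rules2 definable_first_gourd)

lemma definable_count_step: "definable (\<lambda>w e. count_step w (\<lambda>t. e (g t)) t (e i) (e j) (e k) (e l))"
  unfolding count_step_def by (intro definable_rules2 definable_next_gourd definable_gourd_type)

lemma definable_gourd_count: "definable (\<lambda>w e. gourd_count w (\<lambda>t. e (g t)) t (e i))"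
  unfolding gourd_count_def by (intro definable_rules2 definable_count_init definable_count_step)

text \<open>There is exactly one walk of \<open>n\<close> successor steps from \<open>a\<close>.
  Since the length of a walk may be an argument, addition of positions becomes definable.\<close>

lemma odd_walks_add:
  assumes "a < B" "b < B"
  shows "odd_walks 1 B (\<lambda>t. t = [a]) (\<lambda>s t. t ! 0 = Suc (s ! 0)) n [b] \<longleftrightarrow> b = a + n"
  using assms(2)
proof (induction n arbitrary: b)
  case (Suc n)
  have "{s \<in> tuples 1 B. odd_walks 1 B (\<lambda>t. t = [a]) (\<lambda>s t. t ! 0 = Suc (s ! 0)) n s \<and> b = Suc (s ! 0)} =
      (if b = a + Suc n then {[a + n]} else {})"
    using Suc by (auto simp: tuples_1)
  then show ?case by simp
qed auto

lemma definable_add: "definable (\<lambda>w e. e k = e i + e j)"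
proof -
  have "definable (\<lambda>w e. odd_walks 1 (univ w) (\<lambda>t. t = [e i]) (\<lambda>s t. t ! 0 = Suc (s ! 0)) (e j) (map e [k]))"
    by (rule definable_odd_walks[where I = "\<lambda>w t e. t = [e i]" and S = "\<lambda>w s t e. t ! 0 = Suc (s ! 0)"])
      (simp_all add: definable_eq definable_Suc)
  then show ?thesis by (rule definable_cong[rotated]) (simp add: odd_walks_add del: One_nat_def)
qed

text \<open>Ordering the ends makes both directions of an edge use the same bits, as the
  cancellation of reversed walks requires.\<close>

definition random_bit :: "world \<Rightarrow> nat \<Rightarrow> nat \<Rightarrow> nat \<Rightarrow> bool" where
  "random_bit w u v j \<longleftrightarrow> u < v \<and> rnd w [u, v, j] \<or> v < u \<and> rnd w [v, u, j]"

text \<open>This is \<open>walk_step\<close> as a formula on positions. The condition that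
  \<open>j\<close> is not padding says that \<open>j\<close> is less than the length of the input,
  the number of random coefficients of an edge.\<close>

definition gourd_step :: "nat \<Rightarrow> world \<Rightarrow> (nat \<Rightarrow> nat) \<Rightarrow> nat list \<Rightarrow> nat list \<Rightarrow> bool" where
  "gourd_step K w g s s' \<longleftrightarrow> (\<exists>v<univ w. \<exists>j<univ w.
     (\<exists>t<K. edge_type w g t (s ! 1) v \<and>
        (\<forall>i<K. if i = t then s' ! (3 + i) = Suc (s ! (3 + i)) else s' ! (3 + i) = s ! (3 + i))) \<and>
     random_bit w (s ! 1) v j \<and> \<not> isPad w j \<and> s' ! 2 = s ! 2 + j \<and>
     (s' ! 0 = s ! 0 \<and> s' ! 1 = v \<and> s ! 0 < v \<or> v = s ! 0 \<and> s' ! 1 = s' ! 0 \<and> s ! 0 < s' ! 0))"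

text \<open>A padded \<open>z\<close> lies above all cells, as \<open>odd_walks_matchings\<close>
  demands. Searching for \<open>g\<close>, \<open>n\<close> and \<open>x\<close> instead of
  computing them cannot cause a false acceptance, because any odd number of walks yields a
  matching.\<close>

definition gourd_formula :: "nat \<Rightarrow> world \<Rightarrow> bool" where
  "gourd_formula K w \<longleftrightarrow> (\<exists>g\<in>tuples K (univ w). covering K w (\<lambda>t. g ! t) \<and>
     (\<exists>cs\<in>tuples K (univ w). (\<forall>t<K. gourd_count w (\<lambda>t. g ! t) t (cs ! t)) \<and>
       (\<exists>n<univ w. \<exists>x<univ w. \<exists>z<univ w. isPad w z \<and>
         odd_walks (3 + K) (univ w) (walk_init K) (gourd_step K w (\<lambda>t. g ! t)) n (z # z # x # cs))))"

lemma definable_random_bit: "definable (\<lambda>w e. random_bit w (e i) (e j) (e k))"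
  unfolding random_bit_def by (intro definable_rules2)

lemma definable_walk_init: "definable (\<lambda>w e. walk_init K (map e [0..<3 + K]))"
proof -
  have "definable (\<lambda>w e. e 0 = e 1 \<and> e (Suc (Suc 0)) = 0 \<and> (\<forall>t<K. e (3 + t) = 0))"
    by (intro definable_rules2 definable_Ball_fin)
  then show ?thesis by (rule definable_cong[rotated]) (auto simp: walk_init_def simp del: upt_Suc)
qed

lemma definable_gourd_step:
  "definable (\<lambda>w e. gourd_step K w (\<lambda>t. e (g t + 2 * (3 + K))) (map e [0..<3 + K]) (map e [3 + K..<2 * (3 + K)]))"
proof -
  let ?d = "3 + K"
  have if_def: "definable (\<lambda>w e. if i = t then e (a i) = Suc (e (b i)) else e (a i) = e (b i))"
    for i t :: nat and a b
    by (cases "i = t") (simp_all add: definable_eq definable_Suc)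
  have "definable (\<lambda>w e. \<exists>v<univ w. \<exists>j<univ w.
     (\<exists>t<K. edge_type w (\<lambda>t. e (g t + 2 * (3 + K))) t (e 1) v \<and>
        (\<forall>i<K. if i = t then e (?d + (3 + i)) = Suc (e (3 + i)) else e (?d + (3 + i)) = e (3 + i))) \<and>
     random_bit w (e 1) v j \<and> \<not> isPad w j \<and> e (?d + 2) = e (Suc (Suc 0)) + j \<and>
     (e ?d = e 0 \<and> e (?d + 1) = v \<and> e 0 < v \<or> v = e 0 \<and> e (?d + 1) = e ?d \<and> e 0 < e ?d))"
    by (intro definable_rules2 definable_Bex_fin definable_Ball_fin definable_edge_type
      definable_random_bit definable_add if_def)
  then show ?thesis
    by (rule definable_cong[rotated]) (simp add: gourd_step_def del: upt_Suc cong: conj_cong)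
qed

theorem definable_gourd_formula: "definable (\<lambda>w e. gourd_formula K w)"
  unfolding gourd_formula_def
proof (intro definable_Ex_tuple definable_conj)
  show "definable (\<lambda>w e. covering K w (\<lambda>t. map e [0..<K] ! t))"
    by (rule definable_cong[OF _ definable_covering[where K = K and g = "\<lambda>t. t"]])
      (simp add: covering_def cong: conj_cong)
  \<comment> \<open>The relations consult \<open>g\<close> only below \<open>K\<close>, so entries
    of the tuple may be replaced by arguments of the environment.\<close>
  have eq: "gourd_type w g t = gourd_type w g' t" "gourd_count w g t = gourd_count w g' t"
    "edge_type w g t = edge_type w g' t"
    if "\<And>t. t < K \<Longrightarrow> g t = g' t" "t < K" for w t and g g' :: "nat \<Rightarrow> nat"
  proof -
    show "gourd_type w g t = gourd_type w g' t" "edge_type w g t = edge_type w g' t"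
      using that by (auto simp: gourd_type_def edge_type_def fun_eq_iff)
    then show "gourd_count w g t = gourd_count w g' t"
      by (simp add: gourd_count_def count_step_def fun_eq_iff)
  qed
  show "definable (\<lambda>w e. \<forall>t<K. gourd_count w (\<lambda>t. map (\<lambda>i. e (i + K)) [0..<K] ! t) t (map e [0..<K] ! t))"
  proof (rule definable_cong[OF _ definable_Ball_fin])
    show "definable (\<lambda>w e. gourd_count w (\<lambda>t. e (t + K)) t (e t))" for t
      by (rule definable_gourd_count)
    show "(\<forall>t<K. gourd_count w (\<lambda>t. e (t + K)) t (e t)) =
       (\<forall>t<K. gourd_count w (\<lambda>t. map (\<lambda>i. e (i + K)) [0..<K] ! t) t (map e [0..<K] ! t))" for w e
      using eq(2)[of "\<lambda>t. e (t + K)" "\<lambda>t. map (\<lambda>i. e (i + K)) [0..<K] ! t"] by simp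
  qed
  have step: "gourd_step K w (\<lambda>t. e (t + K + 3)) = gourd_step K w (\<lambda>t. map (\<lambda>i. e (i + K + 3)) [0..<K] ! t)"
    for w and e :: "nat \<Rightarrow> nat"
    using eq(3)[of "\<lambda>t. e (t + K + 3)" "\<lambda>t. map (\<lambda>i. e (i + K + 3)) [0..<K] ! t"]
    by (simp add: gourd_step_def fun_eq_iff cong: conj_cong)
  \<comment> \<open>Innermost first, the arguments are \<open>z\<close>, \<open>x\<close>,
    \<open>n\<close>, the entries of \<open>cs\<close> from index 3 on, and those of
    \<open>g\<close> from \<open>K + 3\<close> on.\<close>
  have "definable (\<lambda>w e. odd_walks (3 + K) (univ w) (walk_init K) (gourd_step K w (\<lambda>t. e (t + K + 3))) (e 2)
      (map e ([0, 0, 1] @ [3..<3 + K])))"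
  proof (rule definable_odd_walks[where I = "\<lambda>w t e. walk_init K t" and S = "\<lambda>w s t e. gourd_step K w (\<lambda>t. e (t + K + 3)) s t"])
    show "definable (\<lambda>w e. gourd_step K w (\<lambda>t. e (t + K + 3 + 2 * (3 + K))) (map e [0..<3 + K]) (map e [3 + K..<2 * (3 + K)]))"
      by (rule definable_gourd_step)
  qed (simp_all add: definable_walk_init del: upt_Suc)
  then have main: "definable (\<lambda>w e. isPad w (e 0) \<and> odd_walks (3 + K) (univ w) (walk_init K)
      (gourd_step K w (\<lambda>t. map (\<lambda>i. e (i + K + 3)) [0..<K] ! t)) (e 2) (e 0 # e 0 # e 1 # map (\<lambda>i. e (i + 3)) [0..<K]))"
  proof (intro definable_conj definable_isPad, elim definable_cong[rotated])
    fix w :: world and e :: "nat \<Rightarrow> nat"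
    have "map e [3..<3 + K] = map (\<lambda>i. e (i + 3)) [0..<K]"
      by (rule nth_equalityI) (simp_all add: add.commute)
    then show "odd_walks (3 + K) (univ w) (walk_init K) (gourd_step K w (\<lambda>t. e (t + K + 3))) (e 2)
      (map e ([0, 0, 1] @ [3..<3 + K])) = odd_walks (3 + K) (univ w) (walk_init K)
      (gourd_step K w (\<lambda>t. map (\<lambda>i. e (i + K + 3)) [0..<K] ! t)) (e 2) (e 0 # e 0 # e 1 # map (\<lambda>i. e (i + 3)) [0..<K])"
      by (simp add: step)
  qed
  show "definable (\<lambda>w e. \<exists>n<univ w. \<exists>x<univ w. \<exists>z<univ w. isPad w z \<and>
         odd_walks (3 + K) (univ w) (walk_init K) (gourd_step K w (\<lambda>t. map (\<lambda>i. e (i + K)) [0..<K] ! t)) n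
           (z # z # x # map e [0..<K]))"
    by (intro definable_Ex) (use main in \<open>simp add: numeral_eq_Suc\<close>)
qed

section \<open>Evaluation of the formulas on encoded instances\<close>

definition chain :: "nat \<Rightarrow> nat \<Rightarrow> (nat list \<Rightarrow> nat list \<Rightarrow> bool) \<Rightarrow> (nat \<Rightarrow> nat list) \<Rightarrow> nat \<Rightarrow> bool" where
  "chain d B R c m \<longleftrightarrow> (\<forall>i\<le>m. c i \<in> tuples d B) \<and>
     (\<forall>i<m. \<forall>t\<in>tuples d B. R (c i) t \<longleftrightarrow> t = c (Suc i)) \<and> (\<forall>t\<in>tuples d B. \<not> R (c m) t)"

lemma chain_single: "s \<in> tuples d B \<Longrightarrow> (\<And>t. t \<in> tuples d B \<Longrightarrow> \<not> R s t) \<Longrightarrow> chain d B R (\<lambda>_. s) 0"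
  by (auto simp: chain_def)

lemma chain_Cons:
  assumes "s \<in> tuples d B" "\<And>t. t \<in> tuples d B \<Longrightarrow> R s t \<longleftrightarrow> t = c 0" "chain d B R c m"
  shows "chain d B R (case_nat s c) (Suc m)"
  using assms unfolding chain_def by (auto split: nat.splits simp: less_Suc_eq_0_disj)

text \<open>The only walk of length \<open>n\<close> is the initial piece of the chain, so each set
  whose parity is taken is empty or a singleton.\<close>

lemma odd_walks_chain:
  assumes c: "chain d B R c m" and I: "\<And>t. t \<in> tuples d B \<Longrightarrow> I t \<longleftrightarrow> t = c 0" and t: "t \<in> tuples d B"
  shows "odd_walks d B I R n t \<longleftrightarrow> n \<le> m \<and> t = c n"
  using t
proof (induction n arbitrary: t)
  case 0
  then show ?case using I by simp
next
  case (Suc n)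
  have "{s \<in> tuples d B. odd_walks d B I R n s \<and> R s t} = {s \<in> tuples d B. (n \<le> m \<and> s = c n) \<and> R s t}"
    using Suc.IH by blast
  also have "\<dots> = (if Suc n \<le> m \<and> t = c (Suc n) then {c n} else {})"
    using c Suc.prems unfolding chain_def by (auto simp: Suc_le_eq le_less)
  finally show ?case by simp
qed

lemma reach_chain:
  assumes "chain d (univ w) R c m" "\<And>t. t \<in> tuples d (univ w) \<Longrightarrow> I t \<longleftrightarrow> t = c 0" "m < univ w"
    "t \<in> tuples d (univ w)"
  shows "reach d w I R t \<longleftrightarrow> (\<exists>i\<le>m. t = c i)"
  unfolding reach_def using odd_walks_chain[OF assms(1,2,4)] assms(3) by (auto intro: le_less_trans)

lemma tuples_2: "tuples 2 B = (\<lambda>(a, b). [a, b]) ` ({..<B} \<times> {..<B})"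
  by (force simp: numeral_2_eq_2 tuples_Suc tuples_0 image_iff)

lemma tuples_3': "tuples 3 B = (\<lambda>(a, b, c). [a, b, c]) ` ({..<B} \<times> {..<B} \<times> {..<B})"
  by (force simp: numeral_3_eq_3 tuples_Suc tuples_0 image_iff)

lemma in_tuples_2 [simp]: "[a, b] \<in> tuples 2 B \<longleftrightarrow> a < B \<and> b < B"
  by (auto simp: tuples_def)

lemma in_tuples_3 [simp]: "[a, b, c] \<in> tuples 3 B \<longleftrightarrow> a < B \<and> b < B \<and> c < B"
  by (auto simp: tuples_def)

lemma in_tuples_1 [simp]: "[a] \<in> tuples 1 B \<longleftrightarrow> a < B" "[a] \<in> tuples (Suc 0) B \<longleftrightarrow> a < B"
  by (auto simp: tuples_def)

section \<open>Positions inside an encoded list\<close>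

definition enc_pos :: "('a \<Rightarrow> bool list) \<Rightarrow> 'a list \<Rightarrow> nat \<Rightarrow> nat" where
  "enc_pos f xs i = length (concat (map (\<lambda>z. True # f z) (take i xs)))"

lemma enc_pos_0 [simp]: "enc_pos f xs 0 = 0" by (simp add: enc_pos_def)

lemma enc_pos_Suc: "i < length xs \<Longrightarrow> enc_pos f xs (Suc i) = enc_pos f xs i + Suc (length (f (xs ! i)))"
  by (simp add: enc_pos_def take_Suc_conv_app_nth)

lemma enc_pos_strict: "i < j \<Longrightarrow> j \<le> length xs \<Longrightarrow> enc_pos f xs i < enc_pos f xs j"
proof (induction j)
  case (Suc j)
  then show ?case by (cases "i = j") (auto simp: enc_pos_Suc)
qed simp

lemma enc_pos_inj: "i \<le> length xs \<Longrightarrow> j \<le> length xs \<Longrightarrow> enc_pos f xs i = enc_pos f xs j \<longleftrightarrow> i = j"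
  by (metis enc_pos_strict less_irrefl linorder_neqE_nat)

definition same_ends :: "gourd \<Rightarrow> gourd \<Rightarrow> bool" where
  "same_ends p q \<longleftrightarrow> p = q \<or> (snd p, fst p) = q"

text \<open>One digit of binary addition: if the lowest bits are consistent, the equation for the
  numbers is that for their halves and the new carry.\<close>

lemma half_add_iff:
  fixes a b n n' k :: nat
  assumes "n = 2 * a + of_bool p" "n' = 2 * b + of_bool p'" "k \<le> 1" "p' \<longleftrightarrow> \<not> (p \<longleftrightarrow> k = 1)"
  shows "b = a + (if k = 1 \<and> p then 1 else 0) \<longleftrightarrow> n' = n + k"
proof -
  have "k = 0 \<or> k = 1" using assms(3) by auto
  then show ?thesis using assms by (elim disjE; cases p; cases p'; simp; arith)
qed

text \<open>The parsing relations are functional; this evaluates a quantifier over a position that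
  such a relation determines.\<close>

lemma bex_unique:
  fixes t :: nat
  assumes "\<And>q. q < B \<and> P q \<longleftrightarrow> q = t"
  shows "(\<exists>q<B. P q \<and> Q q) \<longleftrightarrow> Q t"
  using assms by (metis (full_types))

lemma nth_pad: "p < length (pad x) \<Longrightarrow> pad x ! p = (if p < length x then bt (x ! p) else 3)"
  unfolding pad_def by (auto simp: nth_append simp del: replicate.simps replicate_add)

section \<open>Numbers and integers in the world of an input word\<close>

context
  fixes x :: "bool list" and \<rho> :: "nat \<Rightarrow> bool"
begin

abbreviation W :: world where "W \<equiv> world_of x \<rho>"

lemma univ_W: "univ W = length x + length x * length x + 1"
  by (simp add: world_of_def)

lemma length_less_univ: "length x < univ W" by (simp add: univ_W)

lemma isT_W: "p < univ W \<Longrightarrow> isT W p \<longleftrightarrow> p < length x \<and> x ! p"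
  by (auto simp: isT_def world_of_def nth_pad simp del: length_pad)

lemma isPad_W: "p < univ W \<Longrightarrow> isPad W p \<longleftrightarrow> length x \<le> p"
  by (auto simp: isPad_def world_of_def nth_pad simp del: length_pad)

lemma bit_at_W: "bit_at W p \<longleftrightarrow> Suc p < length x \<and> x ! Suc p"
  unfolding bit_at_def using isT_W length_less_univ by (auto simp del: length_pad)

definition reads_at :: "nat \<Rightarrow> bool list \<Rightarrow> bool" where
  "reads_at p s \<longleftrightarrow> p \<le> length x \<and> drop p x = s"

lemma reads_at_less: "reads_at p s \<Longrightarrow> p < univ W"
  using length_less_univ by (auto simp: reads_at_def simp del: length_pad)

lemma reads_at_append: "reads_at p (s @ s') \<Longrightarrow> reads_at (p + length s) s'"
  unfolding reads_at_def
  by (metis (no_types, lifting) add.commute append_eq_conv_conj drop_drop length_append length_drop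
      le_add_diff_inverse nat_add_left_cancel_le le_add1)

lemma reads_at_Cons: "reads_at p (b # s) \<Longrightarrow> reads_at (Suc p) s"
  using reads_at_append[of p "[b]" s] by simp

lemma reads_at_isT: "reads_at p (b # s) \<Longrightarrow> isT W p \<longleftrightarrow> b"
  using isT_W[OF reads_at_less] unfolding reads_at_def
  by (metis drop_all list.distinct(1) not_le nth_via_drop)

lemma reads_at_bit: "reads_at p (b # b' # s) \<Longrightarrow> bit_at W p \<longleftrightarrow> b'"
  using reads_at_Cons[of p b "b' # s"] unfolding bit_at_W reads_at_def
  by (metis drop_all list.distinct(1) not_le nth_via_drop)

text \<open>The number \<open>m\<close> of steps is the number of binary digits; the chain visits
  their announcements and stops at the symbol that ends the encoding.\<close>

lemma skip_nat_chain:
  assumes "reads_at p (enc_nat n @ s)"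
  shows "\<exists>m. chain 1 (univ W) (\<lambda>s t. isT W (s ! 0) \<and> t ! 0 = Suc (Suc (s ! 0))) (\<lambda>i. [p + 2 * i]) m \<and>
     2 * m + 1 = length (enc_nat n) \<and> \<not> isT W (p + 2 * m) \<and> (\<forall>i<m. isT W (p + 2 * i))"
  using assms
proof (induction n arbitrary: p rule: less_induct)
  case (less n)
  show ?case
  proof (cases "n = 0")
    case True
    then have "\<not> isT W p" using less.prems reads_at_isT[of p False] by (simp add: enc_nat_0)
    then show ?thesis using True reads_at_less[OF less.prems]
      by (intro exI[of _ 0]) (auto simp: enc_nat_0 chain_def simp del: length_pad)
  next
    case False
    then have r: "reads_at p (True # odd n # enc_nat (n div 2) @ s)"
      using less.prems by (simp add: enc_nat_pos)
    have T: "isT W p" using reads_at_isT[OF r] by simp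
    have r2: "reads_at (p + 2) (enc_nat (n div 2) @ s)" using reads_at_Cons[OF reads_at_Cons[OF r]] by simp
    obtain m where m: "chain 1 (univ W) (\<lambda>s t. isT W (s ! 0) \<and> t ! 0 = Suc (Suc (s ! 0))) (\<lambda>i. [p + 2 + 2 * i]) m"
      "2 * m + 1 = length (enc_nat (n div 2))" "\<not> isT W (p + 2 + 2 * m)" "\<forall>i<m. isT W (p + 2 + 2 * i)"
      using less.IH[OF _ r2] False by auto
    have "chain 1 (univ W) (\<lambda>s t. isT W (s ! 0) \<and> t ! 0 = Suc (Suc (s ! 0))) (case_nat [p] (\<lambda>i. [p + 2 + 2 * i])) (Suc m)"
      by (rule chain_Cons[OF _ _ m(1)]) (use T reads_at_less[OF r] in \<open>auto simp: tuples_1 simp del: length_pad\<close>)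
    moreover have "case_nat [p] (\<lambda>i. [p + 2 + 2 * i]) = (\<lambda>i. [p + 2 * i])"
      by (auto simp: fun_eq_iff split: nat.splits)
    moreover have "\<forall>i<Suc m. isT W (p + 2 * i)" using T m(4) by (auto simp: less_Suc_eq_0_disj)
    ultimately show ?thesis using m(3) False
      by (intro exI[of _ "Suc m"]) (simp add: enc_nat_pos m(2)[symmetric])
  qed
qed

lemma skip_nat_W:
  assumes "reads_at p (enc_nat n @ s)" "q < univ W"
  shows "skip_nat W p q \<longleftrightarrow> q = p + length (enc_nat n)"
proof -
  obtain m where m: "chain 1 (univ W) (\<lambda>s t. isT W (s ! 0) \<and> t ! 0 = Suc (Suc (s ! 0))) (\<lambda>i. [p + 2 * i]) m"
    "2 * m + 1 = length (enc_nat n)" "\<not> isT W (p + 2 * m)" "\<forall>i<m. isT W (p + 2 * i)"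
    using skip_nat_chain[OF assms(1)] by blast
  have mB: "p + 2 * m < univ W" using m(1) by (auto simp: chain_def simp del: length_pad)
  have "reach1 W (\<lambda>b. b = p) (\<lambda>b c. isT W b \<and> c = Suc (Suc b)) a \<longleftrightarrow> (\<exists>i\<le>m. a = p + 2 * i)" if "a < univ W" for a
    unfolding reach1_def by (subst reach_chain[OF m(1)]) (use mB that in \<open>auto simp: tuples_1 simp del: length_pad\<close>)
  then have "skip_nat W p q \<longleftrightarrow> (\<exists>a<univ W. (\<exists>i\<le>m. a = p + 2 * i) \<and> \<not> isT W a \<and> q = Suc a)"
    unfolding skip_nat_def by (metis (no_types, lifting))
  also have "\<dots> \<longleftrightarrow> q = Suc (p + 2 * m)"
    using m(3,4) mB by (auto simp del: length_pad) (metis le_neq_implies_less)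
  finally show ?thesis unfolding m(2)[symmetric] by simp
qed

lemma skip_nat_iff:
  assumes "reads_at p (enc_nat n @ s)"
  shows "q < univ W \<and> skip_nat W p q \<longleftrightarrow> q = p + length (enc_nat n)"
  using skip_nat_W[OF assms] reads_at_less[OF reads_at_append[OF assms]] by auto

text \<open>Reading both numbers in parallel is deterministic and stops at an inconsistent digit or
  where one of them ends. Only this last configuration can satisfy \<open>add_end\<close>. The bound
  on \<open>p + m\<close> provides the length bound that \<open>reach_chain\<close> asks
  for.\<close>

lemma add_nat_chain:
  assumes "reads_at p (enc_nat n @ s)" "reads_at q (enc_nat n' @ s')" "k \<le> 1"
  shows "\<exists>c m. chain 3 (univ W) (\<lambda>s t. add_step W (s ! 0) (s ! 1) (s ! 2) (t ! 0) (t ! 1) (t ! 2)) c m \<and>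
     c 0 = [p, q, k] \<and> p + m < univ W \<and> (\<forall>i<m. \<not> add_end W (c i ! 0) (c i ! 1) (c i ! 2)) \<and>
     (add_end W (c m ! 0) (c m ! 1) (c m ! 2) \<longleftrightarrow> n' = n + k)"
  using assms
proof (induction n arbitrary: p q n' k rule: less_induct)
  case (less n)
  let ?R = "\<lambda>s t. add_step W (s ! 0) (s ! 1) (s ! 2) (t ! 0) (t ! 1) (t ! 2)"
  have pq: "p < univ W" "q < univ W" using less.prems reads_at_less by blast+
  \<comment> \<open>A carry is stored as a position, so 1 must belong to the universe.\<close>
  have k1: "1 < univ W" if "reads_at p (b # s)" for b s p
  proof -
    have "length x \<noteq> 0" using that by (auto simp: reads_at_def)
    then show ?thesis by (cases "length x") (auto simp: univ_W)
  qed
  have one: "1 < univ W"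
    using less.prems(1) k1 by (cases "n = 0") (auto simp: enc_nat_0 enc_nat_pos)
  have in_t: "[p, q, k] \<in> tuples 3 (univ W)" using pq one less.prems(3) by (simp del: length_pad)
  have stop: ?case if "\<And>t. \<not> ?R [p, q, k] t" "add_end W p q k \<longleftrightarrow> n' = n + k"
    using chain_single[OF in_t, of ?R] that pq by (intro exI[of _ "\<lambda>_. [p, q, k]"] exI[of _ 0]) (auto simp del: length_pad)
  have nT: "isT W p \<longleftrightarrow> n \<noteq> 0" "isT W q \<longleftrightarrow> n' \<noteq> 0"
    using less.prems reads_at_isT by (cases "n = 0"; cases "n' = 0"; force simp: enc_nat_0 enc_nat_pos)+
  show ?case
  proof (cases "n = 0 \<or> n' = 0")
    case True
    show ?thesis
    proof (rule stop)
      show "\<not> ?R [p, q, k] t" for t using True nT by (auto simp: add_step_def)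
      show "add_end W p q k \<longleftrightarrow> n' = n + k"
      proof (cases "n = 0 \<and> n' \<noteq> 0")
        case False
        then show ?thesis using True nT less.prems(3) by (auto simp: add_end_def)
      next
        case T: True
        then have r: "reads_at q (True # odd n' # enc_nat (n' div 2) @ s')"
          using less.prems by (simp add: enc_nat_pos)
        have r2: "reads_at (Suc (Suc q)) (enc_nat (n' div 2) @ s')" using reads_at_Cons[OF reads_at_Cons[OF r]] .
        have b: "bit_at W q \<longleftrightarrow> odd n'" using reads_at_bit[OF r] .
        have "isT W (Suc (Suc q)) \<longleftrightarrow> n' div 2 \<noteq> 0"
          using r2 reads_at_isT by (cases "n' div 2 = 0") (force simp: enc_nat_0 enc_nat_pos)+
        then have "add_end W p q k \<longleftrightarrow> k = 1 \<and> odd n' \<and> n' div 2 = 0"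
          using nT T b reads_at_less[OF r2] by (auto simp: add_end_def simp del: length_pad)
        also have "\<dots> \<longleftrightarrow> n' = k" proof -
          have "k = 0 \<or> k = 1" using less.prems(3) by auto
          then show ?thesis using T by (elim disjE; simp; presburger)
        qed
        finally show ?thesis using T by simp
      qed
    qed
  next
    case False
    then have r: "reads_at p (True # odd n # enc_nat (n div 2) @ s)"
      "reads_at q (True # odd n' # enc_nat (n' div 2) @ s')"
      using less.prems by (simp_all add: enc_nat_pos)
    have b: "bit_at W p \<longleftrightarrow> odd n" "bit_at W q \<longleftrightarrow> odd n'" using reads_at_bit[OF r(1)] reads_at_bit[OF r(2)] .
    have r2: "reads_at (Suc (Suc p)) (enc_nat (n div 2) @ s)" "reads_at (Suc (Suc q)) (enc_nat (n' div 2) @ s')"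
      using reads_at_Cons[OF reads_at_Cons[OF r(1)]] reads_at_Cons[OF reads_at_Cons[OF r(2)]] .
    have not_end: "\<not> add_end W p q k" using False nT by (simp add: add_end_def)
    show ?thesis
    proof (cases "odd n' \<longleftrightarrow> \<not> (odd n \<longleftrightarrow> k = 1)")
      \<comment> \<open>Inconsistent lowest bits: there is no further step, and the two sides of the
        equation differ in parity.\<close>
      case bad: False
      show ?thesis
      proof (rule stop)
        show "\<not> ?R [p, q, k] t" for t using bad b by (auto simp: add_step_def)
        show "add_end W p q k \<longleftrightarrow> n' = n + k" proof -
          have "k = 0 \<or> k = 1" using less.prems(3) by auto
          then show ?thesis using not_end bad by (elim disjE) auto
        qed
      qed
    next
      case good: True
      define k' :: nat where "k' = (if k = 1 \<and> odd n then 1 else 0)"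
      obtain c m where c: "chain 3 (univ W) ?R c m" "c 0 = [Suc (Suc p), Suc (Suc q), k']"
        "Suc (Suc p) + m < univ W" "\<forall>i<m. \<not> add_end W (c i ! 0) (c i ! 1) (c i ! 2)"
        "add_end W (c m ! 0) (c m ! 1) (c m ! 2) \<longleftrightarrow> n' div 2 = n div 2 + k'"
      proof -
        have "n div 2 < n" "k' \<le> 1" using False by (auto simp: k'_def)
        from less.IH[OF this(1) r2 this(2)] show ?thesis using that by blast
      qed
      have "chain 3 (univ W) ?R (case_nat [p, q, k] c) (Suc m)"
      proof (rule chain_Cons[OF in_t _ c(1)])
        fix t assume "t \<in> tuples 3 (univ W)"
        then obtain p' q' l where t: "t = [p', q', l]" by (auto simp: tuples_3')
        show "?R [p, q, k] t \<longleftrightarrow> t = c 0"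
          unfolding t c(2) using good b nT False by (auto simp: add_step_def k'_def)
      qed
      moreover have "n' div 2 = n div 2 + k' \<longleftrightarrow> n' = n + k"
        unfolding k'_def
        by (rule half_add_iff[where p = "odd n" and p' = "odd n'"]) (use good less.prems(3) in auto)
      ultimately show ?thesis
        using c(3-5) not_end by (intro exI[of _ "case_nat [p, q, k] c"] exI[of _ "Suc m"])
          (auto simp: less_Suc_eq_0_disj simp del: length_pad)
    qed
  qed
qed

lemma add_nat_W:
  assumes "reads_at p (enc_nat n @ s)" "reads_at q (enc_nat n' @ s')"
  shows "add_nat k W p q \<longleftrightarrow> n' = n + of_bool k"
proof -
  let ?R = "\<lambda>s t. add_step W (s ! 0) (s ! 1) (s ! 2) (t ! 0) (t ! 1) (t ! 2)"
  obtain c m where c: "chain 3 (univ W) ?R c m"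
    "c 0 = [p, q, of_bool k]" "p + m < univ W" "\<forall>i<m. \<not> add_end W (c i ! 0) (c i ! 1) (c i ! 2)"
    "add_end W (c m ! 0) (c m ! 1) (c m ! 2) \<longleftrightarrow> n' = n + of_bool k"
  proof -
    have "(of_bool k :: nat) \<le> 1" by simp
    from add_nat_chain[OF assms this] show ?thesis using that by blast
  qed
  have in_t: "c i \<in> tuples 3 (univ W)" if "i \<le> m" for i using c(1) that by (auto simp: chain_def)
  have r: "reach3 W (add_init k p q) (add_step W) a b d \<longleftrightarrow> (\<exists>i\<le>m. [a, b, d] = c i)"
    if "a < univ W" "b < univ W" "d < univ W" for a b d
    unfolding reach3_def
  proof (rule reach_chain[OF c(1)])
    fix t assume "t \<in> tuples 3 (univ W)"
    then obtain a' b' d' where t: "t = [a', b', d']" by (auto simp: tuples_3')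
    show "add_init k p q (t ! 0) (t ! 1) (t ! 2) \<longleftrightarrow> t = c 0"
      unfolding t c(2) by (auto simp: add_init_def)
  qed (use c(3) that in \<open>simp_all del: length_pad\<close>)
  have "add_nat k W p q \<longleftrightarrow> (\<exists>i\<le>m. add_end W (c i ! 0) (c i ! 1) (c i ! 2))"
  proof
    assume "add_nat k W p q"
    then obtain a b d where abd: "a < univ W" "b < univ W" "d < univ W"
      "reach3 W (add_init k p q) (add_step W) a b d" "add_end W a b d"
      unfolding add_nat_def by blast
    then obtain i where "i \<le> m" "c i = [a, b, d]" using r by metis
    then show "\<exists>i\<le>m. add_end W (c i ! 0) (c i ! 1) (c i ! 2)" using abd(5) by (intro exI[of _ i]) simp
  next
    assume "\<exists>i\<le>m. add_end W (c i ! 0) (c i ! 1) (c i ! 2)"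
    then obtain i where i: "i \<le> m" "add_end W (c i ! 0) (c i ! 1) (c i ! 2)" by blast
    obtain a b d where abd: "c i = [a, b, d]" "a < univ W" "b < univ W" "d < univ W"
      using in_t[OF i(1)] by (auto simp: tuples_3' simp del: length_pad)
    then have "reach3 W (add_init k p q) (add_step W) a b d" using r i(1) by metis
    then show "add_nat k W p q" using abd i(2) unfolding add_nat_def by (auto simp del: length_pad)
  qed
  then show ?thesis using c(4,5) le_neq_implies_less by blast
qed

lemma eq_int_W:
  assumes "reads_at p (enc_int i @ s)" "reads_at q (enc_int j @ s')"
  shows "eq_int W p q \<longleftrightarrow> i = j"
proof -
  have r: "reads_at p ((i < 0) # enc_nat (nat \<bar>i\<bar>) @ s)" "reads_at q ((j < 0) # enc_nat (nat \<bar>j\<bar>) @ s')"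
    using assms by (simp_all add: enc_int_def)
  note r' = reads_at_Cons[OF r(1)] reads_at_Cons[OF r(2)]
  have "eq_int W p q \<longleftrightarrow> ((i < 0) = (j < 0) \<and> nat \<bar>j\<bar> = nat \<bar>i\<bar>)"
    unfolding eq_int_def using add_nat_W[OF r', of False] reads_at_isT[OF r(1)] reads_at_isT[OF r(2)]
      reads_at_less[OF r'(1)] reads_at_less[OF r'(2)] by (auto simp del: length_pad)
  then show ?thesis by auto
qed

lemma suc_int_W:
  assumes "reads_at p (enc_int i @ s)" "reads_at q (enc_int j @ s')"
  shows "suc_int W p q \<longleftrightarrow> j = i + 1"
proof -
  have r: "reads_at p ((i < 0) # enc_nat (nat \<bar>i\<bar>) @ s)" "reads_at q ((j < 0) # enc_nat (nat \<bar>j\<bar>) @ s')"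
    using assms by (simp_all add: enc_int_def)
  note r' = reads_at_Cons[OF r(1)] reads_at_Cons[OF r(2)]
  have z: "isT W (Suc q) \<longleftrightarrow> j \<noteq> 0"
    using r'(2) reads_at_isT by (cases "j = 0") (force simp: enc_nat_0 enc_nat_pos)+
  have "suc_int W p q \<longleftrightarrow> (\<not> isT W p \<and> \<not> isT W q \<and> add_nat True W (Suc p) (Suc q) \<or>
      isT W p \<and> add_nat True W (Suc q) (Suc p) \<and> (isT W q \<or> \<not> isT W (Suc q)))"
    unfolding suc_int_def using reads_at_less[OF r'(1)] reads_at_less[OF r'(2)] by (auto simp del: length_pad)
  also have "\<dots> \<longleftrightarrow> (\<not> i < 0 \<and> \<not> j < 0 \<and> nat \<bar>j\<bar> = nat \<bar>i\<bar> + 1 \<or>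
      i < 0 \<and> nat \<bar>i\<bar> = nat \<bar>j\<bar> + 1 \<and> (j < 0 \<or> j = 0))"
    unfolding add_nat_W[OF r'] add_nat_W[OF r'(2,1)] reads_at_isT[OF r(1)] reads_at_isT[OF r(2)] z
    by simp
  also have "\<dots> \<longleftrightarrow> j = i + 1" by arith
  finally show ?thesis .
qed

section \<open>Cells and gourds read at a position\<close>

definition cell_at :: "nat \<Rightarrow> int \<Rightarrow> int \<Rightarrow> nat \<Rightarrow> bool list \<Rightarrow> bool" where
  "cell_at u a b c s \<longleftrightarrow> reads_at u (True # enc_int a @ enc_int b @ enc_nat c @ s)"

lemma cell_at_parts:
  assumes "cell_at u a b c s"
  shows "isT W u" "reads_at (Suc u) (enc_int a @ enc_int b @ enc_nat c @ s)"
    "reads_at (Suc u + length (enc_int a)) (enc_int b @ enc_nat c @ s)"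
    "reads_at (Suc u + length (enc_int a) + length (enc_int b)) (enc_nat c @ s)"
    "reads_at (Suc u + length (enc_int a) + length (enc_int b) + length (enc_nat c)) s"
proof -
  have r: "reads_at u (True # enc_int a @ enc_int b @ enc_nat c @ s)" using assms by (simp add: cell_at_def)
  show "isT W u" using reads_at_isT[OF r] by simp
  show 1: "reads_at (Suc u) (enc_int a @ enc_int b @ enc_nat c @ s)" using reads_at_Cons[OF r] .
  show 2: "reads_at (Suc u + length (enc_int a)) (enc_int b @ enc_nat c @ s)" using reads_at_append[OF 1] .
  show 3: "reads_at (Suc u + length (enc_int a) + length (enc_int b)) (enc_nat c @ s)" using reads_at_append[OF 2] .
  show "reads_at (Suc u + length (enc_int a) + length (enc_int b) + length (enc_nat c)) s" using reads_at_append[OF 3] .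
qed

lemma y_pos_W:
  assumes "cell_at u a b c s" "q < univ W"
  shows "y_pos W u q \<longleftrightarrow> q = Suc u + length (enc_int a)"
proof -
  have "reads_at (Suc u) ((a < 0) # enc_nat (nat \<bar>a\<bar>) @ enc_int b @ enc_nat c @ s)"
    using cell_at_parts(2)[OF assms(1)] by (simp add: enc_int_def)
  from reads_at_Cons[OF this] have r: "reads_at (Suc (Suc u)) (enc_nat (nat \<bar>a\<bar>) @ enc_int b @ enc_nat c @ s)" .
  show ?thesis unfolding y_pos_def using skip_nat_W[OF r assms(2)] reads_at_less[OF r]
    by (auto simp: enc_int_def simp del: length_pad)
qed

lemma y_pos_iff:
  assumes "cell_at u a b c s"
  shows "q < univ W \<and> y_pos W u q \<longleftrightarrow> q = Suc u + length (enc_int a)"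
  using y_pos_W[OF assms] reads_at_less[OF cell_at_parts(3)[OF assms]] by auto

lemma color_pos_W:
  assumes "cell_at u a b c s" "q < univ W"
  shows "color_pos W u q \<longleftrightarrow> q = Suc u + length (enc_int a) + length (enc_int b)"
proof -
  let ?y = "Suc u + length (enc_int a)"
  have "reads_at ?y ((b < 0) # enc_nat (nat \<bar>b\<bar>) @ enc_nat c @ s)"
    using cell_at_parts(3)[OF assms(1)] by (simp add: enc_int_def)
  from reads_at_Cons[OF this] have r: "reads_at (Suc ?y) (enc_nat (nat \<bar>b\<bar>) @ enc_nat c @ s)" .
  have "color_pos W u q \<longleftrightarrow> skip_nat W (Suc ?y) q"
    unfolding color_pos_def bex_unique[OF y_pos_iff[OF assms(1)]] using reads_at_less[OF r] by (auto simp del: length_pad)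
  also have "\<dots> \<longleftrightarrow> q = Suc ?y + length (enc_nat (nat \<bar>b\<bar>))" using skip_nat_W[OF r assms(2)] .
  finally show ?thesis by (simp add: enc_int_def)
qed

lemma color_pos_iff:
  assumes "cell_at u a b c s"
  shows "q < univ W \<and> color_pos W u q \<longleftrightarrow> q = Suc u + length (enc_int a) + length (enc_int b)"
  using color_pos_W[OF assms] reads_at_less[OF cell_at_parts(4)[OF assms]] by auto

lemma next_cell_W:
  assumes "cell_at u a b c s" "q < univ W"
  shows "next_cell W u q \<longleftrightarrow> q = Suc u + length (enc_int a) + length (enc_int b) + length (enc_nat c)"
  unfolding next_cell_def bex_unique[OF color_pos_iff[OF assms(1)]]
  using cell_at_parts(1)[OF assms(1)] skip_nat_W[OF cell_at_parts(4)[OF assms(1)] assms(2)] by (auto simp del: length_pad)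

lemma adj_cells_W:
  assumes u: "cell_at u a b c s" and v: "cell_at v a' b' c' s'"
  shows "adj_cells W u v \<longleftrightarrow> adjacent (a, b) (a', b')"
proof -
  let ?y = "Suc u + length (enc_int a)" and ?y' = "Suc v + length (enc_int a')"
  note ru = cell_at_parts[OF u] and rv = cell_at_parts[OF v]
  have "adj_cells W u v \<longleftrightarrow>
     (suc_int W (Suc u) (Suc v) \<and> eq_int W ?y ?y' \<or> eq_int W (Suc u) (Suc v) \<and> suc_int W ?y ?y' \<or>
      suc_int W (Suc v) (Suc u) \<and> suc_int W ?y ?y' \<or> suc_int W (Suc v) (Suc u) \<and> eq_int W ?y ?y' \<or>
      eq_int W (Suc u) (Suc v) \<and> suc_int W ?y' ?y \<or> suc_int W (Suc u) (Suc v) \<and> suc_int W ?y' ?y)"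
    unfolding adj_cells_def bex_unique[OF y_pos_iff[OF u]]
      bex_unique[OF y_pos_iff[OF v]]
    using reads_at_less[OF ru(2)] reads_at_less[OF rv(2)] by (simp del: length_pad)
  also have "\<dots> \<longleftrightarrow> adjacent (a, b) (a', b')"
    unfolding suc_int_W[OF ru(2) rv(2)] suc_int_W[OF rv(2) ru(2)] eq_int_W[OF ru(2) rv(2)]
      suc_int_W[OF ru(3) rv(3)] suc_int_W[OF rv(3) ru(3)] eq_int_W[OF ru(3) rv(3)]
    by (auto simp: adjacent_def)
  finally show ?thesis .
qed

definition gourd_at :: "nat \<Rightarrow> gourd \<Rightarrow> bool list \<Rightarrow> bool" where
  "gourd_at p g s \<longleftrightarrow> reads_at p (True # enc_nat (fst g) @ enc_nat (snd g) @ s)"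

lemma gourd_at_parts:
  assumes "gourd_at p g s"
  shows "isT W p" "reads_at (Suc p) (enc_nat (fst g) @ enc_nat (snd g) @ s)"
    "reads_at (Suc p + length (enc_nat (fst g))) (enc_nat (snd g) @ s)"
    "reads_at (Suc p + length (enc_nat (fst g)) + length (enc_nat (snd g))) s"
proof -
  have r: "reads_at p (True # enc_nat (fst g) @ enc_nat (snd g) @ s)" using assms by (simp add: gourd_at_def)
  show "isT W p" using reads_at_isT[OF r] by simp
  show 1: "reads_at (Suc p) (enc_nat (fst g) @ enc_nat (snd g) @ s)" using reads_at_Cons[OF r] .
  show 2: "reads_at (Suc p + length (enc_nat (fst g))) (enc_nat (snd g) @ s)" using reads_at_append[OF 1] .
  show "reads_at (Suc p + length (enc_nat (fst g)) + length (enc_nat (snd g))) s" using reads_at_append[OF 2] .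
qed

lemma next_gourd_W:
  assumes "gourd_at p g s" "q < univ W"
  shows "next_gourd W p q \<longleftrightarrow> q = Suc p + length (enc_nat (fst g)) + length (enc_nat (snd g))"
proof -
  note r = gourd_at_parts[OF assms(1)]
  have "next_gourd W p q \<longleftrightarrow> (\<exists>b<univ W. skip_nat W (Suc p) b \<and> skip_nat W b q)"
    unfolding next_gourd_def using r(1) reads_at_less[OF r(2)] by (auto simp del: length_pad)
  then show ?thesis
    unfolding bex_unique[OF skip_nat_iff[OF r(2)]] skip_nat_W[OF r(3) assms(2)] .
qed

lemma fits_W:
  assumes g: "gourd_at p g s" "is_gourd W p"
    and c: "reads_at u (enc_nat a @ s1)" "reads_at v (enc_nat b @ s2)"
  shows "fits W u v p \<longleftrightarrow> same_ends (a, b) g"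
proof -
  note r = gourd_at_parts[OF g(1)]
  have "fits W u v p \<longleftrightarrow> (\<exists>b<univ W. skip_nat W (Suc p) b \<and>
     (add_nat False W u (Suc p) \<and> add_nat False W v b \<or> add_nat False W u b \<and> add_nat False W v (Suc p)))"
    unfolding fits_def using g(2) reads_at_less[OF r(2)] by (auto simp del: length_pad)
  also have "\<dots> \<longleftrightarrow> (fst g = a \<and> snd g = b \<or> snd g = a \<and> fst g = b)"
    unfolding bex_unique[OF skip_nat_iff[OF r(2)]]
      add_nat_W[OF c(1) r(2), of False] add_nat_W[OF c(1) r(3), of False]
      add_nat_W[OF c(2) r(2), of False] add_nat_W[OF c(2) r(3), of False]
    by simp
  finally have "fits W u v p \<longleftrightarrow> (fst g = a \<and> snd g = b \<or> snd g = a \<and> fst g = b)" .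
  then show ?thesis by (auto simp: same_ends_def prod_eq_iff)
qed

end

section \<open>Positions of the cells and gourds of an encoded instance\<close>

abbreviation enc_cell :: "cell \<times> color \<Rightarrow> bool list" where
  "enc_cell \<equiv> enc_pair (enc_pair enc_int enc_int) enc_nat"

abbreviation enc_gourd :: "gourd \<Rightarrow> bool list" where
  "enc_gourd \<equiv> enc_pair enc_nat enc_nat"

lemma enc_pos_ge:
  assumes "\<And>z. m \<le> Suc (length (f z))" "i \<le> length xs"
  shows "m * i \<le> enc_pos f xs i"
  using assms(2)
proof (induction i)
  case (Suc i)
  then show ?case using assms(1)[of "xs ! i"] by (simp add: enc_pos_Suc)
qed simp

lemma length_enc_nat: "1 \<le> length (enc_nat n)"
  by (cases "n = 0") (simp_all add: enc_nat_0 enc_nat_pos)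

lemma reads_at_enc_list:
  assumes "reads_at x p (enc_list f xs @ s)" "i \<le> length xs"
  shows "reads_at x (p + enc_pos f xs i) (enc_list f (drop i xs) @ s)"
  using assms(2)
proof (induction i)
  case 0
  then show ?case using assms(1) by simp
next
  case (Suc i)
  then have "drop i xs = xs ! i # drop (Suc i) xs" by (simp add: Cons_nth_drop_Suc)
  with Suc have "reads_at x (p + enc_pos f xs i) (True # f (xs ! i) @ enc_list f (drop (Suc i) xs) @ s)"
    by simp
  from reads_at_append[OF reads_at_Cons[OF this]] show ?case
    using Suc.prems by (simp add: enc_pos_Suc add.assoc)
qed

context
  fixes I :: cgp
begin

definition inp :: "bool list" where "inp = enc_cgp I"

definition cpos :: "nat \<Rightarrow> nat" where "cpos i = enc_pos enc_cell (colored_cells I) i"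

definition gpos :: "nat \<Rightarrow> nat" where
  "gpos i = Suc (cpos (length (colored_cells I))) + enc_pos enc_gourd (gourd_list I) i"

abbreviation nc :: nat where "nc \<equiv> length (colored_cells I)"
abbreviation ng :: nat where "ng \<equiv> length (gourd_list I)"

lemma reads_at_cpos:
  assumes "i \<le> nc"
  shows "reads_at inp (cpos i) (enc_list enc_cell (drop i (colored_cells I)) @ enc_list enc_gourd (gourd_list I))"
  using reads_at_enc_list[of inp 0 enc_cell "colored_cells I" _ i] assms
  by (simp add: reads_at_def inp_def enc_cgp_def cpos_def)

lemma reads_at_gpos:
  assumes "i \<le> ng"
  shows "reads_at inp (gpos i) (enc_list enc_gourd (drop i (gourd_list I)))"
proof -
  have "reads_at inp (cpos nc) (False # enc_list enc_gourd (gourd_list I) @ [])"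
    using reads_at_cpos[of nc] by simp
  from reads_at_enc_list[OF reads_at_Cons[OF this] assms] show ?thesis by (simp add: gpos_def)
qed

lemma cell_at_cpos:
  assumes "i < nc"
  shows "cell_at inp (cpos i) (fst (fst (colored_cells I ! i))) (snd (fst (colored_cells I ! i)))
    (snd (colored_cells I ! i)) (enc_list enc_cell (drop (Suc i) (colored_cells I)) @ enc_list enc_gourd (gourd_list I))"
proof -
  have "drop i (colored_cells I) = colored_cells I ! i # drop (Suc i) (colored_cells I)"
    using assms by (simp add: Cons_nth_drop_Suc)
  then show ?thesis using reads_at_cpos[of i] assms by (simp add: cell_at_def enc_pair_def)
qed

lemma gourd_at_gpos:
  assumes "i < ng"
  shows "gourd_at inp (gpos i) (gourd_list I ! i) (enc_list enc_gourd (drop (Suc i) (gourd_list I)))"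
proof -
  have "drop i (gourd_list I) = gourd_list I ! i # drop (Suc i) (gourd_list I)"
    using assms by (simp add: Cons_nth_drop_Suc)
  then show ?thesis using reads_at_gpos[of i] assms by (simp add: gourd_at_def enc_pair_def)
qed

lemma cpos_inj: "i \<le> nc \<Longrightarrow> j \<le> nc \<Longrightarrow> cpos i = cpos j \<longleftrightarrow> i = j"
  by (simp add: cpos_def enc_pos_inj)

lemma gpos_inj: "i \<le> ng \<Longrightarrow> j \<le> ng \<Longrightarrow> gpos i = gpos j \<longleftrightarrow> i = j"
  by (simp add: gpos_def enc_pos_inj)

lemma cpos_less: "i < nc \<Longrightarrow> cpos i < length inp"
  using reads_at_cpos[of i] by (cases "drop i (colored_cells I)") (auto simp: reads_at_def dest!: arg_cong[where f = length])

lemma gpos_le: "i \<le> ng \<Longrightarrow> gpos i \<le> length inp"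
  using reads_at_gpos[of i] by (simp add: reads_at_def)

lemma cpos_le: "i \<le> nc \<Longrightarrow> cpos i \<le> length inp"
  using reads_at_cpos[of i] by (simp add: reads_at_def)

lemma nc_le: "nc \<le> length inp"
  using enc_pos_ge[of 1 enc_cell nc "colored_cells I"] cpos_le[of nc] by (simp add: cpos_def)

text \<open>A gourd takes its announcement and at least one symbol for each end. The factor leaves
  room for twice the number of gourds, which occurs as a count and as a walk length.\<close>

lemma ng_le: "3 * ng \<le> length inp"
proof -
  have "3 \<le> Suc (length (enc_gourd z))" for z
    using length_enc_nat[of "fst z"] length_enc_nat[of "snd z"] by (simp add: enc_pair_def)
  from enc_pos_ge[where f = enc_gourd, OF this, of ng "gourd_list I"] show ?thesis
    using gpos_le[of ng] by (simp add: gpos_def)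
qed

context
  fixes \<rho> :: "nat \<Rightarrow> bool"
begin

abbreviation V :: world where "V \<equiv> world_of inp \<rho>"

lemma le_inp: "p \<le> length inp \<Longrightarrow> p < univ V"
  using length_less_univ[of inp \<rho>] by (auto simp del: length_pad)

lemma isT_cpos: "i \<le> nc \<Longrightarrow> isT V (cpos i) \<longleftrightarrow> i < nc"
proof -
  assume i: "i \<le> nc"
  show ?thesis
  proof (cases "i < nc")
    case True
    then show ?thesis using cell_at_parts(1)[OF cell_at_cpos[OF True]] by simp
  next
    case False
    then have "reads_at inp (cpos i) (False # enc_list enc_gourd (gourd_list I))"
      using reads_at_cpos[of i] i by simp
    then show ?thesis using reads_at_isT False by blast
  qed
qed

lemma isT_gpos: "i \<le> ng \<Longrightarrow> isT V (gpos i) \<longleftrightarrow> i < ng"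
proof -
  assume i: "i \<le> ng"
  show ?thesis
  proof (cases "i < ng")
    case True
    then show ?thesis using gourd_at_parts(1)[OF gourd_at_gpos[OF True]] by simp
  next
    case False
    then have "reads_at inp (gpos i) (False # [])" using reads_at_gpos[of i] i by simp
    then show ?thesis using reads_at_isT False by blast
  qed
qed

lemma next_cell_cpos: "i < nc \<Longrightarrow> q < univ V \<Longrightarrow> next_cell V (cpos i) q \<longleftrightarrow> q = cpos (Suc i)"
  using next_cell_W[OF cell_at_cpos] by (simp add: cpos_def enc_pos_Suc enc_pair_def add.assoc del: length_pad)

lemma next_gourd_gpos: "i < ng \<Longrightarrow> q < univ V \<Longrightarrow> next_gourd V (gpos i) q \<longleftrightarrow> q = gpos (Suc i)"
  using next_gourd_W[OF gourd_at_gpos] by (simp add: gpos_def enc_pos_Suc enc_pair_def add.assoc del: length_pad)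

lemma cell_reached_V:
  assumes "p < univ V"
  shows "cell_reached V p \<longleftrightarrow> (\<exists>i\<le>nc. p = cpos i)"
proof -
  have c: "chain 1 (univ V) (\<lambda>s t. next_cell V (s ! 0) (t ! 0)) (\<lambda>i. [cpos i]) nc"
    unfolding chain_def
  proof (intro conjI allI impI ballI)
    fix i assume "i \<le> nc" then show "[cpos i] \<in> tuples 1 (univ V)" using cpos_le le_inp by (simp del: length_pad)
  next
    fix i t assume "i < nc" "t \<in> tuples 1 (univ V)"
    then show "next_cell V ([cpos i] ! 0) (t ! 0) \<longleftrightarrow> t = [cpos (Suc i)]"
      using next_cell_cpos by (auto simp: tuples_1 simp del: length_pad)
  next
    fix t show "\<not> next_cell V ([cpos nc] ! 0) (t ! 0)" using isT_cpos[of nc] by (simp add: next_cell_def)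
  qed
  have "reach1 V (\<lambda>a. a = 0) (next_cell V) p \<longleftrightarrow> (\<exists>i\<le>nc. [p] = [cpos i])"
    unfolding reach1_def
  proof (rule reach_chain[OF c])
    show "nc < univ V" using nc_le le_inp by blast
    fix t assume "t \<in> tuples 1 (univ V)"
    then show "(t ! 0 = 0) = (t = [cpos 0])" by (auto simp: tuples_1 cpos_def)
  qed (use assms in simp)
  then show ?thesis by (simp add: cell_reached_def)
qed

lemma is_cell_V: "p < univ V \<Longrightarrow> is_cell V p \<longleftrightarrow> (\<exists>i<nc. p = cpos i)"
  unfolding is_cell_def using cell_reached_V isT_cpos by (auto simp: le_less)

lemma first_gourd_V: "p < univ V \<Longrightarrow> first_gourd V p \<longleftrightarrow> p = gpos 0"
proof -
  assume p: "p < univ V"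
  have "first_gourd V p \<longleftrightarrow> (\<exists>z<univ V. (z = cpos nc) \<and> p = Suc z)"
    unfolding first_gourd_def using cell_reached_V isT_cpos by (metis (no_types, lifting) le_less less_irrefl)
  also have "\<dots> \<longleftrightarrow> p = gpos 0" using le_inp[OF cpos_le[of nc]] by (auto simp: gpos_def)
  finally show ?thesis .
qed

lemma is_gourd_V:
  assumes "p < univ V"
  shows "is_gourd V p \<longleftrightarrow> (\<exists>i<ng. p = gpos i)"
proof -
  have c: "chain 1 (univ V) (\<lambda>s t. next_gourd V (s ! 0) (t ! 0)) (\<lambda>i. [gpos i]) ng"
    unfolding chain_def
  proof (intro conjI allI impI ballI)
    fix i assume "i \<le> ng" then show "[gpos i] \<in> tuples 1 (univ V)" using gpos_le le_inp by (simp del: length_pad)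
  next
    fix i t assume "i < ng" "t \<in> tuples 1 (univ V)"
    then show "next_gourd V ([gpos i] ! 0) (t ! 0) \<longleftrightarrow> t = [gpos (Suc i)]"
      using next_gourd_gpos by (auto simp: tuples_1 simp del: length_pad)
  next
    fix t show "\<not> next_gourd V ([gpos ng] ! 0) (t ! 0)" using isT_gpos[of ng] by (simp add: next_gourd_def)
  qed
  have "reach1 V (first_gourd V) (next_gourd V) p \<longleftrightarrow> (\<exists>i\<le>ng. [p] = [gpos i])"
    unfolding reach1_def
  proof (rule reach_chain[OF c])
    show "ng < univ V" using ng_le le_inp[of ng] by linarith
    fix t assume "t \<in> tuples 1 (univ V)"
    then show "first_gourd V (t ! 0) = (t = [gpos 0])" using first_gourd_V by (auto simp: tuples_1 simp del: length_pad)
  qed (use assms in simp)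
  then show ?thesis unfolding is_gourd_def using isT_gpos by (auto simp: le_less)
qed

definition represents :: "nat \<Rightarrow> gourd \<Rightarrow> bool" where
  "represents p q \<longleftrightarrow> (\<exists>k<ng. p = gpos k \<and> same_ends q (gourd_list I ! k))"

lemma fits_V:
  assumes "reads_at inp u (enc_nat a @ s)" "reads_at inp v (enc_nat b @ s')" "p < univ V"
  shows "fits V u v p \<longleftrightarrow> represents p (a, b)"
proof (cases "is_gourd V p")
  case True
  then obtain k where k: "k < ng" "p = gpos k" using is_gourd_V[OF assms(3)] by auto
  show ?thesis using fits_W[OF gourd_at_gpos[OF k(1)] _ assms(1,2), of \<rho>] True k gpos_inj
    by (auto simp: represents_def)
next
  case False
  then show ?thesis using is_gourd_V[OF assms(3)] by (auto simp: fits_def represents_def)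
qed

abbreviation ccol :: "nat \<Rightarrow> color" where "ccol i \<equiv> snd (colored_cells I ! i)"

lemma fits_cells_V:
  assumes "i < nc" "j < nc" "p < univ V"
  shows "fits_cells V (cpos i) (cpos j) p \<longleftrightarrow> represents p (ccol i, ccol j)"
  unfolding fits_cells_def bex_unique[OF color_pos_iff[OF cell_at_cpos[OF assms(1)]]]
    bex_unique[OF color_pos_iff[OF cell_at_cpos[OF assms(2)]]]
  by (rule fits_V[OF cell_at_parts(4)[OF cell_at_cpos[OF assms(1)]] cell_at_parts(4)[OF cell_at_cpos[OF assms(2)]] assms(3)])

lemma fits_gourd_V:
  assumes "i < ng" "p < univ V"
  shows "fits_gourd V (gpos i) p \<longleftrightarrow> represents p (gourd_list I ! i)"
proof -
  note r = gourd_at_parts[OF gourd_at_gpos[OF assms(1)]]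
  have "fits_gourd V (gpos i) p \<longleftrightarrow> (\<exists>c'<univ V. skip_nat V (Suc (gpos i)) c' \<and> fits V (Suc (gpos i)) c' p)"
    unfolding fits_gourd_def using reads_at_less[OF r(2), of \<rho>] by (auto simp del: length_pad)
  also have "\<dots> \<longleftrightarrow> represents p (fst (gourd_list I ! i), snd (gourd_list I ! i))"
    unfolding bex_unique[OF skip_nat_iff[OF r(2)]] by (rule fits_V[OF r(2,3) assms(2)])
  finally show ?thesis by simp
qed

text \<open>Taking the first representative makes types disjoint even if \<open>g\<close> represents
  the same colors several times.\<close>

definition has_type :: "(nat \<Rightarrow> nat) \<Rightarrow> nat \<Rightarrow> gourd \<Rightarrow> bool" where
  "has_type g t q \<longleftrightarrow> represents (g t) q \<and> (\<forall>t'<t. \<not> represents (g t') q)"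

lemma gourd_type_V:
  assumes "i < ng" "\<And>t'. t' \<le> t \<Longrightarrow> g t' < univ V"
  shows "gourd_type V g t (gpos i) \<longleftrightarrow> has_type g t (gourd_list I ! i)"
  unfolding gourd_type_def has_type_def using fits_gourd_V[OF assms(1)] assms(2) by (auto simp del: length_pad)

lemma edge_type_V:
  assumes "u < univ V" "v < univ V" "\<And>t'. t' \<le> t \<Longrightarrow> g t' < univ V"
  shows "edge_type V g t u v \<longleftrightarrow> (\<exists>i<nc. \<exists>j<nc. u = cpos i \<and> v = cpos j \<and>
     adjacent (fst (colored_cells I ! i)) (fst (colored_cells I ! j)) \<and> has_type g t (ccol i, ccol j))"
proof -
  have *: "adj_cells V (cpos i) (cpos j) \<and> fits_cells V (cpos i) (cpos j) (g t) \<and>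
      (\<forall>t'<t. \<not> fits_cells V (cpos i) (cpos j) (g t')) \<longleftrightarrow>
      adjacent (fst (colored_cells I ! i)) (fst (colored_cells I ! j)) \<and> has_type g t (ccol i, ccol j)"
    if "i < nc" "j < nc" for i j
    unfolding has_type_def adj_cells_W[OF cell_at_cpos[OF that(1)] cell_at_cpos[OF that(2)]]
    using fits_cells_V[OF that] assms(3) by (auto simp del: length_pad)
  show ?thesis
    unfolding edge_type_def is_cell_V[OF assms(1)] is_cell_V[OF assms(2)] using * by blast
qed

lemma covering_V:
  assumes "\<And>t. t < K \<Longrightarrow> g t < univ V"
  shows "covering K V g \<longleftrightarrow> (\<forall>i<ng. \<exists>t<K. represents (g t) (gourd_list I ! i))"
proof -
  have "covering K V g \<longleftrightarrow> (\<forall>i<ng. \<exists>t<K. fits_gourd V (gpos i) (g t))"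
    unfolding covering_def using is_gourd_V le_inp[OF gpos_le] by (metis (no_types, lifting) less_imp_le)
  then show ?thesis using fits_gourd_V assms by (metis (no_types, lifting))
qed

lemma gourd_count_V:
  assumes g: "\<And>t'. t' \<le> t \<Longrightarrow> g t' < univ V" and c: "c < univ V"
  shows "gourd_count V g t c \<longleftrightarrow> c = 2 * card {i. i < ng \<and> has_type g t (gourd_list I ! i)}"
proof -
  define N where "N = (\<lambda>m. 2 * card {i. i < m \<and> has_type g t (gourd_list I ! i)})"
  have N_Suc: "N (Suc m) = (if has_type g t (gourd_list I ! m) then Suc (Suc (N m)) else N m)" for m
  proof -
    have "{i. i < Suc m \<and> has_type g t (gourd_list I ! i)} =
        (if has_type g t (gourd_list I ! m) then insert m {i. i < m \<and> has_type g t (gourd_list I ! i)}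
         else {i. i < m \<and> has_type g t (gourd_list I ! i)})"
      by (auto simp: less_Suc_eq)
    then show ?thesis by (simp add: N_def)
  qed
  \<comment> \<open>The doubled counts must be positions; \<open>ng_le\<close> provides the
    room.\<close>
  have N_less: "N m < univ V" if "m \<le> ng" for m
  proof -
    have "card {i. i < m \<and> has_type g t (gourd_list I ! i)} \<le> card {..<m}" by (rule card_mono) auto
    then have "N m \<le> length inp" using that ng_le by (simp add: N_def)
    then show ?thesis by (rule le_inp)
  qed
  let ?R = "\<lambda>s t'. count_step V g t (s ! 0) (s ! 1) (t' ! 0) (t' ! 1)"
  have ch: "chain 2 (univ V) ?R (\<lambda>i. [gpos i, N i]) ng"
    unfolding chain_def
  proof (intro conjI allI impI ballI)
    fix i assume "i \<le> ng"
    then show "[gpos i, N i] \<in> tuples 2 (univ V)" using gpos_le le_inp N_less by (simp del: length_pad)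
  next
    fix i s assume i: "i < ng" and "s \<in> tuples 2 (univ V)"
    then obtain a b where s: "s = [a, b]" "a < univ V" "b < univ V" by (auto simp: tuples_2 simp del: length_pad)
    show "?R [gpos i, N i] s \<longleftrightarrow> s = [gpos (Suc i), N (Suc i)]"
      using next_gourd_gpos[OF i s(2)] gourd_type_V[OF i g] by (auto simp: s(1) count_step_def N_Suc)
  next
    fix s show "\<not> ?R [gpos ng, N ng] s" using isT_gpos[of ng] by (simp add: count_step_def next_gourd_def)
  qed
  have r: "reach2 V (count_init V) (count_step V g t) p c \<longleftrightarrow> (\<exists>i\<le>ng. [p, c] = [gpos i, N i])" if "p < univ V" for p
    unfolding reach2_def
  proof (rule reach_chain[OF ch])
    show "ng < univ V" using ng_le le_inp[of ng] by linarith
    fix s assume "s \<in> tuples 2 (univ V)"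
    then obtain a b where s: "s = [a, b]" "a < univ V" by (auto simp: tuples_2 simp del: length_pad)
    show "count_init V (s ! 0) (s ! 1) \<longleftrightarrow> s = [gpos 0, N 0]"
      using first_gourd_V[OF s(2)] by (auto simp: s(1) count_init_def N_def)
  qed (use that c in simp)
  have "gourd_count V g t c \<longleftrightarrow> (\<exists>p<univ V. (\<exists>i\<le>ng. p = gpos i \<and> c = N i) \<and> \<not> isT V p)"
    unfolding gourd_count_def using r by auto
  also have "\<dots> \<longleftrightarrow> c = N ng" using isT_gpos le_inp[OF gpos_le[of ng]] by (metis le_less less_irrefl order_refl)
  finally show ?thesis by (simp add: N_def)
qed

end

end

section \<open>Random evaluation of a multilinear polynomial\<close>

text \<open>
  The value of the variable \<open>e\<close> is determined by the \<open>L\<close> random bits in the block \<open>D e\<close>. Splitting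
  off one variable, a zero is a zero of its cofactor or fixes the bits in the block of the variable.
\<close>

lemma schwartz_zippel_blocks:
  fixes val :: "'e \<Rightarrow> 'b set \<Rightarrow> 'r :: idom"
  assumes U: "finite U" and D: "\<And>e. e \<in> E \<Longrightarrow> D e \<subseteq> U \<and> card (D e) = L"
    and disj: "\<And>e e'. e \<in> E \<Longrightarrow> e' \<in> E \<Longrightarrow> e \<noteq> e' \<Longrightarrow> D e \<inter> D e' = {}"
    and val: "\<And>e A A'. e \<in> E \<Longrightarrow> A \<inter> D e = A' \<inter> D e \<Longrightarrow> val e A = val e A'"
    and inj: "\<And>e A A'. e \<in> E \<Longrightarrow> val e A = val e A' \<Longrightarrow> A \<inter> D e = A' \<inter> D e"
    and F: "finite F" "F \<noteq> {}" "\<And>M. M \<in> F \<Longrightarrow> finite M \<and> M \<subseteq> E \<and> card M = n"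
  shows "card {A \<in> Pow U. (\<Sum>M\<in>F. \<Prod>e\<in>M. val e A) = 0} * 2 ^ L \<le> n * 2 ^ card U"
  using F
proof (induction n arbitrary: F)
  case 0
  have "M = {}" if "M \<in> F" for M using "0.prems"(3)[OF that] by auto
  then have "F = {{}}" using "0.prems"(2) by auto
  then show ?case by simp
next
  case (Suc n)
  \<comment> \<open>Splitting off a variable that occurs keeps the family \<open>G\<close> of its
    cofactor nonempty, as the induction hypothesis requires.\<close>
  obtain M0 where "M0 \<in> F" using Suc.prems(2) by auto
  then have "card M0 = Suc n" "M0 \<subseteq> E" using Suc.prems(3) by auto
  then have "M0 \<noteq> {}" by auto
  then obtain e where e: "e \<in> M0" "e \<in> E" using \<open>M0 \<subseteq> E\<close> by blast
  define F1 where "F1 = {M \<in> F. e \<in> M}"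
  define G where "G = (\<lambda>M. M - {e}) ` F1"
  let ?cof = "\<lambda>A. \<Sum>M\<in>G. \<Prod>e\<in>M. val e A"
  let ?rest = "\<lambda>A. \<Sum>M\<in>F - F1. \<Prod>e\<in>M. val e A"
  let ?all = "\<lambda>A. \<Sum>M\<in>F. \<Prod>e\<in>M. val e A"
  have fin: "finite F1" "F1 \<subseteq> F" using Suc.prems(1) by (auto simp: F1_def)
  have G: "finite G" "G \<noteq> {}" "\<And>M. M \<in> G \<Longrightarrow> finite M \<and> M \<subseteq> E - {e} \<and> card M = n"
    using Suc.prems(3) fin \<open>M0 \<in> F\<close> e by (auto simp: G_def F1_def)
  have inj1: "inj_on (\<lambda>M. M - {e}) F1" by (auto simp: inj_on_def F1_def)
  have split: "?all A = val e A * ?cof A + ?rest A" for A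
  proof -
    have "?all A = ?rest A + (\<Sum>M\<in>F1. \<Prod>e\<in>M. val e A)"
      by (rule sum.subset_diff[OF fin(2) Suc.prems(1)])
    also have "(\<Sum>M\<in>F1. \<Prod>e\<in>M. val e A) = (\<Sum>M\<in>F1. val e A * (\<Prod>e\<in>M - {e}. val e A))"
      using Suc.prems(3) by (intro sum.cong refl prod.remove) (auto simp: F1_def)
    also have "\<dots> = val e A * ?cof A"
      unfolding G_def by (simp add: sum.reindex[OF inj1] sum_distrib_left)
    finally show ?thesis by simp
  qed
  have same: "?cof A = ?cof A' \<and> ?rest A = ?rest A'" if eq: "A - D e = A' - D e" for A A'
  proof -
    have v: "val e' A = val e' A'" if "e' \<in> E" "e' \<noteq> e" for e'
      using disj[OF that(1) e(2) that(2)] eq by (intro val[OF that(1)]) blast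
    have "(\<Prod>e\<in>M. val e A) = (\<Prod>e\<in>M. val e A')" if "M \<subseteq> E - {e}" for M
      using that v by (intro prod.cong) auto
    moreover have "M \<subseteq> E - {e}" if "M \<in> F - F1" for M
      using that Suc.prems(3) by (auto simp: F1_def)
    ultimately show ?thesis using G(3) by (auto intro!: sum.cong)
  qed
  define B1 where "B1 = {A \<in> Pow U. ?cof A = 0}"
  define B2 where "B2 = {A \<in> Pow U. ?all A = 0 \<and> ?cof A \<noteq> 0}"
  have "card B2 \<le> card (Pow (U - D e))"
  proof (rule card_inj_on_le)
    \<comment> \<open>The bits outside the block fix cofactor and rest. Since the cofactor is not 0,
      they fix the value of \<open>e\<close> at a zero as well, and this value determines the bits
      in the block.\<close>
    show "inj_on (\<lambda>A. A - D e) B2"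
    proof (rule inj_onI)
      fix A A' assume A: "A \<in> B2" "A' \<in> B2" and eq: "A - D e = A' - D e"
      have "val e A * ?cof A + ?rest A = val e A' * ?cof A + ?rest A"
        using A split[of A] split[of A'] same[OF eq] by (simp add: B2_def)
      then have "val e A = val e A'" using A by (simp add: B2_def)
      from inj[OF e(2) this] eq show "A = A'" by blast
    qed
  qed (use U in \<open>auto simp: B2_def\<close>)
  also have "card (Pow (U - D e)) = 2 ^ (card U - L)"
    using D[OF e(2)] U card_Diff_subset[of "D e" U] finite_subset[of "D e" U] by (simp add: card_Pow)
  finally have "card B2 * 2 ^ L \<le> 2 ^ (card U - L) * 2 ^ L" by simp
  also have "\<dots> = 2 ^ card U"
    using D[OF e(2)] card_mono[OF U, of "D e"] by (simp flip: power_add)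
  finally have b2: "card B2 * 2 ^ L \<le> 2 ^ card U" .
  have b1: "card B1 * 2 ^ L \<le> n * 2 ^ card U"
    unfolding B1_def by (rule Suc.IH[OF G(1,2)]) (use G(3) in blast)
  have "card {A \<in> Pow U. ?all A = 0} \<le> card (B1 \<union> B2)"
    using U by (intro card_mono) (auto simp: B1_def B2_def)
  also have "\<dots> \<le> card B1 + card B2" by (rule card_Un_le)
  finally have "card {A \<in> Pow U. ?all A = 0} * 2 ^ L \<le> (card B1 + card B2) * 2 ^ L" by simp
  then show ?case using b1 b2 by (simp add: algebra_simps)
qed

lemma bij_lists_sets: "bij_betw (\<lambda>r. {k. k < n \<and> r ! k}) {r :: bool list. length r = n} (Pow {..<n})"
proof (rule bij_betwI[where g = "\<lambda>A. map (\<lambda>k. k \<in> A) [0..<n]"])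
  fix r :: "bool list" assume "r \<in> {r. length r = n}"
  then show "map (\<lambda>k. k \<in> {k. k < n \<and> r ! k}) [0..<n] = r" by (auto intro!: nth_equalityI)
qed auto

lemma power2_eq_char2:
  fixes p q :: "bit poly"
  assumes "p\<^sup>2 = q\<^sup>2"
  shows "p = q"
proof -
  have "- q = q" by (simp add: poly_eq_iff)
  then show ?thesis using assms by (metis power2_eq_iff)
qed

lemma rpoly_eq_iff: "rpoly L r e = rpoly L r' e \<longleftrightarrow> (\<forall>j<L. r e j = r' e j)"
proof
  assume eq: "rpoly L r e = rpoly L r' e"
  show "\<forall>j<L. r e j = r' e j"
  proof (intro allI impI)
    fix j assume "j < L"
    then show "r e j = r' e j" using arg_cong[OF eq, of "\<lambda>p. coeff p j"]
      by (cases "r e j"; cases "r' e j") (simp_all add: coeff_rpoly)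
  qed
next
  assume "\<forall>j<L. r e j = r' e j"
  then show "rpoly L r e = rpoly L r' e" by (auto simp: rpoly_def intro!: sum.cong)
qed

lemma degree_rpoly: "degree (rpoly L r e) \<le> L"
  by (rule degree_le) (simp add: coeff_rpoly)

lemma degree_prod_rpoly:
  assumes "finite M"
  shows "degree ((\<Prod>e\<in>M. rpoly L r e)\<^sup>2) \<le> 2 * card M * L"
proof -
  have "degree (\<Prod>e\<in>M. rpoly L r e) \<le> (\<Sum>e\<in>M. degree (rpoly L r e))"
    using degree_prod_sum_le[OF assms, of "rpoly L r"] by (simp add: comp_def)
  also have "\<dots> \<le> card M * L" using sum_bounded_above[of M "\<lambda>e. degree (rpoly L r e)" L] degree_rpoly by simp
  finally show ?thesis using degree_power_le[of "\<Prod>e\<in>M. rpoly L r e" 2] by simp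
qed

text \<open>The inverse of \<open>digits\<close>: the address of a triple on the random tape and
  hence, up to \<open>b + 4 * k\<close>, the index of its coin.\<close>

definition idx :: "nat \<Rightarrow> nat list \<Rightarrow> nat" where
  "idx B ts = inv_into {..<B ^ 3} (digits B 3) ts"

lemma idx_bij: "bij_betw (idx B) (tuples 3 B) {..<B ^ 3}"
  unfolding idx_def[abs_def] by (rule bij_betw_inv_into[OF bij_digits])

lemma rnd_world_of:
  assumes "ts \<in> tuples 3 (univ (world_of x \<rho>))"
  shows "rnd (world_of x \<rho>) ts \<longleftrightarrow> \<rho> (idx (univ (world_of x \<rho>)) ts)"
proof -
  let ?B = "univ (world_of x \<rho>)"
  have b: "bij_betw (digits ?B 3) {..<?B ^ 3} (tuples 3 ?B)" by (rule bij_digits)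
  have i: "idx ?B ts < ?B ^ 3" "digits ?B 3 (idx ?B ts) = ts"
    using bij_betw_inv_into_right[OF b assms] idx_bij[of ?B] assms
    by (auto simp: bij_betw_def idx_def simp del: length_pad)
  have "k = idx ?B ts" if "k < ?B ^ 3" "digits ?B 3 k = ts" for k
    using bij_betw_inv_into_left[OF b, of k] that by (simp add: idx_def del: length_pad)
  then have "rnd (world_of x \<rho>) ts \<longleftrightarrow> snd (world_of x \<rho>) ! idx ?B ts = 2"
    unfolding rnd_def using i by metis
  also have "\<dots> \<longleftrightarrow> \<rho> (idx ?B ts)"
    using i(1) by (simp add: world_of_def del: length_pad)
  finally show ?thesis .
qed

section \<open>Placements and typed matchings\<close>

lemma adjacent_imp_sym: "adjacent u v \<Longrightarrow> adjacent v u"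
  unfolding adjacent_def by (elim insertE emptyE; simp; linarith)

lemma adjacent_sym: "adjacent u v \<longleftrightarrow> adjacent v u"
  using adjacent_imp_sym by blast

lemma adjacent_irrefl: "\<not> adjacent u u"
  by (simp add: adjacent_def)

lemma same_ends_swap: "same_ends (a, b) q \<longleftrightarrow> same_ends (b, a) q"
  by (auto simp: same_ends_def)

lemma tuples_nth: "ts \<in> tuples d B \<Longrightarrow> i < d \<Longrightarrow> ts ! i < B"
  unfolding tuples_def using nth_mem by blast

lemma odd_walks_cong:
  assumes "\<And>s t. s \<in> tuples d B \<Longrightarrow> t \<in> tuples d B \<Longrightarrow> S s t \<longleftrightarrow> S' s t" "t \<in> tuples d B"
  shows "odd_walks d B I S n t \<longleftrightarrow> odd_walks d B I S' n t"
  using assms(2)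
proof (induction n arbitrary: t)
  case (Suc n)
  then have "{s \<in> tuples d B. odd_walks d B I S n s \<and> S s t} = {s \<in> tuples d B. odd_walks d B I S' n s \<and> S' s t}"
    using assms(1) by blast
  then show ?case by simp
qed simp

lemma represents_swap: "represents I p (a, b) \<longleftrightarrow> represents I p (b, a)"
  unfolding represents_def same_ends_swap[of a b] ..

lemma has_type_swap: "has_type I g t (a, b) \<longleftrightarrow> has_type I g t (b, a)"
  unfolding has_type_def represents_swap[of I _ a b] ..

lemma has_type_unique: "has_type I g t q \<Longrightarrow> has_type I g t' q \<Longrightarrow> t = t'"
  unfolding has_type_def by (meson linorder_neqE_nat)

lemma has_type_exists:
  assumes "t < K" "represents I (g t) q"
  shows "\<exists>t<K. has_type I g t q"
  using assms exists_least_iff[of "\<lambda>t. represents I (g t) q"] unfolding has_type_def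
  by (metis le_less_trans linorder_le_less_linear)

lemma has_type_same_ends:
  assumes "has_type I g t q" "has_type I g t q'"
  shows "same_ends q q'"
proof -
  obtain k k' where "k < length (gourd_list I)" "g t = gpos I k" "same_ends q (gourd_list I ! k)"
    "k' < length (gourd_list I)" "g t = gpos I k'" "same_ends q' (gourd_list I ! k')"
    using assms unfolding has_type_def represents_def by blast
  then show ?thesis using gpos_inj[of k I k'] by (auto simp: same_ends_def prod_eq_iff)
qed

text \<open>Formulas speak of ordered pairs of positions, matchings of unordered ones. The passage
  is sound because adjacency and \<open>has_type\<close> are symmetric.\<close>

definition pair_type :: "cgp \<Rightarrow> nat \<Rightarrow> (nat \<Rightarrow> nat) \<Rightarrow> nat set \<Rightarrow> nat \<Rightarrow> bool" where
  "pair_type I K g e t \<longleftrightarrow> t < K \<and> (\<exists>i<length (colored_cells I). \<exists>j<length (colored_cells I).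
     e = {cpos I i, cpos I j} \<and> adjacent (fst (colored_cells I ! i)) (fst (colored_cells I ! j)) \<and>
     has_type I g t (snd (colored_cells I ! i), snd (colored_cells I ! j)))"

definition etype :: "cgp \<Rightarrow> nat \<Rightarrow> (nat \<Rightarrow> nat) \<Rightarrow> nat set \<Rightarrow> nat option" where
  "etype I K g e = (if \<exists>t. pair_type I K g e t then Some (SOME t. pair_type I K g e t) else None)"

lemma pair_type_unique:
  assumes "pair_type I K g e t" "pair_type I K g e t'"
  shows "t = t'"
proof -
  obtain i j where ij: "i < length (colored_cells I)" "j < length (colored_cells I)" "e = {cpos I i, cpos I j}"
    "has_type I g t (snd (colored_cells I ! i), snd (colored_cells I ! j))"
    using assms(1) unfolding pair_type_def by blast
  obtain i' j' where ij': "i' < length (colored_cells I)" "j' < length (colored_cells I)" "e = {cpos I i', cpos I j'}"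
    "has_type I g t' (snd (colored_cells I ! i'), snd (colored_cells I ! j'))"
    using assms(2) unfolding pair_type_def by blast
  have "i = i' \<and> j = j' \<or> i = j' \<and> j = i'"
    using ij(1-3) ij'(1-3) cpos_inj[of _ I] by (auto simp: doubleton_eq_iff)
  then show ?thesis using ij(4) ij'(4) has_type_unique has_type_swap by blast
qed

lemma etype_Some: "etype I K g e = Some t \<longleftrightarrow> pair_type I K g e t"
  unfolding etype_def using pair_type_unique someI_ex[of "pair_type I K g e"] by (auto split: if_splits)

lemma pair_type_cells:
  assumes "pair_type I K g e t"
  shows "e \<subseteq> {..<length (inp I)}" "card e = 2" "t < K"
proof -
  obtain i j where ij: "i < length (colored_cells I)" "j < length (colored_cells I)" "e = {cpos I i, cpos I j}"
    "adjacent (fst (colored_cells I ! i)) (fst (colored_cells I ! j))"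
    using assms unfolding pair_type_def by blast
  then show "e \<subseteq> {..<length (inp I)}" using cpos_less by auto
  have "i \<noteq> j" using ij(4) adjacent_irrefl by metis
  then show "card e = 2" using ij cpos_inj[of i I j] by simp
  show "t < K" using assms by (simp add: pair_type_def)
qed

text \<open>\<open>Min\<close> and \<open>Max\<close> order the ends of an edge in the same way as
  \<open>random_bit\<close>.\<close>

definition rbits :: "world \<Rightarrow> nat set \<Rightarrow> nat \<Rightarrow> bool" where
  "rbits w e j \<longleftrightarrow> rnd w [Min e, Max e, j]"

lemma random_bit_iff: "u \<noteq> v \<Longrightarrow> random_bit w u v j \<longleftrightarrow> rbits w {u, v} j"
  by (auto simp: random_bit_def rbits_def min_def max_def)

abbreviation wld :: "cgp \<Rightarrow> (nat \<Rightarrow> bool) \<Rightarrow> world" where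
  "wld I \<rho> \<equiv> world_of (inp I) \<rho>"

lemma edge_type_pair:
  assumes "u < univ (wld I \<rho>)" "v < univ (wld I \<rho>)" "\<And>t. t < K \<Longrightarrow> g t < univ (wld I \<rho>)" "t < K"
  shows "edge_type (wld I \<rho>) g t u v \<longleftrightarrow> u \<noteq> v \<and> etype I K g {u, v} = Some t"
proof -
  have gt: "\<And>t'. t' \<le> t \<Longrightarrow> g t' < univ (wld I \<rho>)" using assms(3,4) by (meson le_less_trans)
  have eq: "edge_type (wld I \<rho>) g t u v \<longleftrightarrow> (\<exists>i<length (colored_cells I). \<exists>j<length (colored_cells I).
      u = cpos I i \<and> v = cpos I j \<and>
      adjacent (fst (colored_cells I ! i)) (fst (colored_cells I ! j)) \<and>
      has_type I g t (snd (colored_cells I ! i), snd (colored_cells I ! j)))"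
    by (rule edge_type_V[OF assms(1,2)]) (rule gt)
  show ?thesis
    unfolding eq etype_Some
  proof
    assume "\<exists>i<length (colored_cells I). \<exists>j<length (colored_cells I). u = cpos I i \<and> v = cpos I j \<and>
      adjacent (fst (colored_cells I ! i)) (fst (colored_cells I ! j)) \<and>
      has_type I g t (snd (colored_cells I ! i), snd (colored_cells I ! j))"
    then obtain i j where ij: "i < length (colored_cells I)" "j < length (colored_cells I)" "u = cpos I i" "v = cpos I j"
      "adjacent (fst (colored_cells I ! i)) (fst (colored_cells I ! j))"
      "has_type I g t (snd (colored_cells I ! i), snd (colored_cells I ! j))" by blast
    have "i \<noteq> j" using ij(5) adjacent_irrefl by metis
    then show "u \<noteq> v \<and> pair_type I K g {u, v} t"
      using ij assms(4) cpos_inj[of i I j] unfolding pair_type_def by auto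
  next
    assume "u \<noteq> v \<and> pair_type I K g {u, v} t"
    then obtain i j where ij: "i < length (colored_cells I)" "j < length (colored_cells I)" "{u, v} = {cpos I i, cpos I j}"
      "adjacent (fst (colored_cells I ! i)) (fst (colored_cells I ! j))"
      "has_type I g t (snd (colored_cells I ! i), snd (colored_cells I ! j))"
      unfolding pair_type_def by blast
    then consider "u = cpos I i" "v = cpos I j" | "u = cpos I j" "v = cpos I i"
      by (auto simp: doubleton_eq_iff)
    then show "\<exists>i<length (colored_cells I). \<exists>j<length (colored_cells I). u = cpos I i \<and> v = cpos I j \<and>
      adjacent (fst (colored_cells I ! i)) (fst (colored_cells I ! j)) \<and>
      has_type I g t (snd (colored_cells I ! i), snd (colored_cells I ! j))"
      using ij adjacent_sym has_type_swap by cases blast+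
  qed
qed

lemma gourd_step_iff:
  assumes g: "\<And>t. t < K \<Longrightarrow> g t < univ (wld I \<rho>)"
    and s: "s \<in> tuples (3 + K) (univ (wld I \<rho>))" "s' \<in> tuples (3 + K) (univ (wld I \<rho>))"
  shows "gourd_step K (wld I \<rho>) g s s' \<longleftrightarrow>
    walk_step (length (inp I)) (etype I K g) (rbits (wld I \<rho>)) s s'"
proof -
  let ?B = "univ (wld I \<rho>)" and ?L = "length (inp I)"
  have len: "length s = 3 + K" "length s' = 3 + K" using s by (auto simp: tuples_def)
  have s1: "s ! 1 < ?B" using tuples_nth[OF s(1), of 1] by simp
  have upd: "(\<forall>i<K. if i = t then s' ! (3 + i) = Suc (s ! (3 + i)) else s' ! (3 + i) = s ! (3 + i)) \<longleftrightarrow>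
      drop 3 s' = (drop 3 s)[t := Suc (drop 3 s ! t)]" if "t < K" for t
    using len that by (auto simp: list_eq_iff_nth_eq nth_list_update)
  have LB: "j < ?L \<Longrightarrow> j < ?B" for j using length_less_univ[of "inp I" \<rho>] by linarith
  define C where "C = (\<lambda>v. s' ! 0 = s ! 0 \<and> s' ! 1 = v \<and> s ! 0 < v \<or> v = s ! 0 \<and> s' ! 1 = s' ! 0 \<and> s ! 0 < s' ! 0)"
  have "gourd_step K (wld I \<rho>) g s s' \<longleftrightarrow> (\<exists>v<?B. \<exists>j<?B. (\<exists>t<K. edge_type (wld I \<rho>) g t (s ! 1) v \<and>
      drop 3 s' = (drop 3 s)[t := Suc (drop 3 s ! t)]) \<and> random_bit (wld I \<rho>) (s ! 1) v j \<and>
      \<not> isPad (wld I \<rho>) j \<and> s' ! 2 = s ! 2 + j \<and> C v)"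
    unfolding gourd_step_def C_def using upd by (simp cong: conj_cong del: length_pad)
  also have "\<dots> \<longleftrightarrow> (\<exists>v t j. (s ! 1 \<noteq> v \<and> etype I K g {s ! 1, v} = Some t \<and> j < ?L \<and>
      rbits (wld I \<rho>) {s ! 1, v} j \<and> s' ! 2 = s ! 2 + j \<and>
      drop 3 s' = (drop 3 s)[t := Suc (drop 3 s ! t)]) \<and> C v)"
  proof
    assume "\<exists>v<?B. \<exists>j<?B. (\<exists>t<K. edge_type (wld I \<rho>) g t (s ! 1) v \<and>
      drop 3 s' = (drop 3 s)[t := Suc (drop 3 s ! t)]) \<and> random_bit (wld I \<rho>) (s ! 1) v j \<and>
      \<not> isPad (wld I \<rho>) j \<and> s' ! 2 = s ! 2 + j \<and> C v"
    then obtain v j t where a: "v < ?B" "j < ?B" "t < K" "edge_type (wld I \<rho>) g t (s ! 1) v"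
      "drop 3 s' = (drop 3 s)[t := Suc (drop 3 s ! t)]" "random_bit (wld I \<rho>) (s ! 1) v j"
      "\<not> isPad (wld I \<rho>) j" "s' ! 2 = s ! 2 + j" "C v" by blast
    have e: "s ! 1 \<noteq> v" "etype I K g {s ! 1, v} = Some t"
      using edge_type_pair[OF s1 a(1) g a(3)] a(4) by auto
    have "j < ?L" using isPad_W[OF a(2)] a(7) by simp
    moreover have "rbits (wld I \<rho>) {s ! 1, v} j" using a(6) random_bit_iff[OF e(1)] by simp
    ultimately show "\<exists>v t j. (s ! 1 \<noteq> v \<and> etype I K g {s ! 1, v} = Some t \<and> j < ?L \<and>
      rbits (wld I \<rho>) {s ! 1, v} j \<and> s' ! 2 = s ! 2 + j \<and>
      drop 3 s' = (drop 3 s)[t := Suc (drop 3 s ! t)]) \<and> C v" using e a(5,8,9) by blast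
  next
    assume "\<exists>v t j. (s ! 1 \<noteq> v \<and> etype I K g {s ! 1, v} = Some t \<and> j < ?L \<and>
      rbits (wld I \<rho>) {s ! 1, v} j \<and> s' ! 2 = s ! 2 + j \<and>
      drop 3 s' = (drop 3 s)[t := Suc (drop 3 s ! t)]) \<and> C v"
    then obtain v t j where a: "s ! 1 \<noteq> v" "etype I K g {s ! 1, v} = Some t" "j < ?L"
      "rbits (wld I \<rho>) {s ! 1, v} j" "s' ! 2 = s ! 2 + j"
      "drop 3 s' = (drop 3 s)[t := Suc (drop 3 s ! t)]" "C v" by blast
    have t: "t < K" and v: "v < ?B"
      using pair_type_cells[of I K g "{s ! 1, v}" t] a(2) LB[of v] by (auto simp: etype_Some simp del: length_pad)
    have "edge_type (wld I \<rho>) g t (s ! 1) v" using edge_type_pair[OF s1 v g t] a(1,2) by simp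
    moreover have "random_bit (wld I \<rho>) (s ! 1) v j" using a(4) random_bit_iff[OF a(1)] by simp
    moreover have "\<not> isPad (wld I \<rho>) j" using isPad_W[OF LB[OF a(3)]] a(3) by simp
    ultimately show "\<exists>v<?B. \<exists>j<?B. (\<exists>t<K. edge_type (wld I \<rho>) g t (s ! 1) v \<and>
      drop 3 s' = (drop 3 s)[t := Suc (drop 3 s ! t)]) \<and> random_bit (wld I \<rho>) (s ! 1) v j \<and>
      \<not> isPad (wld I \<rho>) j \<and> s' ! 2 = s ! 2 + j \<and> C v" using t v LB[OF a(3)] a(5-7) by blast
  qed
  also have "\<dots> \<longleftrightarrow> walk_step (length (inp I)) (etype I K g) (rbits (wld I \<rho>)) s s'"
    unfolding walk_step_def traverse_def C_def by blast
  finally show ?thesis .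
qed

section \<open>Acceptance as a nonzero coefficient of a matching polynomial\<close>

definition counts :: "cgp \<Rightarrow> nat \<Rightarrow> (nat \<Rightarrow> nat) \<Rightarrow> nat list" where
  "counts I K g = map (\<lambda>t. 2 * card {i. i < length (gourd_list I) \<and> has_type I g t (gourd_list I ! i)}) [0..<K]"

definition covers :: "cgp \<Rightarrow> nat \<Rightarrow> (nat \<Rightarrow> nat) \<Rightarrow> bool" where
  "covers I K g \<longleftrightarrow> (\<forall>i<length (gourd_list I). \<exists>t<K. represents I (g t) (gourd_list I ! i))"

abbreviation size_univ :: "cgp \<Rightarrow> nat" where
  "size_univ I \<equiv> length (pad (inp I))"

definition match_poly :: "cgp \<Rightarrow> nat \<Rightarrow> (nat \<Rightarrow> nat) \<Rightarrow> nat \<Rightarrow> (nat \<Rightarrow> bool) \<Rightarrow> bit poly" where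
  "match_poly I K g n \<rho> = (\<Sum>M\<in>typed_matchings (etype I K g) (size_univ I) n (counts I K g).
     (\<Prod>e\<in>M. rpoly (length (inp I)) (rbits (wld I \<rho>)) e)\<^sup>2)"

lemma size_univ_pos: "0 < size_univ I" by simp

lemma univ_wld: "univ (wld I \<rho>) = size_univ I" by (simp add: world_of_def)

lemma counts_tuples: "counts I K g \<in> tuples K (size_univ I)"
proof -
  have "2 * card {i. i < length (gourd_list I) \<and> has_type I g t (gourd_list I ! i)} < size_univ I" for t
  proof -
    have "card {i. i < length (gourd_list I) \<and> has_type I g t (gourd_list I ! i)} \<le> card {..<length (gourd_list I)}"
      by (rule card_mono) auto
    then show ?thesis using ng_le[of I] by simp
  qed
  then show ?thesis by (auto simp: counts_def tuples_def simp del: length_pad)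
qed

theorem gourd_formula_iff:
  "gourd_formula K (wld I \<rho>) \<longleftrightarrow> (\<exists>g\<in>tuples K (size_univ I). covers I K (\<lambda>t. g ! t) \<and>
     (\<exists>n<size_univ I. \<exists>x<size_univ I. coeff (match_poly I K (\<lambda>t. g ! t) n \<rho>) x = 1))"
proof -
  let ?B = "size_univ I"
  have main: "(\<exists>cs\<in>tuples K ?B. (\<forall>t<K. gourd_count (wld I \<rho>) (\<lambda>t. g ! t) t (cs ! t)) \<and>
       (\<exists>n<?B. \<exists>x<?B. \<exists>z<?B. isPad (wld I \<rho>) z \<and>
         odd_walks (3 + K) ?B (walk_init K) (gourd_step K (wld I \<rho>) (\<lambda>t. g ! t)) n (z # z # x # cs))) \<longleftrightarrow>
      (\<exists>n<?B. \<exists>x<?B. coeff (match_poly I K (\<lambda>t. g ! t) n \<rho>) x = 1)"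
    if g: "g \<in> tuples K ?B" for g
  proof -
    have gB: "g ! t < univ (wld I \<rho>)" if "t < K" for t
      using tuples_nth[OF g that] unfolding univ_wld .
    have cnt: "(\<forall>t<K. gourd_count (wld I \<rho>) (\<lambda>t. g ! t) t (cs ! t)) \<longleftrightarrow> cs = counts I K (\<lambda>t. g ! t)"
      if cs: "cs \<in> tuples K ?B" for cs
    proof -
      have "gourd_count (wld I \<rho>) (\<lambda>t. g ! t) t (cs ! t) \<longleftrightarrow>
          cs ! t = 2 * card {i. i < length (gourd_list I) \<and> has_type I (\<lambda>t. g ! t) t (gourd_list I ! i)}" if "t < K" for t
      proof (rule gourd_count_V)
        show "cs ! t < univ (wld I \<rho>)"
          using tuples_nth[OF cs that] unfolding univ_wld .
      qed (use gB that in auto)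
      moreover have "length cs = K" using cs by (simp add: tuples_def)
      ultimately show ?thesis by (auto simp: counts_def list_eq_iff_nth_eq)
    qed
    have odd_walks: "odd_walks (3 + K) ?B (walk_init K) (gourd_step K (wld I \<rho>) (\<lambda>t. g ! t)) n (z # z # x # counts I K (\<lambda>t. g ! t)) \<longleftrightarrow>
        coeff (match_poly I K (\<lambda>t. g ! t) n \<rho>) x = 1"
      if z: "z < ?B" "isPad (wld I \<rho>) z" and x: "x < ?B" for n x z
    proof -
      have Lz: "length (inp I) \<le> z" using z isPad_W[of z "inp I" \<rho>] by (simp add: univ_wld del: length_pad)
      have "odd_walks (3 + K) ?B (walk_init K) (gourd_step K (wld I \<rho>) (\<lambda>t. g ! t)) n (z # z # x # counts I K (\<lambda>t. g ! t)) \<longleftrightarrow>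
        odd_walks (3 + K) ?B (walk_init K) (walk_step (length (inp I)) (etype I K (\<lambda>t. g ! t)) (rbits (wld I \<rho>))) n (z # z # x # counts I K (\<lambda>t. g ! t))"
      proof (rule odd_walks_cong)
        show "z # z # x # counts I K (\<lambda>t. g ! t) \<in> tuples (3 + K) ?B"
          using z x counts_tuples[of I K "\<lambda>t. g ! t"] by (simp add: tuples_def del: length_pad)
      qed (use gourd_step_iff[OF gB] in \<open>simp add: univ_wld del: length_pad\<close>)
      also have "\<dots> \<longleftrightarrow> coeff (match_poly I K (\<lambda>t. g ! t) n \<rho>) x = 1"
        unfolding match_poly_def
      proof (rule odd_walks_matchings[OF _ _ z(1) x counts_tuples])
        show "t < K" if "etype I K (\<lambda>t. g ! t) e = Some t" for e t
          using that pair_type_cells(3) by (simp add: etype_Some)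
        show "e \<subseteq> {..<z}" if "etype I K (\<lambda>t. g ! t) e = Some t" for e t
          using that pair_type_cells(1) Lz unfolding etype_Some by fastforce
      qed
      finally show ?thesis .
    qed
    \<comment> \<open>The last position is always padding, and the parity is the same for all padded
      \<open>z\<close>.\<close>
    have "?B - 1 < ?B" "isPad (wld I \<rho>) (?B - 1)"
      using isPad_W[of "?B - 1" "inp I" \<rho>] by (simp_all add: univ_wld)
    then show ?thesis using cnt odd_walks counts_tuples[of I K "\<lambda>t. g ! t"] by (metis (no_types, lifting))
  qed
  have cov: "covering K (wld I \<rho>) (\<lambda>t. g ! t) \<longleftrightarrow> covers I K (\<lambda>t. g ! t)" if "g \<in> tuples K ?B" for g
    unfolding covers_def
    by (rule covering_V) (use tuples_nth[OF that] in \<open>simp add: univ_wld del: length_pad\<close>)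
  show ?thesis unfolding gourd_formula_def univ_wld using main cov by (simp cong: bex_cong del: length_pad)
qed

section \<open>Placements correspond to typed matchings\<close>

context
  fixes I :: cgp
  assumes inst: "cgp_instance I"
begin

abbreviation "cells \<equiv> colored_cells I"
abbreviation "gourds \<equiv> gourd_list I"
abbreviation "cell_of i \<equiv> fst (cells ! i)"
abbreviation "col_of i \<equiv> snd (cells ! i)"

lemma distinct_cells: "distinct (map fst cells)" using inst by (simp add: cgp_instance_def)

lemma cell_of_inj: "i < length cells \<Longrightarrow> j < length cells \<Longrightarrow> cell_of i = cell_of j \<longleftrightarrow> i = j"
  using distinct_cells by (auto simp: distinct_conv_nth)

lemma cell_of_board: "i < length cells \<Longrightarrow> cell_of i \<in> cgp_board I"
  by (auto simp: cgp_board_def)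

lemma board_index: "u \<in> cgp_board I \<Longrightarrow> \<exists>i<length cells. u = cell_of i"
  by (auto simp: cgp_board_def in_set_conv_nth) (metis fst_conv)

lemma color_cell_of:
  assumes "i < length cells"
  shows "cgp_color I (cell_of i) = col_of i"
proof -
  have "(cell_of i, col_of i) \<in> set cells" using assms by simp
  then have "map_of cells (cell_of i) = Some (col_of i)"
    using distinct_cells by (simp add: map_of_eq_Some_iff)
  then show ?thesis by (simp add: cgp_color_def)
qed

lemma card_type_filter:
  "card {i. i < length gourds \<and> Q (gourds ! i)} = size (filter_mset Q (mset gourds))"
  by (metis length_filter_conv_card mset_filter size_mset)

text \<open>The placed pairs become disjoint edges on cell positions. Each carries the colors of
  some gourd and hence, by the covering, a type; equality of the color multisets gives the required
  count for each type.\<close>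

lemma placeable_matching:
  assumes "cgp_yes I" and cov: "covers I K g"
  shows "typed_matchings (etype I K g) (size_univ I) (2 * length gourds) (counts I K g) \<noteq> {}"
proof -
  obtain P where P0: "P \<subseteq> cgp_board I \<times> cgp_board I" "\<forall>p\<in>P. adjacent (fst p) (snd p)"
    "\<forall>p\<in>P. \<forall>q\<in>P. p \<noteq> q \<longrightarrow> {fst p, snd p} \<inter> {fst q, snd q} = {}"
    "image_mset (\<lambda>(u, v). (cgp_color I u, cgp_color I v)) (mset_set P) = mset gourds"
  proof -
    obtain P where P: "P \<subseteq> cgp_board I \<times> cgp_board I" "\<forall>(u, v)\<in>P. adjacent u v"
      "\<forall>(u, v)\<in>P. \<forall>(u', v')\<in>P. (u, v) \<noteq> (u', v') \<longrightarrow> {u, v} \<inter> {u', v'} = {}"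
      "image_mset (\<lambda>(u, v). (cgp_color I u, cgp_color I v)) (mset_set P) = mset gourds"
      using assms(1) unfolding cgp_yes_def placeable_def cgp_gourds_def by (elim exE conjE) (rule that)
    show ?thesis
      by (rule that[OF P(1) P(2)[unfolded case_prod_beta] P(3)[unfolded case_prod_beta prod.collapse] P(4)])
  qed
  note P = P0(1) bspec[OF P0(2)] P0(3)[rule_format] P0(4)
  have finP: "finite P" using finite_subset[OF P(1)] by (simp add: cgp_board_def)
  define ix where "ix = (\<lambda>u. SOME i. i < length cells \<and> u = cell_of i)"
  have ix: "ix u < length cells" "cell_of (ix u) = u" if "u \<in> cgp_board I" for u
    using someI_ex[OF board_index[OF that]] unfolding ix_def by metis+
  define E where "E = (\<lambda>p. {cpos I (ix (fst p)), cpos I (ix (snd p))})"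
  have inB: "fst p \<in> cgp_board I" "snd p \<in> cgp_board I" if "p \<in> P" for p using P(1) that by auto
  have cpos_ix: "cpos I (ix u) = cpos I (ix v) \<longleftrightarrow> u = v" if "u \<in> cgp_board I" "v \<in> cgp_board I" for u v
    using cpos_inj[OF less_imp_le[OF ix(1)[OF that(1)]] less_imp_le[OF ix(1)[OF that(2)]]]
      ix(2)[OF that(1)] ix(2)[OF that(2)] by metis
  have disj: "E p \<inter> E q = {}" if "p \<in> P" "q \<in> P" "p \<noteq> q" for p q
  proof -
    have "fst p \<noteq> fst q" "fst p \<noteq> snd q" "snd p \<noteq> fst q" "snd p \<noteq> snd q"
      using P(3)[OF that] by auto
    then show ?thesis
      using cpos_ix[OF inB(1)[OF that(1)] inB(1)[OF that(2)]] cpos_ix[OF inB(1)[OF that(1)] inB(2)[OF that(2)]]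
        cpos_ix[OF inB(2)[OF that(1)] inB(1)[OF that(2)]] cpos_ix[OF inB(2)[OF that(1)] inB(2)[OF that(2)]]
      by (simp add: E_def)
  qed
  have inj: "inj_on E P"
  proof (rule inj_onI, rule ccontr)
    fix p q assume "p \<in> P" "q \<in> P" "E p = E q" "p \<noteq> q"
    then show False using disj[of p q] by (simp add: E_def)
  qed
  have colors: "(cgp_color I (fst p), cgp_color I (snd p)) \<in> set gourds" if "p \<in> P" for p
  proof -
    have "(cgp_color I (fst p), cgp_color I (snd p)) \<in># image_mset (\<lambda>(u, v). (cgp_color I u, cgp_color I v)) (mset_set P)"
      using that finP by (auto intro!: image_eqI[of _ _ p] simp: case_prod_beta)
    then show ?thesis unfolding P(4) by simp
  qed
  have type: "etype I K g (E p) = Some t \<longleftrightarrow> t < K \<and> has_type I g t (cgp_color I (fst p), cgp_color I (snd p))"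
    if p: "p \<in> P" for p t
  proof -
    note i = ix[OF inB(1)[OF p]] ix[OF inB(2)[OF p]]
    have c: "cgp_color I (fst p) = col_of (ix (fst p))" "cgp_color I (snd p) = col_of (ix (snd p))"
      using color_cell_of i by metis+
    have adj: "adjacent (fst p) (snd p)" using P(2)[of p] p by simp
    have dir: "pair_type I K g (E p) t" if "t < K" "has_type I g t (cgp_color I (fst p), cgp_color I (snd p))" for t
      unfolding pair_type_def E_def using that i adj c by (intro conjI exI[of _ "ix (fst p)"] exI[of _ "ix (snd p)"]) auto
    obtain k where k: "k < length gourds" "gourds ! k = (cgp_color I (fst p), cgp_color I (snd p))"
      using colors[OF p] by (auto simp: in_set_conv_nth)
    then obtain t0 where "t0 < K" "has_type I g t0 (cgp_color I (fst p), cgp_color I (snd p))"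
      using cov has_type_exists unfolding covers_def by metis
    then show ?thesis using dir pair_type_unique has_type_unique unfolding etype_Some by metis
  qed
  have typed: "\<exists>t. etype I K g (E p) = Some t" if p: "p \<in> P" for p
  proof -
    obtain k where k: "k < length gourds" "gourds ! k = (cgp_color I (fst p), cgp_color I (snd p))"
      using colors[OF p] by (auto simp: in_set_conv_nth)
    then show ?thesis using cov has_type_exists type[OF p] unfolding covers_def by metis
  qed
  have "E ` P \<in> matchings {..<size_univ I}"
  proof -
    have "E p \<subseteq> {..<size_univ I} \<and> card (E p) = 2" if p: "p \<in> P" for p
    proof -
      obtain t where "pair_type I K g (E p) t" using typed[OF p] etype_Some by blast
      from pair_type_cells[OF this] show ?thesis by auto
    qed
    moreover have "pairwise disjnt (E ` P)"
      using disj unfolding pairwise_def disjnt_def by blast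
    ultimately show ?thesis unfolding matchings_def by blast
  qed
  moreover have "card (E ` P) = length gourds"
    using card_image[OF inj] arg_cong[OF P(4), of size] by simp
  moreover have "card {e \<in> E ` P. etype I K g e = Some t} =
      card {i. i < length gourds \<and> has_type I g t (gourds ! i)}" if t: "t < K" for t
  proof -
    let ?c = "\<lambda>(u, v). (cgp_color I u, cgp_color I v)"
    have "{e \<in> E ` P. etype I K g e = Some t} = E ` {p \<in> P. has_type I g t (?c p)}"
      using type t by (auto simp: case_prod_beta)
    then have "card {e \<in> E ` P. etype I K g e = Some t} = card {p \<in> P. has_type I g t (?c p)}"
      using card_image[OF inj_on_subset[OF inj, of "{p \<in> P. has_type I g t (?c p)}"]] by auto
    also have "\<dots> = size (filter_mset (has_type I g t) (image_mset ?c (mset_set P)))"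
      using finP by (simp add: filter_mset_image_mset filter_mset_mset_set comp_def)
    also have "\<dots> = card {i. i < length gourds \<and> has_type I g t (gourds ! i)}"
      unfolding P(4) card_type_filter ..
    finally show ?thesis .
  qed
  ultimately have "E ` P \<in> typed_matchings (etype I K g) (size_univ I) (2 * length gourds) (counts I K g)"
    using typed by (auto simp: typed_matchings_def counts_def)
  then show ?thesis by blast
qed

text \<open>Within each type edges and gourds are equally many, and equal types mean equal colors up
  to orientation. Any bijection that respects types therefore places the gourds.\<close>

lemma matching_placeable:
  assumes M: "M \<in> typed_matchings (etype I K g) B n (counts I K g)" and cov: "covers I K g"
  shows "cgp_yes I"
proof -
  have mat: "M \<in> matchings {..<B}" and typed: "\<And>e. e \<in> M \<Longrightarrow> \<exists>t. etype I K g e = Some t"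
    and cnt: "\<And>t. t < K \<Longrightarrow> card {e \<in> M. etype I K g e = Some t} = card {i. i < length gourds \<and> has_type I g t (gourds ! i)}"
    using M by (auto simp: typed_matchings_def counts_def)
  have finM: "finite M" using finite_matching[OF _ mat] by simp
  \<comment> \<open>One bijection for each type; \<open>F\<close> glues them together, since every
    edge and every gourd has exactly one type.\<close>
  define f where "f = (\<lambda>t. SOME f. bij_betw f {e \<in> M. etype I K g e = Some t}
      {i. i < length gourds \<and> has_type I g t (gourds ! i)})"
  have f: "bij_betw (f t) {e \<in> M. etype I K g e = Some t} {i. i < length gourds \<and> has_type I g t (gourds ! i)}"
    if "t < K" for t
  proof -
    have "finite {e \<in> M. etype I K g e = Some t}" using finM by simp
    from someI_ex[OF finite_same_card_bij[OF this _ cnt[OF that]]] show ?thesis by (simp add: f_def)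
  qed
  define F where "F = (\<lambda>e. f (the (etype I K g e)) e)"
  have tK: "t < K" if "etype I K g e = Some t" for e t using that pair_type_cells(3) by (simp add: etype_Some)
  have F: "F e < length gourds" "has_type I g t (gourds ! F e)" if "e \<in> M" "etype I K g e = Some t" for e t
    using bij_betwE[OF f[OF tK[OF that(2)]]] that unfolding F_def by auto
  have bij: "bij_betw F M {..<length gourds}"
  proof (rule bij_betw_imageI, rule inj_onI, rule_tac [2] equalityI, rule_tac [2-3] subsetI)
    fix e e' assume e: "e \<in> M" "e' \<in> M" and eq: "F e = F e'"
    obtain t t' where t: "etype I K g e = Some t" "etype I K g e' = Some t'" using typed e by blast
    have "t = t'" using F(2)[OF e(1) t(1)] F(2)[OF e(2) t(2)] eq has_type_unique by metis
    then show "e = e'"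
      using inj_onD[OF bij_betw_imp_inj_on[OF f[OF tK[OF t(1)]]], of e e'] t e eq by (simp add: F_def)
  next
    fix i assume "i \<in> F ` M"
    then show "i \<in> {..<length gourds}" using typed F(1) by blast
  next
    fix i assume "i \<in> {..<length gourds}"
    then have i: "i < length gourds" by simp
    obtain t where t: "t < K" "has_type I g t (gourds ! i)"
      using i cov has_type_exists unfolding covers_def by metis
    have "i \<in> f t ` {e \<in> M. etype I K g e = Some t}"
      unfolding bij_betw_imp_surj_on[OF f[OF t(1)]] using i t(2) by simp
    then obtain e where "e \<in> M" "etype I K g e = Some t" "f t e = i" by blast
    then show "i \<in> F ` M" by (auto simp: F_def intro!: image_eqI[of _ _ e])
  qed
  have "\<exists>i j. i < length cells \<and> j < length cells \<and> e = {cpos I i, cpos I j} \<and>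
      adjacent (cell_of i) (cell_of j) \<and> (col_of i, col_of j) = gourds ! F e" if e: "e \<in> M" for e
  proof -
    obtain t where t: "etype I K g e = Some t" using typed e by blast
    then obtain i j where ij: "i < length cells" "j < length cells" "e = {cpos I i, cpos I j}"
      "adjacent (cell_of i) (cell_of j)" "has_type I g t (col_of i, col_of j)"
      unfolding etype_Some pair_type_def by blast
    have "same_ends (col_of i, col_of j) (gourds ! F e)"
      by (rule has_type_same_ends[OF ij(5) F(2)[OF e t]])
    then consider "(col_of i, col_of j) = gourds ! F e" | "(col_of j, col_of i) = gourds ! F e"
      by (auto simp: same_ends_def)
    then show ?thesis
    proof cases
      case 1
      then show ?thesis using ij by blast
    next
      case 2
      have "e = {cpos I j, cpos I i}" using ij(3) by auto
      then show ?thesis using 2 ij adjacent_sym by blast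
    qed
  qed
  \<comment> \<open>The ends of each edge are ordered so that their colors agree with the assigned
    gourd in the order in which its pair is written.\<close>
  then obtain a b where ends: "\<And>e. e \<in> M \<Longrightarrow> e = {cpos I (a e), cpos I (b e)}"
    and ab: "\<And>e. e \<in> M \<Longrightarrow> a e < length cells" "\<And>e. e \<in> M \<Longrightarrow> b e < length cells"
      "\<And>e. e \<in> M \<Longrightarrow> adjacent (cell_of (a e)) (cell_of (b e))"
      "\<And>e. e \<in> M \<Longrightarrow> (col_of (a e), col_of (b e)) = gourds ! F e"
    by metis
  define h where "h = (\<lambda>e. (cell_of (a e), cell_of (b e)))"
  have disj: "{fst (h e), snd (h e)} \<inter> {fst (h e'), snd (h e')} = {}" if "e \<in> M" "e' \<in> M" "e \<noteq> e'" for e e'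
  proof -
    have "e \<inter> e' = {}" using mat that unfolding matchings_def pairwise_def disjnt_def by blast
    then have "a e \<noteq> a e'" "a e \<noteq> b e'" "b e \<noteq> a e'" "b e \<noteq> b e'"
      using ends[OF that(1)] ends[OF that(2)] by (metis disjoint_iff insertI1 insertI2)+
    then show ?thesis using ab(1,2)[OF that(1)] ab(1,2)[OF that(2)] by (simp add: h_def cell_of_inj)
  qed
  have inj: "inj_on h M"
  proof (rule inj_onI, rule ccontr)
    fix e e' assume "e \<in> M" "e' \<in> M" "h e = h e'" "e \<noteq> e'"
    then show False using disj[of e e'] by simp
  qed
  have "image_mset (\<lambda>(u, v). (cgp_color I u, cgp_color I v)) (mset_set (h ` M)) =
      image_mset (\<lambda>e. gourds ! F e) (mset_set M)"
    unfolding image_mset_mset_set[OF inj, symmetric] multiset.map_comp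
    using finM ab color_cell_of by (intro image_mset_cong) (auto simp: h_def)
  also have "\<dots> = image_mset (\<lambda>i. gourds ! i) (image_mset F (mset_set M))"
    by (simp add: multiset.map_comp comp_def)
  also have "image_mset F (mset_set M) = mset_set {..<length gourds}"
    using image_mset_mset_set[of F M] bij by (simp add: bij_betw_def)
  also have "image_mset (\<lambda>i. gourds ! i) (mset_set {..<length gourds}) = mset gourds"
  proof -
    have "mset_set {..<length gourds} = mset [0..<length gourds]" by (simp add: atLeast0LessThan)
    then show ?thesis by (metis map_nth mset_map)
  qed
  finally have colors: "image_mset (\<lambda>(u, v). (cgp_color I u, cgp_color I v)) (mset_set (h ` M)) = cgp_gourds I"
    by (simp add: cgp_gourds_def)
  have "h ` M \<subseteq> cgp_board I \<times> cgp_board I" using ab cell_of_board by (auto simp: h_def)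
  moreover have "\<forall>(u, v)\<in>h ` M. adjacent u v" using ab by (auto simp: h_def)
  moreover have "\<forall>p\<in>h ` M. \<forall>q\<in>h ` M. p \<noteq> q \<longrightarrow> {fst p, snd p} \<inter> {fst q, snd q} = {}"
    using disj by (intro ballI impI) (metis imageE)
  then have "\<forall>(u, v)\<in>h ` M. \<forall>(u', v')\<in>h ` M. (u, v) \<noteq> (u', v') \<longrightarrow> {u, v} \<inter> {u', v'} = {}"
    unfolding case_prod_beta prod.collapse .
  ultimately show ?thesis unfolding cgp_yes_def placeable_def using colors by blast
qed

text \<open>Gourds are pairs of colors, so at most \<open>k * k\<close> different ones occur; each
  is represented by a position where it is encoded.\<close>

lemma exists_covers:
  assumes "card (cgp_colors I) \<le> k"
  obtains g where "g \<in> tuples (k * k) (size_univ I)" "covers I (k * k) (\<lambda>t. g ! t)"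
proof -
  define C where "C = cgp_colors I"
  have finC: "finite C" by (auto simp: C_def cgp_colors_def cgp_board_def)
  have "set gourds \<subseteq> C \<times> C" by (force simp: C_def cgp_colors_def cgp_gourds_def)
  then have "card (set gourds) \<le> card C * card C"
    using card_mono[of "C \<times> C" "set gourds"] finC by (simp add: card_cartesian_product)
  also have "\<dots> \<le> k * k" using assms by (intro mult_le_mono) (simp_all add: C_def)
  finally have card: "length (remdups gourds) \<le> k * k" by (simp add: length_remdups_card_conv)
  have "\<exists>i. i < length gourds \<and> gourds ! i = q" if "q \<in> set gourds" for q
    using that by (auto simp: in_set_conv_nth)
  then obtain r where r: "\<And>q. q \<in> set gourds \<Longrightarrow> r q < length gourds \<and> gourds ! r q = q" by metis
  \<comment> \<open>Spare components are filled with position 0, which represents no gourd because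
    every \<open>gpos\<close> is a successor.\<close>
  define g where "g = map (\<lambda>q. gpos I (r q)) (remdups gourds) @ replicate (k * k - length (remdups gourds)) 0"
  have "gpos I i < size_univ I" if "i < length gourds" for i
    using gpos_le[of i I] that by simp
  then have "g \<in> tuples (k * k) (size_univ I)"
    using card r size_univ_pos by (auto simp: g_def tuples_def simp del: length_pad length_greater_0_conv)
  moreover have "covers I (k * k) (\<lambda>t. g ! t)"
    unfolding covers_def
  proof (intro allI impI)
    fix i assume i: "i < length gourds"
    then have "gourds ! i \<in> set (remdups gourds)" by simp
    then obtain t where t: "t < length (remdups gourds)" "remdups gourds ! t = gourds ! i"
      by (metis in_set_conv_nth)
    have "g ! t = gpos I (r (gourds ! i))" using t by (simp add: g_def nth_append)
    then have "represents I (g ! t) (gourds ! i)"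
      unfolding represents_def using r[of "gourds ! i"] i by (auto simp: same_ends_def)
    then show "\<exists>t<k * k. represents I (g ! t) (gourds ! i)" using t(1) card by (meson less_le_trans)
  qed
  ultimately show ?thesis using that by blast
qed

end

text \<open>At most \<open>L / 2\<close> edges, each with a polynomial of degree at most
  \<open>L\<close>, give squares of degree at most \<open>L * L\<close>. The padding makes such
  exponents positions, so the formula can find the leading coefficient.\<close>

lemma match_poly_coeff:
  assumes "match_poly I K g (2 * length (gourd_list I)) \<rho> \<noteq> 0"
  shows "\<exists>x<size_univ I. coeff (match_poly I K g (2 * length (gourd_list I)) \<rho>) x = 1"
proof -
  let ?p = "match_poly I K g (2 * length (gourd_list I)) \<rho>" and ?L = "length (inp I)"
  have "degree ((\<Prod>e\<in>M. rpoly ?L (rbits (wld I \<rho>)) e)\<^sup>2) \<le> ?L * ?L"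
    if M: "M \<in> typed_matchings (etype I K g) (size_univ I) (2 * length (gourd_list I)) (counts I K g)" for M
  proof -
    have "finite M" "2 * card M \<le> ?L"
      using M finite_matching[of "{..<size_univ I}" M] ng_le[of I] by (auto simp: typed_matchings_def simp del: length_pad)
    then show ?thesis
      using degree_prod_rpoly[of M ?L "rbits (wld I \<rho>)"] mult_le_mono1[of "2 * card M" ?L ?L] by (meson le_trans)
  qed
  then have "degree ?p \<le> ?L * ?L"
    unfolding match_poly_def
    by (intro degree_sum_le) (auto simp: typed_matchings_def finite_matchings simp del: length_pad)
  then have "degree ?p < size_univ I" by simp
  moreover have "coeff ?p (degree ?p) = 1" using assms by (metis bit_not_zero_iff leading_coeff_0_iff)
  ultimately show ?thesis by blast
qed

text \<open>The coins behind the coefficients of an edge form its block. The squared edge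
  polynomials determine these coins because squaring is injective in characteristic two, so
  \<open>schwartz_zippel_blocks\<close> applies to all outcomes of \<open>T\<close> coins.\<close>

lemma few_zeros:
  assumes inst: "cgp_instance I" and yes: "cgp_yes I" and cov: "covers I K g"
    and T: "b + 4 * size_univ I ^ 3 \<le> T"
  shows "2 * card {A \<in> Pow {..<T}. match_poly I K g (2 * length (gourd_list I)) (\<lambda>k. b + 4 * k \<in> A) = 0} \<le> 2 ^ T"
proof -
  let ?B = "size_univ I" and ?L = "length (inp I)" and ?n = "length (gourd_list I)"
  define \<rho> where "\<rho> = (\<lambda>A :: nat set. \<lambda>k. b + 4 * k \<in> A)"
  define E where "E = {e. e \<subseteq> {..<?B} \<and> card e = 2}"
  define bit_of where "bit_of = (\<lambda>e j. b + 4 * idx ?B [Min e, Max e, j])"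
  define val where "val = (\<lambda>e A. (rpoly ?L (rbits (wld I (\<rho> A))) e)\<^sup>2)"
  define \<M> where "\<M> = typed_matchings (etype I K g) ?B (2 * ?n) (counts I K g)"
  let ?Z = "{A \<in> Pow {..<T}. (\<Sum>M\<in>\<M>. \<Prod>e\<in>M. val e A) = 0}"
  have "?L < ?B" by simp
  have edge: "finite e" "e = {Min e, Max e}" "Max e < ?B" "Min e < ?B" if "e \<in> E" for e
  proof -
    obtain u v where "e = {u, v}" using \<open>e \<in> E\<close> by (auto simp: E_def card_2_iff)
    then show "finite e" "e = {Min e, Max e}" "Max e < ?B" "Min e < ?B"
      using \<open>e \<in> E\<close> by (auto simp: E_def min_def max_def simp del: length_pad)
  qed
  have tup: "[Min e, Max e, j] \<in> tuples 3 ?B" if "e \<in> E" "j < ?L" for e j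
    using edge[OF that(1)] that(2) \<open>?L < ?B\<close> by (simp add: tuples_def del: length_pad)
  have idx_inj: "idx ?B s = idx ?B t \<longleftrightarrow> s = t" if "s \<in> tuples 3 ?B" "t \<in> tuples 3 ?B" for s t
    using bij_betw_imp_inj_on[OF idx_bij[of ?B]] that by (auto dest: inj_onD)
  have rbits: "rbits (wld I (\<rho> A)) e j \<longleftrightarrow> bit_of e j \<in> A" if "e \<in> E" "j < ?L" for A e j
    using rnd_world_of[of "[Min e, Max e, j]" "inp I" "\<rho> A"] tup[OF that]
    unfolding univ_wld by (simp add: rbits_def \<rho>_def bit_of_def del: length_pad)
  \<comment> \<open>An edge is determined by \<open>Min\<close> and \<open>Max\<close>, and
    \<open>idx\<close> is injective, so different coefficients use different coins.\<close>
  have bit_inj: "e = e' \<and> j = j'" if "bit_of e j = bit_of e' j'" "e \<in> E" "e' \<in> E" "j < ?L" "j' < ?L" for e e' j j'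
    using that idx_inj[OF tup[OF that(2,4)] tup[OF that(3,5)]] edge(2)[OF that(2)] edge(2)[OF that(3)]
    by (simp add: bit_of_def del: length_pad)
  have val_eq: "val e A = val e A' \<longleftrightarrow> A \<inter> bit_of e ` {..<?L} = A' \<inter> bit_of e ` {..<?L}" if "e \<in> E" for e A A'
  proof -
    have "val e A = val e A' \<longleftrightarrow> rpoly ?L (rbits (wld I (\<rho> A))) e = rpoly ?L (rbits (wld I (\<rho> A'))) e"
      unfolding val_def by (auto dest: power2_eq_char2)
    also have "\<dots> \<longleftrightarrow> (\<forall>j<?L. bit_of e j \<in> A \<longleftrightarrow> bit_of e j \<in> A')"
      unfolding rpoly_eq_iff by (simp add: rbits[OF that] cong: imp_cong)
    also have "\<dots> \<longleftrightarrow> A \<inter> bit_of e ` {..<?L} = A' \<inter> bit_of e ` {..<?L}" by blast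
    finally show ?thesis .
  qed
  have zeros: "card ?Z * 2 ^ ?L \<le> ?n * 2 ^ card {..<T}"
  proof (rule schwartz_zippel_blocks)
    fix e assume e: "e \<in> E"
    have "bit_of e j < T" if "j < ?L" for j
      using bij_betwE[OF idx_bij[of ?B]] tup[OF e that] T unfolding bit_of_def by (fastforce simp del: length_pad)
    moreover have "inj_on (bit_of e) {..<?L}" using bit_inj e by (auto simp: inj_on_def)
    ultimately show "bit_of e ` {..<?L} \<subseteq> {..<T} \<and> card (bit_of e ` {..<?L}) = ?L"
      by (auto simp: card_image)
  next
    fix e e' assume "e \<in> E" "e' \<in> E" "e \<noteq> e'"
    then show "bit_of e ` {..<?L} \<inter> bit_of e' ` {..<?L} = {}" using bit_inj by blast
  next
    fix M assume M: "M \<in> \<M>"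
    then have "M \<in> matchings {..<?B}" "card M = ?n" by (auto simp: \<M>_def typed_matchings_def simp del: length_pad)
    then show "finite M \<and> M \<subseteq> E \<and> card M = ?n"
      using finite_matching[of "{..<?B}" M] by (auto simp: matchings_def E_def simp del: length_pad)
  next
    show "finite \<M>" by (simp add: \<M>_def typed_matchings_def finite_matchings del: length_pad)
    show "\<M> \<noteq> {}" unfolding \<M>_def by (rule placeable_matching[OF inst yes cov])
  qed (simp_all add: val_eq del: length_pad)
  \<comment> \<open>For \<open>n\<close> gourds and input length \<open>L\<close> the zeros make up
    at most the fraction \<open>n / 2 ^ L\<close>, and \<open>2 * n \<le> L < 2 ^ L\<close>.\<close>
  have "3 * ?n \<le> ?L" by (rule ng_le)
  moreover have "?L < 2 ^ ?L" by (rule less_exp)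
  ultimately have "2 * ?n \<le> 2 ^ ?L" by linarith
  then have "(2 * ?n) * 2 ^ T \<le> 2 ^ ?L * 2 ^ T" by (rule mult_le_mono1)
  moreover have "(2 * card ?Z) * 2 ^ ?L \<le> (2 * ?n) * 2 ^ T" using zeros by simp
  ultimately have "(2 * card ?Z) * 2 ^ ?L \<le> 2 ^ ?L * 2 ^ T" by (rule le_trans[rotated])
  then have "2 * card ?Z \<le> 2 ^ T" by simp
  moreover have "match_poly I K g (2 * ?n) (\<rho> A) = (\<Sum>M\<in>\<M>. \<Prod>e\<in>M. val e A)" for A
    unfolding match_poly_def \<M>_def val_def by (simp add: prod_power_distrib)
  ultimately show ?thesis unfolding \<rho>_def by simp
qed

section \<open>Acceptance probability and one-sided error\<close>

lemma accept_prob_card: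
  "accept_prob M x T = card {r. length r = T \<and> fst (ptm_run M x r) = accept_state M} / 2 ^ T"
proof -
  have fin: "finite {r :: bool list. length r = T}"
    using bij_betw_finite[OF bij_lists_sets[of T]] by simp
  have "card {r :: bool list. length r = T} = 2 ^ T"
    using bij_betw_same_card[OF bij_lists_sets[of T]] by (simp add: card_Pow)
  moreover have "{r :: bool list. length r = T} \<noteq> {}" by (auto intro: exI[of _ "replicate T False"])
  ultimately show ?thesis
    unfolding accept_prob_def using fin by (simp add: measure_pmf_of_set Collect_conj_eq)
qed

theorem theorem2:
  fixes k :: nat
  shows "solvable_in_randomized_poly_time enc_cgp
           {I. cgp_instance I \<and> card (cgp_colors I) \<le> k} cgp_yes"
proof -
  obtain M p pos where M: "ptm_wf M" "\<And>x. pos x + 4 * length (pad x) ^ 3 \<le> poly p (length x)"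
    "\<And>x r. length r = poly p (length x) \<Longrightarrow> halted M (ptm_run M x r) \<and>
       (fst (ptm_run M x r) = accept_state M \<longleftrightarrow> gourd_formula (k * k) (world_of x (\<lambda>j. r ! (pos x + 4 * j))))"
    using definable_machine[OF definable_gourd_formula[of "k * k"]] by metis
  have "(cgp_yes I \<longrightarrow> accept_prob M (enc_cgp I) (poly p (length (enc_cgp I))) \<ge> 1 / 2) \<and>
      (\<not> cgp_yes I \<longrightarrow> accept_prob M (enc_cgp I) (poly p (length (enc_cgp I))) = 0)"
    if inst: "cgp_instance I" and few: "card (cgp_colors I) \<le> k" for I
  proof -
    define T b where "T = poly p (length (inp I))" and "b = pos (inp I)"
    define R where "R = {r. length r = T \<and> fst (ptm_run M (inp I) r) = accept_state M}"
    have T: "b + 4 * size_univ I ^ 3 \<le> T" unfolding T_def b_def by (rule M(2))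
    have acc: "fst (ptm_run M (inp I) r) = accept_state M \<longleftrightarrow> (\<exists>g\<in>tuples (k * k) (size_univ I). covers I (k * k) (\<lambda>t. g ! t) \<and>
       (\<exists>n<size_univ I. \<exists>x<size_univ I. coeff (match_poly I (k * k) (\<lambda>t. g ! t) n (\<lambda>j. r ! (b + 4 * j))) x = 1))"
      if "length r = T" for r
      using M(3)[OF that[unfolded T_def]] gourd_formula_iff unfolding b_def by simp
    have prob: "accept_prob M (enc_cgp I) (poly p (length (enc_cgp I))) = card R / 2 ^ T"
      unfolding R_def T_def inp_def by (rule accept_prob_card)
    show ?thesis
      unfolding prob
    proof (intro conjI impI)
      assume yes: "cgp_yes I"
      \<comment> \<open>One covering \<open>g\<close> is fixed before the coins are considered, so
        that a single polynomial has to be nonzero; acceptance through another tuple only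
        helps.\<close>
      obtain g where g: "g \<in> tuples (k * k) (size_univ I)" "covers I (k * k) (\<lambda>t. g ! t)"
        using exists_covers[OF inst few] by blast
      let ?n = "2 * length (gourd_list I)"
      let ?p = "\<lambda>A. match_poly I (k * k) (\<lambda>t. g ! t) ?n (\<lambda>j. b + 4 * j \<in> A)"
      let ?set = "\<lambda>r. {j. j < T \<and> r ! j}"
      define Z where "Z = {A \<in> Pow {..<T}. ?p A = 0}"
      note bij = bij_lists_sets[of T]
      have "Pow {..<T} - Z \<subseteq> ?set ` R"
      proof
        fix A assume A: "A \<in> Pow {..<T} - Z"
        then obtain r where r: "length r = T" "A = ?set r"
          using bij_betw_imp_surj_on[OF bij] by blast
        have "\<exists>x<size_univ I. coeff (?p A) x = 1"
          using A by (intro match_poly_coeff) (auto simp: Z_def)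
        moreover have "?p A = match_poly I (k * k) (\<lambda>t. g ! t) ?n (\<lambda>j. r ! (b + 4 * j))"
        proof -
          have "wld I (\<lambda>j. b + 4 * j \<in> A) = wld I (\<lambda>j. r ! (b + 4 * j))"
            using T by (auto simp: world_of_def r(2) simp del: length_pad)
          then show ?thesis unfolding match_poly_def by simp
        qed
        moreover have "?n < size_univ I" using ng_le[of I] by simp
        ultimately show "A \<in> ?set ` R" unfolding R_def using acc[OF r(1)] g r by auto
      qed
      moreover have finR: "finite R"
        using bij_betw_finite[OF bij] by (auto simp: R_def intro: finite_subset[rotated])
      ultimately have "card (Pow {..<T} - Z) \<le> card R" by (rule surj_card_le[rotated])
      moreover have "card (Pow {..<T} - Z) = 2 ^ T - card Z"
        unfolding Z_def by (subst card_Diff_subset) (auto simp: card_Pow)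
      moreover have "2 * card Z \<le> 2 ^ T"
        unfolding Z_def by (rule few_zeros[OF inst yes g(2) T])
      ultimately have "2 ^ T \<le> 2 * card R" by linarith
      then have "real (2 ^ T) \<le> real (2 * card R)" by (rule of_nat_mono)
      then show "1 / 2 \<le> card R / 2 ^ T" by (simp add: field_simps)
    next
      assume no: "\<not> cgp_yes I"
      \<comment> \<open>An accepting run exhibits a nonzero coefficient, so the sum over matchings
        is not empty, whatever \<open>g\<close> and \<open>n\<close> it has found.\<close>
      have "R = {}"
      proof (rule ccontr)
        assume "R \<noteq> {}"
        then obtain r g n x where "covers I (k * k) (\<lambda>t. g ! t)"
          and one: "coeff (match_poly I (k * k) (\<lambda>t. g ! t) n (\<lambda>j. r ! (b + 4 * j))) x = 1"
          unfolding R_def using acc by blast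
        moreover from one have "typed_matchings (etype I (k * k) (\<lambda>t. g ! t)) (size_univ I) n (counts I (k * k) (\<lambda>t. g ! t)) \<noteq> {}"
          unfolding match_poly_def by force
        ultimately show False using matching_placeable[OF inst] no by blast
      qed
      then show "card R / 2 ^ T = 0" by simp
    qed
  qed
  then show ?thesis
    unfolding solvable_in_randomized_poly_time_def using M(1,3) by blast
qed

end
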